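(* Let $\varOmega\Subset T^*\mathbb C^n$ (conically) be an open conic subset, let $z$ and $w$ be local coordinates on a neighborhood of $\operatorname{Cl}\pi(\varOmega)$ with corresponding cotangent coordinates $(z;\zeta)$, $(w;\lambda)$ near $\operatorname{Cl}\varOmega$, and let $z=\varPhi(w)$ be the coordinate transformation. For $P(t;z,\zeta,\eta)\in\widehat{\mathfrak S}(\varOmega;S)$ set $$\varPhi^*P(t;w,\lambda,\eta)=e^{t\langle\partial_{\zeta'},\partial_{z'}\rangle}P\bigl(t;\varPhi(w),\zeta'+{}^{\mathsf t}\!J^*_\varPhi(\varPhi(w)+z',\varPhi(w))\lambda,\eta\bigr)\Big|_{z'=0,\ \zeta'=0}.$$ (1) $\varPhi^*P(t;w,\lambda,\eta)\in\widehat{\mathfrak S}(\varOmega;S)$ with respect to the coordinate system $(w;\lambda)$. Further, if $P(t;z,\zeta,\eta)\in\widehat{\mathfrak N}(\varOmega;S)$, then $\varPhi^*P(t;w,\lambda,\eta)\in\widehat{\mathfrak N}(\varOmega;S)$. (2) $\mathbf 1^*$ is the identity, and for complex coordinate transformations $z=\varPhi(w)$ and $w=\varPsi(v)$ (with cotangent coordinates $(v;\xi)$) one has $$\varPsi^*\varPhi^*P(t;v,\xi,\eta)-(\varPhi\varPsi)^*P(t;v,\xi,\eta)\in\widehat{\mathfrak N}_{(v;\xi)}.$$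
   Context: $\|z\|=\max_i|z_i|$; $\pi:T^*X\to X$ is the projection ($X=\mathbb C^n$); $\mathbf 1$ is the identity transformation. $V\Subset U$ conically means that $V$ is generated by a relatively compact subset of $U$ (contained in $\mathbb R_{>0}K$ with $K\subset U$ compact). $J^*_\varPhi(z',z)$ is a holomorphic $n\times n$ matrix, for $z'$ near $z$, with $\varPhi^{-1}(z')-\varPhi^{-1}(z)=J^*_\varPhi(z',z)(z'-z)$; ${}^{\mathsf t}\!J^*_\varPhi(z,z)\lambda={}^{\mathsf t}[\partial w/\partial z(z)]\lambda=\zeta$ relates the fiber coordinates. For an open conic $\varOmega$ (in given coordinates) and $\rho\ge0$, $\varOmega_\rho$ is the closure of $\bigcup_{(z;\zeta)\in\varOmega}\{(z+z';\zeta+\zeta');\ \|z'\|\le\rho,\ \|\zeta'\|\le\rho\|\zeta\|\}$; $d_\rho=d(1-\rho)$; $S=\{\eta\in\mathbb C;\ 0<|\eta|<r,\ |\arg\eta|<\theta/4\}$ with $r,\theta\in]0,\frac12[$; for $U\subset S$, $(\varOmega_\rho*U)[md_\rho]=\{(z;\zeta,\eta)\in\varOmega_\rho\times U;\ \|\eta\zeta\|\ge md_\rho\}$. Functions on these sets are understood to be holomorphic on neighborhoods; $t$ is an indeterminate. $\widehat{\mathfrak N}(\varOmega;S)$: formal series $P=\sum_{\nu\ge0}t^\nu P_\nu(z,\zeta,\eta)$ such that for some $d>0$, $\rho\in]0,1[$ each $P_\nu$ is holomorphic on $(\varOmega_\rho*S)[(\nu+1)d_\rho]$ and there is $A\in]0,1[$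 such that for every $Z\Subset S$, $h>0$ there is $C_{h,Z}>0$ with $|\sum_{\nu=0}^{m-1}P_\nu|\le C_{h,Z}A^me^{h\|\zeta\|}$ for all $m\in\mathbb N$ on $(\varOmega_\rho*Z)[md_\rho]$. $\widehat{\mathfrak S}(\varOmega;S)$: formal series $P=\sum t^\nu P_\nu$ such that for some $d>0$, $\rho\in]0,1[$ each $P_\nu$ is holomorphic on $(\varOmega_\rho*S)[(\nu+1)d_\rho]$; there is $A\in]0,1[$ such that for every $Z\Subset S$, $h>0$ there is $C_{h,Z}>0$ with $|P_\nu|\le C_{h,Z}A^\nu e^{h\|\zeta\|}$ for all $\nu\ge0$ on $(\varOmega_\rho*Z)[(\nu+1)d_\rho]$; and $\partial_\eta P\in\widehat{\mathfrak N}(\varOmega;S)$. "With respect to $(w;\lambda)$" means that $\varOmega$ is expressed in the coordinates $(w;\lambda)$ and the definitions are applied in those coordinates. $\widehat{\mathfrak N}_{(v;\xi)}$ is the inductive limit of $\widehat{\mathfrak N}(\varOmega';S)$ (in the coordinates $(v;\xi)$) over open conic neighborhoods $\varOmega'$ of the point $(v;\xi)$ and $r,\theta\to0$. *)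

theory Defs
  imports "HOL-Complex_Analysis.Complex_Analysis"
begin

section \<open>Holomorphic maps of several complex variables\<close>

class complex_normed = real_normed_vector +
  fixes scaleC :: "complex \<Rightarrow> 'a \<Rightarrow> 'a"  (infixr \<open>*\<^sub>C\<close> 75)
  assumes scaleC_add_right: "c *\<^sub>C (x + y) = c *\<^sub>C x + c *\<^sub>C y"
    and scaleC_add_left: "(b + c) *\<^sub>C x = b *\<^sub>C x + c *\<^sub>C x"
    and scaleC_scaleC: "b *\<^sub>C c *\<^sub>C x = (b * c) *\<^sub>C x"
    and scaleC_of_real: "complex_of_real a *\<^sub>C x = a *\<^sub>R x"
    and norm_scaleC: "norm (c *\<^sub>C x) = cmod c * norm x"

instantiation complex :: complex_normed
begin
definition scaleC_complex :: "complex \<Rightarrow> complex \<Rightarrow> complex"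
  where "scaleC_complex c x = c * x"
instance
  by standard (simp_all add: scaleC_complex_def algebra_simps scaleR_conv_of_real norm_mult)
end

instantiation prod :: (complex_normed, complex_normed) complex_normed
begin
definition scaleC_prod :: "complex \<Rightarrow> 'a \<times> 'b \<Rightarrow> 'a \<times> 'b"
  where "scaleC_prod c p = (c *\<^sub>C fst p, c *\<^sub>C snd p)"
instance
  by standard
    (simp_all add: scaleC_prod_def prod_eq_iff scaleC_add_right scaleC_add_left
      scaleC_scaleC scaleC_of_real norm_scaleC norm_prod_def power_mult_distrib
      real_sqrt_mult flip: distrib_left)
end

instantiation vec :: (complex_normed, finite) complex_normed
begin
definition scaleC_vec :: "complex \<Rightarrow> ('a, 'b) vec \<Rightarrow> ('a, 'b) vec"
  where "scaleC_vec c x = (\<chi> i. c *\<^sub>C (x $ i))"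
instance
  by standard
    (simp_all add: scaleC_vec_def vec_eq_iff scaleC_add_right scaleC_add_left
      scaleC_scaleC scaleC_of_real norm_scaleC norm_vec_def L2_set_right_distrib)
end

text \<open>Used for open \<open>U\<close> only.\<close>

definition holo_on :: "('a::complex_normed \<Rightarrow> 'b::complex_normed) \<Rightarrow> 'a set \<Rightarrow> bool"
  where "holo_on f U \<longleftrightarrow>
    (\<forall>x\<in>U. \<exists>D. (f has_derivative D) (at x) \<and> (\<forall>c h. D (c *\<^sub>C h) = c *\<^sub>C D h))"

definition holo_near :: "('a::complex_normed \<Rightarrow> 'b::complex_normed) \<Rightarrow> 'a set \<Rightarrow> bool"
  where "holo_near f A \<longleftrightarrow> (\<exists>N. open N \<and> A \<subseteq> N \<and> holo_on f N)"

definition maxnorm :: "complex^'n \<Rightarrow> real"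
  where "maxnorm z = Max (range (\<lambda>i. cmod (z $ i)))"


section \<open>Conic sets and local coordinates of the cotangent bundle\<close>

text \<open>The cotangent bundle of complex n-space is the type of pairs \<open>(x, \<xi>)\<close>, and the
  projection is \<open>fst\<close>.\<close>

type_synonym 'n cotangent = "(complex^'n) \<times> (complex^'n)"

definition fiber_conic :: "'n::finite cotangent set \<Rightarrow> bool"
  where "fiber_conic V \<longleftrightarrow> (\<forall>(x, \<xi>)\<in>V. \<forall>c::real. 0 < c \<longrightarrow> (x, c *\<^sub>R \<xi>) \<in> V)"

definition conically_rel_compact :: "'n::finite cotangent set \<Rightarrow> 'n cotangent set \<Rightarrow> bool"
  where "conically_rel_compact V U \<longleftrightarrow>
    (\<exists>K. compact K \<and> K \<subseteq> U \<and> V \<subseteq> {(x, c *\<^sub>R \<xi>) | x \<xi> c. (x, \<xi>) \<in> K \<and> 0 < (c::real)})"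

definition local_coords :: "(complex^'n) set \<Rightarrow> (complex^'n \<Rightarrow> complex^'n) \<Rightarrow> bool"
  where "local_coords W \<phi> \<longleftrightarrow> open W \<and> inj_on \<phi> W \<and> holo_on \<phi> W \<and>
    open (\<phi> ` W) \<and> holo_on (inv_into W \<phi>) (\<phi> ` W)"

text \<open>A covector over \<open>x\<close> with fiber coordinate \<open>\<zeta>\<close> with respect to \<open>\<phi>\<close> is
  \<open>\<Sum>j. \<zeta>\<^sub>j d\<phi>\<^sub>j\<close>, so its standard coordinate is the transposed Jacobian of \<open>\<phi>\<close> applied
  to \<open>\<zeta>\<close>.  The derivative of a holomorphic map is complex linear, hence \<open>matrix\<close> yields the
  complex Jacobian.\<close>

definition in_coords ::
    "(complex^'n) set \<Rightarrow> (complex^'n \<Rightarrow> complex^'n) \<Rightarrow> 'n cotangent set \<Rightarrow> 'n cotangent set"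
  where "in_coords W \<phi> \<Omega> =
    {(\<phi> x, \<zeta>) | x \<zeta>. x \<in> W \<and> (x, transpose (matrix (frechet_derivative \<phi> (at x))) *v \<zeta>) \<in> \<Omega>}"

text \<open>For \<open>\<Phi>\<close> with domain \<open>V\<close>.  Such a matrix is not unique if the dimension exceeds one.\<close>

definition is_Jstar ::
    "(complex^'n) set \<Rightarrow> (complex^'n \<Rightarrow> complex^'n) \<Rightarrow>
      ((complex^'n) \<times> (complex^'n) \<Rightarrow> complex^'n^'n) \<Rightarrow> bool"
  where "is_Jstar V \<Phi> J \<longleftrightarrow>
    (\<exists>D. open D \<and> D \<subseteq> \<Phi> ` V \<times> \<Phi> ` V \<and> (\<forall>z\<in>\<Phi> ` V. (z, z) \<in> D) \<and> holo_on J D \<and>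
      (\<forall>(z', z)\<in>D. inv_into V \<Phi> z' - inv_into V \<Phi> z = J (z', z) *v (z' - z)))"


section \<open>Formal symbols with an apparent parameter\<close>

text \<open>The formal series \<open>\<Sum>\<nu>. t\<^sup>\<nu> P\<^sub>\<nu>(z, \<zeta>, \<eta>)\<close> is represented by the sequence of its coefficients.\<close>

type_synonym 'n series = "nat \<Rightarrow> (complex^'n) \<times> (complex^'n) \<times> complex \<Rightarrow> complex"

definition sector :: "real \<Rightarrow> real \<Rightarrow> complex set"
  where "sector r \<theta> = {\<eta>. 0 < cmod \<eta> \<and> cmod \<eta> < r \<and> \<bar>Arg \<eta>\<bar> < \<theta> / 4}"

definition thicken :: "real \<Rightarrow> 'n::finite cotangent set \<Rightarrow> 'n cotangent set"
  where "thicken \<rho> \<Omega> = closure (\<Union>(z, \<zeta>)\<in>\<Omega>.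
    {(z + z', \<zeta> + \<zeta>') | z' \<zeta>'. maxnorm z' \<le> \<rho> \<and> maxnorm \<zeta>' \<le> \<rho> * maxnorm \<zeta>})"

text \<open>\<open>sym_dom \<Omega> \<rho> U d m\<close> is \<open>(\<Omega>\<^sub>\<rho> * U)[m d\<^sub>\<rho>]\<close>.\<close>

definition sym_dom ::
    "'n::finite cotangent set \<Rightarrow> real \<Rightarrow> complex set \<Rightarrow> real \<Rightarrow> nat \<Rightarrow>
      ((complex^'n) \<times> (complex^'n) \<times> complex) set"
  where "sym_dom \<Omega> \<rho> U d m =
    {(z, \<zeta>, \<eta>). (z, \<zeta>) \<in> thicken \<rho> \<Omega> \<and> \<eta> \<in> U \<and> real m * (d * (1 - \<rho>)) \<le> maxnorm (\<eta> *s \<zeta>)}"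

definition rel_compact :: "complex set \<Rightarrow> complex set \<Rightarrow> bool"
  where "rel_compact Z S \<longleftrightarrow> compact (closure Z) \<and> closure Z \<subseteq> S"

definition N_hat :: "'n::finite cotangent set \<Rightarrow> complex set \<Rightarrow> 'n series set"
  where "N_hat \<Omega> S = {P. \<exists>d \<rho>. 0 < d \<and> 0 < \<rho> \<and> \<rho> < 1 \<and>
    (\<forall>\<nu>. holo_near (P \<nu>) (sym_dom \<Omega> \<rho> S d (\<nu> + 1))) \<and>
    (\<exists>A. 0 < A \<and> A < 1 \<and>
      (\<forall>Z h. rel_compact Z S \<longrightarrow> 0 < h \<longrightarrow>
        (\<exists>C>0. \<forall>m. \<forall>(z, \<zeta>, \<eta>)\<in>sym_dom \<Omega> \<rho> Z d m.
          cmod (\<Sum>\<nu><m. P \<nu> (z, \<zeta>, \<eta>)) \<le> C * A ^ m * exp (h * maxnorm \<zeta>))))}"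

definition d_eta :: "'n::finite series \<Rightarrow> 'n series"
  where "d_eta P = (\<lambda>\<nu> (z, \<zeta>, \<eta>). deriv (\<lambda>e. P \<nu> (z, \<zeta>, e)) \<eta>)"

definition S_hat :: "'n::finite cotangent set \<Rightarrow> complex set \<Rightarrow> 'n series set"
  where "S_hat \<Omega> S = {P. (\<exists>d \<rho>. 0 < d \<and> 0 < \<rho> \<and> \<rho> < 1 \<and>
    (\<forall>\<nu>. holo_near (P \<nu>) (sym_dom \<Omega> \<rho> S d (\<nu> + 1))) \<and>
    (\<exists>A. 0 < A \<and> A < 1 \<and>
      (\<forall>Z h. rel_compact Z S \<longrightarrow> 0 < h \<longrightarrow>
        (\<exists>C>0. \<forall>\<nu>. \<forall>(z, \<zeta>, \<eta>)\<in>sym_dom \<Omega> \<rho> Z d (\<nu> + 1).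
          cmod (P \<nu> (z, \<zeta>, \<eta>)) \<le> C * A ^ \<nu> * exp (h * maxnorm \<zeta>))))) \<and>
    d_eta P \<in> N_hat \<Omega> S}"

text \<open>Membership of a representative in the inductive limit.  \<open>N_hat\<close> is compatible with
  restriction in both arguments, so nothing is gained by bounding \<open>\<Omega>'\<close>, \<open>r\<close> and \<open>\<theta>\<close> from above.\<close>

definition N_hat_germ :: "'n::finite cotangent \<Rightarrow> 'n series set"
  where "N_hat_germ p = {P. \<exists>\<Omega>' r \<theta>. open \<Omega>' \<and> fiber_conic \<Omega>' \<and> p \<in> \<Omega>' \<and>
    0 < r \<and> r < 1/2 \<and> 0 < \<theta> \<and> \<theta> < 1/2 \<and> P \<in> N_hat \<Omega>' (sector r \<theta>)}"

text \<open>Equality of formal series over \<open>\<Omega>\<close> and \<open>S\<close>: representatives are total functions and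
  only their values on a common domain of holomorphy matter.\<close>

definition same_series ::
    "'n::finite cotangent set \<Rightarrow> complex set \<Rightarrow> 'n series \<Rightarrow> 'n series \<Rightarrow> bool"
  where "same_series \<Omega> S P Q \<longleftrightarrow> (\<exists>d \<rho>. 0 < d \<and> 0 < \<rho> \<and> \<rho> < 1 \<and>
    (\<forall>\<nu>. holo_near (P \<nu>) (sym_dom \<Omega> \<rho> S d (\<nu> + 1)) \<and>
         holo_near (Q \<nu>) (sym_dom \<Omega> \<rho> S d (\<nu> + 1)) \<and>
         (\<forall>p\<in>sym_dom \<Omega> \<rho> S d (\<nu> + 1). P \<nu> p = Q \<nu> p)))"


section \<open>Coordinate transformation of formal symbols\<close>

definition d_base :: "'n::finite \<Rightarrow> ('n cotangent \<Rightarrow> complex) \<Rightarrow> 'n cotangent \<Rightarrow> complex"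
  where "d_base i F = (\<lambda>(z, \<zeta>). deriv (\<lambda>s. F (z + axis i s, \<zeta>)) 0)"

definition d_fiber :: "'n::finite \<Rightarrow> ('n cotangent \<Rightarrow> complex) \<Rightarrow> 'n cotangent \<Rightarrow> complex"
  where "d_fiber i F = (\<lambda>(z, \<zeta>). deriv (\<lambda>s. F (z, \<zeta> + axis i s)) 0)"

definition d_pairing :: "('n::finite cotangent \<Rightarrow> complex) \<Rightarrow> 'n cotangent \<Rightarrow> complex"
  where "d_pairing F = (\<lambda>p. \<Sum>i\<in>UNIV. d_fiber i (d_base i F) p)"

text \<open>\<open>exp_t_pairing F \<nu>\<close> is the coefficient of \<open>t\<^sup>\<nu>\<close> in
  \<open>(\<Sum>j. t\<^sup>j/j! \<langle>\<partial>\<^sub>\<zeta>, \<partial>\<^sub>z\<rangle>\<^sup>j) (\<Sum>k. t\<^sup>k F\<^sub>k)\<close>.\<close>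

definition exp_t_pairing ::
    "(nat \<Rightarrow> 'n::finite cotangent \<Rightarrow> complex) \<Rightarrow> nat \<Rightarrow> 'n cotangent \<Rightarrow> complex"
  where "exp_t_pairing F \<nu> = (\<lambda>p. \<Sum>j\<le>\<nu>. (d_pairing ^^ j) (F (\<nu> - j)) p / fact j)"

definition pullback ::
    "(complex^'n \<Rightarrow> complex^'n) \<Rightarrow> ((complex^'n) \<times> (complex^'n) \<Rightarrow> complex^'n^'n) \<Rightarrow>
      'n::finite series \<Rightarrow> 'n series"
  where "pullback \<Phi> J P = (\<lambda>\<nu> (w, l, \<eta>).
    exp_t_pairing
      (\<lambda>k (z', \<zeta>'). P k (\<Phi> w, \<zeta>' + transpose (J (\<Phi> w + z', \<Phi> w)) *v l, \<eta>)) \<nu> (0, 0))"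

end

theory Submission
  imports Defs
begin

text \<open>
  The symbol \<open>\<Phi>\<^sup>*P(w, \<lambda>, \<eta>)\<close> involves the values of \<open>P\<close> over the single base point \<open>\<Phi>(w)\<close> only: the
  auxiliary variable \<open>z'\<close> enters through the matrix \<open>J\<^sup>*\<^sub>\<Phi>(\<Phi>(w) + z', \<Phi>(w))\<close>.  With
  \<open>G(z') = J\<^sup>*\<^sub>\<Phi>(\<Phi>(w) + z', \<Phi>(w))\<close>, the transformation is therefore built from the functionals
  \<open>fiber_coeff G \<lambda> j\<close>, which send a function \<open>f\<close> on the fiber to the coefficient of \<open>t\<^sup>j\<close> in
  \<open>e\<^bsup>t\<langle>\<partial>\<^sub>\<zeta>, \<partial>\<^sub>z\<rangle>\<^esup> f(\<zeta> + \<^sup>tG(z)\<lambda>)\<close> at \<open>z = 0\<close>, \<open>\<zeta> = 0\<close>.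

  Part (1) rests on Cauchy estimates.  On products of balls of radii \<open>\<delta>\<close> in \<open>z'\<close> and \<open>\<delta>|\<lambda>|\<close> in \<open>\<zeta>'\<close> they bound
  the \<open>j\<close>-th coefficient by \<open>(3nj / (\<delta>\<^sup>2|\<lambda>|))\<^sup>j\<close> times the maximum of \<open>f\<close>
  (\<open>d_pairing_power_bound\<close>).  On the domain with index \<open>m\<close> one has \<open>|\<lambda>| \<ge> m d'(1 - \<rho>')\<close>, so that for
  \<open>j \<le> m\<close> and \<open>d'\<close> large the factor is at most \<open>(A/2)\<^sup>j\<close>, and the sums over \<open>j\<close> converge without
  loss in \<open>A\<close> (\<open>fiber_coeff_sym_estimate\<close>).  A compactness argument provides such balls which are
  mapped into the domain of \<open>P\<close> (\<open>transition_controlled\<close>).  Partial sums of \<open>\<Phi>\<^sup>*P\<close> are sums of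
  coefficients of partial sums of \<open>P\<close>, and \<open>\<partial>\<^sub>\<eta>\<close> commutes with \<open>\<Phi>\<^sup>*\<close>; this gives the statements on
  null symbols and on \<open>\<partial>\<^sub>\<eta>\<Phi>\<^sup>*P\<close>.

  Part (2) holds exactly, not only modulo null symbols.  On the exponential
  \<open>e\<^sub>x(\<zeta>) = exp \<langle>x, \<zeta>\<rangle>\<close> the generating function of the functionals is
  \<open>exp (\<langle>G(tx)tx, \<lambda>\<rangle> / t)\<close> (\<open>fiber_coeff_exp\<close>).  It depends only on the map
  \<open>z' \<mapsto> G(z')z' = \<Phi>\<inverse>(\<Phi>(w) + z') - w\<close>, and not on the choice of \<open>J\<^sup>*\<^sub>\<Phi>\<close>; and composition of such maps
  corresponds to composition of the transformations.  Both identities pass from exponentials to all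
  holomorphic functions, because the functionals are of finite order at one point
  (\<open>exp_determines\<close>).
\<close>

text \<open>\<open>$\<close> denotes the components of vectors throughout.\<close>

no_notation fps_nth (infixl "$" 75)

section \<open>Holomorphic maps between complex normed spaces\<close>

lemma holo_onD:
  assumes "holo_on f U" "x \<in> U"
  obtains D where "(f has_derivative D) (at x)" "\<And>c h. D (c *\<^sub>C h) = c *\<^sub>C D h"
  using assms unfolding holo_on_def by blast

lemma holo_on_subset: "holo_on f U \<Longrightarrow> V \<subseteq> U \<Longrightarrow> holo_on f V"
  unfolding holo_on_def by blast

lemma holo_on_imp_continuous_on: "holo_on f U \<Longrightarrow> continuous_on U f"
  unfolding holo_on_def
  by (meson continuous_at_imp_continuous_on has_derivative_continuous)

lemma holo_on_cong:
  assumes "open U" "\<And>x. x \<in> U \<Longrightarrow> f x = g x" "holo_on f U"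
  shows "holo_on g U"
  unfolding holo_on_def
proof
  fix x assume x: "x \<in> U"
  then obtain D where "(f has_derivative D) (at x)" "\<And>c h. D (c *\<^sub>C h) = c *\<^sub>C D h"
    using holo_onD[OF assms(3)] by blast
  moreover have "(g has_derivative D) (at x)"
    using has_derivative_transform_within_open[OF calculation(1) assms(1) x assms(2)] .
  ultimately show "\<exists>D. (g has_derivative D) (at x) \<and> (\<forall>c h. D (c *\<^sub>C h) = c *\<^sub>C D h)"
    by blast
qed

lemma holo_on_compose:
  assumes "holo_on f U" "holo_on g V" "\<And>x. x \<in> U \<Longrightarrow> f x \<in> V"
  shows "holo_on (\<lambda>x. g (f x)) U"
  unfolding holo_on_def
proof
  fix x assume x: "x \<in> U"
  obtain D where D: "(f has_derivative D) (at x)" "\<And>c h. D (c *\<^sub>C h) = c *\<^sub>C D h"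
    using holo_onD[OF assms(1) x] by blast
  obtain E where E: "(g has_derivative E) (at (f x))" "\<And>c h. E (c *\<^sub>C h) = c *\<^sub>C E h"
    using holo_onD[OF assms(2) assms(3)[OF x]] by blast
  show "\<exists>D. ((\<lambda>x. g (f x)) has_derivative D) (at x) \<and> (\<forall>c h. D (c *\<^sub>C h) = c *\<^sub>C D h)"
    using has_derivative_compose[OF D(1) E(1)] D(2) E(2) by auto
qed

lemma holo_on_linear:
  assumes "bounded_linear D" "\<And>c h. D (c *\<^sub>C h) = c *\<^sub>C D h"
  shows "holo_on D U"
  unfolding holo_on_def using bounded_linear_imp_has_derivative[OF assms(1)] assms(2) by blast

lemma scaleC_zero [simp]: "c *\<^sub>C (0::'a::complex_normed) = 0" "0 *\<^sub>C (x::'a::complex_normed) = 0"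
proof -
  show "c *\<^sub>C (0::'a) = 0" by (metis add_cancel_right_right scaleC_add_right)
  show "0 *\<^sub>C x = 0" by (metis add_cancel_right_right scaleC_add_left)
qed

lemma scaleC_one [simp]: "1 *\<^sub>C (x::'a::complex_normed) = x"
  by (metis of_real_1 scaleC_of_real scaleR_one)

lemma scaleC_Pair [simp]: "c *\<^sub>C (a, b) = (c *\<^sub>C a, c *\<^sub>C b)"
  by (simp add: scaleC_prod_def)

lemma fst_scaleC [simp]: "fst (c *\<^sub>C p) = c *\<^sub>C fst p"
  and snd_scaleC [simp]: "snd (c *\<^sub>C p) = c *\<^sub>C snd p"
  by (simp_all add: scaleC_prod_def)

lemma scaleC_nth [simp]: "(c *\<^sub>C x) $ i = c *\<^sub>C (x $ i)"
  by (simp add: scaleC_vec_def)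

lemma scaleC_complex [simp]: "c *\<^sub>C (x::complex) = c * x"
  by (simp add: scaleC_complex_def)

lemma scaleC_scaleR_left: "(a *\<^sub>R c) *\<^sub>C (x::'a::complex_normed) = a *\<^sub>R (c *\<^sub>C x)"
  by (metis mult_scaleR_left scaleC_of_real scaleC_scaleC scaleR_conv_of_real)

lemma scaleC_axis: "s *\<^sub>C axis i (a::complex) = axis i (s * a)"
  by (simp add: vec_eq_iff axis_def)

lemma bounded_linear_scaleC_left: "bounded_linear (\<lambda>c. c *\<^sub>C (x::'a::complex_normed))"
  by (rule bounded_linear_intro[where K = "norm x"])
    (simp_all add: scaleC_add_left scaleC_scaleR_left norm_scaleC)

lemma holo_on_const: "holo_on (\<lambda>x. a) U"
  unfolding holo_on_def by (auto intro!: exI[of _ "\<lambda>_. 0"])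

lemma holo_on_id: "holo_on (\<lambda>x. x) U"
  by (rule holo_on_linear) auto

lemma holo_on_fst: "holo_on f U \<Longrightarrow> holo_on (\<lambda>x. fst (f x)) U"
  by (rule holo_on_compose[where V = UNIV and g = fst], assumption, rule holo_on_linear)
    (auto intro: bounded_linear_fst)

lemma holo_on_snd: "holo_on f U \<Longrightarrow> holo_on (\<lambda>x. snd (f x)) U"
  by (rule holo_on_compose[where V = UNIV and g = snd], assumption, rule holo_on_linear)
    (auto intro: bounded_linear_snd)

lemma holo_on_nth:
  assumes "holo_on f U" shows "holo_on (\<lambda>x. f x $ i) U"
proof (rule holo_on_compose[where V = UNIV and g = "\<lambda>y. y $ i", OF assms])
  show "holo_on (\<lambda>y. y $ i) UNIV"
    by (rule holo_on_linear) (auto intro: bounded_linear_vec_nth)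
qed auto

lemma holo_on_Pair:
  assumes "holo_on f U" "holo_on g U"
  shows "holo_on (\<lambda>x. (f x, g x)) U"
  unfolding holo_on_def
proof
  fix x assume x: "x \<in> U"
  obtain D where D: "(f has_derivative D) (at x)" "\<And>c h. D (c *\<^sub>C h) = c *\<^sub>C D h"
    using holo_onD[OF assms(1) x] by blast
  obtain E where E: "(g has_derivative E) (at x)" "\<And>c h. E (c *\<^sub>C h) = c *\<^sub>C E h"
    using holo_onD[OF assms(2) x] by blast
  show "\<exists>D. ((\<lambda>x. (f x, g x)) has_derivative D) (at x) \<and> (\<forall>c h. D (c *\<^sub>C h) = c *\<^sub>C D h)"
    using has_derivative_Pair[OF D(1) E(1)] D(2) E(2)
    by (intro exI[of _ "\<lambda>h. (D h, E h)"]) simp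
qed

lemma holo_on_add:
  assumes "holo_on f U" "holo_on g U"
  shows "holo_on (\<lambda>x. f x + g x) U"
  unfolding holo_on_def
proof
  fix x assume x: "x \<in> U"
  obtain D where D: "(f has_derivative D) (at x)" "\<And>c h. D (c *\<^sub>C h) = c *\<^sub>C D h"
    using holo_onD[OF assms(1) x] by blast
  obtain E where E: "(g has_derivative E) (at x)" "\<And>c h. E (c *\<^sub>C h) = c *\<^sub>C E h"
    using holo_onD[OF assms(2) x] by blast
  show "\<exists>D. ((\<lambda>x. f x + g x) has_derivative D) (at x) \<and> (\<forall>c h. D (c *\<^sub>C h) = c *\<^sub>C D h)"
    using has_derivative_add[OF D(1) E(1)] D(2) E(2)
    by (intro exI[of _ "\<lambda>h. D h + E h"]) (simp add: scaleC_add_right)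
qed

lemma holo_on_sum:
  assumes "\<And>i. i \<in> I \<Longrightarrow> holo_on (f i) U"
  shows "holo_on (\<lambda>x. \<Sum>i\<in>I. f i x) U"
  using assms by (induction I rule: infinite_finite_induct) (auto intro: holo_on_const holo_on_add)

lemma holo_on_mult:
  fixes f g :: "'a::complex_normed \<Rightarrow> complex"
  assumes "holo_on f U" "holo_on g U"
  shows "holo_on (\<lambda>x. f x * g x) U"
  unfolding holo_on_def
proof
  fix x assume x: "x \<in> U"
  obtain D where D: "(f has_derivative D) (at x)" "\<And>c h. D (c *\<^sub>C h) = c *\<^sub>C D h"
    using holo_onD[OF assms(1) x] by blast
  obtain E where E: "(g has_derivative E) (at x)" "\<And>c h. E (c *\<^sub>C h) = c *\<^sub>C E h"
    using holo_onD[OF assms(2) x] by blast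
  show "\<exists>D. ((\<lambda>x. f x * g x) has_derivative D) (at x) \<and> (\<forall>c h. D (c *\<^sub>C h) = c *\<^sub>C D h)"
    using has_derivative_mult[OF D(1) E(1)] D(2) E(2)
    by (intro exI[of _ "\<lambda>h. f x * E h + D h * g x"]) (simp add: algebra_simps)
qed

lemma holo_on_diff:
  fixes f g :: "'a::complex_normed \<Rightarrow> complex"
  assumes "holo_on f U" "holo_on g U"
  shows "holo_on (\<lambda>x. f x - g x) U"
  using holo_on_add[OF assms(1) holo_on_mult[OF holo_on_const[of "-1"] assms(2)]] by simp

lemma holomorphic_imp_holo_on:
  assumes "g holomorphic_on V" "open V" shows "holo_on g V"
  unfolding holo_on_def
proof
  fix x assume "x \<in> V"
  then have "(g has_field_derivative deriv g x) (at x)"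
    using assms holomorphic_derivI by blast
  then show "\<exists>D. (g has_derivative D) (at x) \<and> (\<forall>c h. D (c *\<^sub>C h) = c *\<^sub>C D h)"
    unfolding has_field_derivative_def
    by (intro exI[of _ "\<lambda>h. deriv g x * h"]) auto
qed

lemma holo_on_imp_holomorphic:
  fixes f :: "complex \<Rightarrow> complex"
  assumes "holo_on f U" shows "f holomorphic_on U"
  unfolding holomorphic_on_def
proof
  fix x assume x: "x \<in> U"
  obtain D where D: "(f has_derivative D) (at x)" "\<And>c h. D (c *\<^sub>C h) = c *\<^sub>C D h"
    using holo_onD[OF assms x] by blast
  have "D = (\<lambda>h. D 1 * h)"
  proof
    fix h show "D h = D 1 * h" using D(2)[of h 1] by (simp add: mult.commute)
  qed
  then have "(f has_field_derivative D 1) (at x)"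
    unfolding has_field_derivative_def using D(1) by simp
  then show "f field_differentiable at x within U"
    using field_differentiable_at_within field_differentiable_def by blast
qed

lemma holo_on_exp:
  fixes f :: "'a::complex_normed \<Rightarrow> complex"
  shows "holo_on f U \<Longrightarrow> holo_on (\<lambda>x. exp (f x)) U"
  by (rule holo_on_compose[where V = UNIV and g = exp], assumption, rule holomorphic_imp_holo_on)
    (auto intro!: holomorphic_intros)

lemma bounded_linear_axis: "bounded_linear (\<lambda>a::complex. axis i a :: complex ^ 'n)"
  by (rule bounded_linear_intro[where K = 1])
    (auto simp: vec_eq_iff axis_def norm_vec_def L2_set_def if_distrib[of norm]
      if_distrib[of "\<lambda>x. x ^ 2"] sum.delta cong: if_cong)

lemma holo_on_axis: "holo_on f U \<Longrightarrow> holo_on (\<lambda>x. axis i (f x :: complex) :: complex ^ 'n) U"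
  by (rule holo_on_compose[where V = UNIV and g = "axis i"], assumption, rule holo_on_linear)
    (auto intro: bounded_linear_axis simp: scaleC_axis)

lemma holo_on_vec:
  fixes f :: "'a::complex_normed \<Rightarrow> complex ^ 'n"
  assumes "\<And>i. holo_on (\<lambda>x. f x $ i) U"
  shows "holo_on f U"
proof -
  have "holo_on (\<lambda>x. \<Sum>i\<in>UNIV. axis i (f x $ i)) U"
    by (intro holo_on_sum holo_on_axis assms)
  moreover have "(\<Sum>i\<in>UNIV. axis i (f x $ i)) = f x" for x
    by (simp add: vec_eq_iff axis_def)
  ultimately show ?thesis by simp
qed

lemma holo_on_matrix_vector:
  fixes A :: "'a::complex_normed \<Rightarrow> complex ^ 'n ^ 'm"
  assumes "holo_on A U" "holo_on v U"
  shows "holo_on (\<lambda>x. A x *v v x) U" 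
  by (rule holo_on_vec, simp add: matrix_vector_mult_def)
    (intro holo_on_sum holo_on_mult holo_on_nth assms)

lemma holo_on_transpose_vector:
  fixes A :: "'a::complex_normed \<Rightarrow> complex ^ 'n ^ 'm"
  assumes "holo_on A U" "holo_on v U"
  shows "holo_on (\<lambda>x. transpose (A x) *v v x) U"
  by (rule holo_on_vec, simp add: matrix_vector_mult_def transpose_def)
    (intro holo_on_sum holo_on_mult holo_on_nth assms)

lemma holo_on_scaleC:
  fixes x :: "'a::complex_normed"
  assumes "holo_on f U" shows "holo_on (\<lambda>s. f s *\<^sub>C x) U"
  by (rule holo_on_compose[OF assms, where V = UNIV and g = "\<lambda>c. c *\<^sub>C x"], rule holo_on_linear)
    (auto intro: bounded_linear_scaleC_left simp: scaleC_scaleC)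

lemmas holo_intros = holo_on_const holo_on_id holo_on_fst holo_on_snd holo_on_nth holo_on_Pair
  holo_on_add holo_on_sum holo_on_mult holo_on_diff holo_on_exp holo_on_axis
  holo_on_matrix_vector holo_on_transpose_vector holo_on_scaleC


section \<open>Directional derivatives\<close>

text \<open>The complex derivative of \<open>f\<close> at \<open>x\<close> in the direction \<open>v\<close>.  The operators \<open>\<partial>\<^sub>z\<close>,
  \<open>\<partial>\<^sub>\<zeta>\<close> and \<open>\<partial>\<^sub>\<eta>\<close> are instances, for vectors \<open>v\<close> of a product space.\<close>

definition dird :: "'a::complex_normed \<Rightarrow> ('a \<Rightarrow> complex) \<Rightarrow> 'a \<Rightarrow> complex"
  where "dird v f x = deriv (\<lambda>s. f (x + s *\<^sub>C v)) 0"

lemma slice_has_derivative: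
  fixes f :: "'a::complex_normed \<Rightarrow> complex"
  assumes "(f has_derivative D) (at (x + s *\<^sub>C v))" "\<And>c h. D (c *\<^sub>C h) = c *\<^sub>C D h"
  shows "((\<lambda>s. f (x + s *\<^sub>C v)) has_field_derivative D v) (at s)"
proof -
  have "((\<lambda>s. x + s *\<^sub>C v) has_derivative (\<lambda>h. 0 + h *\<^sub>C v)) (at s)"
    by (intro has_derivative_add has_derivative_const
        bounded_linear_imp_has_derivative bounded_linear_scaleC_left)
  from has_derivative_compose[OF this assms(1)] show ?thesis
    unfolding has_field_derivative_def by (simp add: assms(2) mult.commute[of _ "D v"])
qed

lemma dird_eq:
  fixes f :: "'a::complex_normed \<Rightarrow> complex"
  assumes "(f has_derivative D) (at x)" "\<And>c h. D (c *\<^sub>C h) = c *\<^sub>C D h"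
  shows "dird v f x = D v"
  unfolding dird_def
  by (rule DERIV_imp_deriv, rule slice_has_derivative) (use assms in auto)

lemma holo_on_has_derivative:
  fixes f :: "'a::complex_normed \<Rightarrow> complex"
  assumes "holo_on f U" "x \<in> U"
  shows "(f has_derivative (\<lambda>h. dird h f x)) (at x)"
    and "dird (c *\<^sub>C h) f x = c * dird h f x"
    and "dird (h + k) f x = dird h f x + dird k f x"
proof -
  obtain D where D: "(f has_derivative D) (at x)" "\<And>c h. D (c *\<^sub>C h) = c *\<^sub>C D h"
    using holo_onD[OF assms] by blast
  have *: "D h = dird h f x" for h using dird_eq[OF D] by simp
  then have "D = (\<lambda>h. dird h f x)" by auto
  then show "(f has_derivative (\<lambda>h. dird h f x)) (at x)" using D(1) by simp
  show "dird (c *\<^sub>C h) f x = c * dird h f x" using D(2)[of c h] * by simp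
  show "dird (h + k) f x = dird h f x + dird k f x"
    using has_derivative_linear[OF D(1)] * by (metis linear_add)
qed

lemma dird_sum_direction:
  fixes f :: "'a::complex_normed \<Rightarrow> complex"
  assumes "holo_on f U" "x \<in> U"
  shows "dird (\<Sum>i\<in>I. g i) f x = (\<Sum>i\<in>I. dird (g i) f x)"
proof (induction I rule: infinite_finite_induct)
  case empty
  have "dird (0::'a) f x = 0" by (simp add: dird_def)
  then show ?case by simp
next
  case (infinite A)
  have "dird (0::'a) f x = 0" by (simp add: dird_def)
  then show ?case using infinite by simp
qed (simp add: holo_on_has_derivative(3)[OF assms])

lemma slice_holomorphic:
  fixes f :: "'a::complex_normed \<Rightarrow> complex"
  assumes "holo_on f U"
  shows "(\<lambda>s. f (x + s *\<^sub>C v)) holomorphic_on {s. x + s *\<^sub>C v \<in> U}"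
  by (rule holo_on_imp_holomorphic, rule holo_on_compose[OF _ assms]) (auto intro!: holo_intros)

lemma open_eventually_dird:
  fixes x :: "'a::complex_normed"
  assumes "open U" "x \<in> U"
  shows "eventually (\<lambda>s. x + s *\<^sub>C v \<in> U) (nhds 0)"
proof -
  have "continuous_on UNIV (\<lambda>s. x + s *\<^sub>C v)"
    by (intro continuous_intros linear_continuous_on bounded_linear_scaleC_left)
  then have "open ((\<lambda>s. x + s *\<^sub>C v) -` U)"
    using assms(1) by (simp add: continuous_on_open_vimage)
  moreover have "0 \<in> (\<lambda>s. x + s *\<^sub>C v) -` U" using assms(2) by simp
  ultimately show ?thesis unfolding eventually_nhds by blast
qed

lemma dird_cong:
  fixes f g :: "'a::complex_normed \<Rightarrow> complex"
  assumes "open U" "x \<in> U" "\<And>y. y \<in> U \<Longrightarrow> f y = g y"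
  shows "dird v f x = dird v g x"
  unfolding dird_def
  by (rule deriv_cong_ev)
    (use open_eventually_dird[OF assms(1,2), of v] assms(3) in \<open>auto elim: eventually_mono\<close>)

lemma dird_add:
  fixes f g :: "'a::complex_normed \<Rightarrow> complex"
  assumes "holo_on f U" "holo_on g U" "x \<in> U"
  shows "dird v (\<lambda>y. f y + g y) x = dird v f x + dird v g x"
  by (rule dird_eq)
    (auto intro!: has_derivative_add holo_on_has_derivative(1)[OF _ assms(3)] assms
      simp: holo_on_has_derivative(2)[OF assms(1,3)] holo_on_has_derivative(2)[OF assms(2,3)] algebra_simps)

lemma dird_cmult:
  fixes f :: "'a::complex_normed \<Rightarrow> complex"
  assumes "holo_on f U" "x \<in> U"
  shows "dird v (\<lambda>y. c * f y) x = c * dird v f x"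
  by (rule dird_eq)
    (auto intro!: has_derivative_mult_right holo_on_has_derivative(1)[OF _ assms(2)] assms
      simp: holo_on_has_derivative(2)[OF assms(1,2)])

lemma dird_const [simp]: "dird v (\<lambda>y. c) x = 0"
  by (simp add: dird_def)

lemma dird_sum:
  fixes f :: "'b \<Rightarrow> 'a::complex_normed \<Rightarrow> complex"
  assumes "\<And>i. i \<in> I \<Longrightarrow> holo_on (f i) U" "x \<in> U"
  shows "dird v (\<lambda>y. \<Sum>i\<in>I. f i y) x = (\<Sum>i\<in>I. dird v (f i) x)"
  using assms
proof (induction I rule: infinite_finite_induct)
  case (insert i I)
  have "dird v (\<lambda>y. f i y + (\<Sum>i\<in>I. f i y)) x = dird v (f i) x + dird v (\<lambda>y. \<Sum>i\<in>I. f i y) x"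
    by (rule dird_add[OF _ _ insert.prems(2)]) (auto intro!: holo_on_sum insert.prems)
  then show ?case using insert by simp
qed auto

lemma dird_Cauchy_bound:
  fixes f :: "'a::complex_normed \<Rightarrow> complex"
  assumes "holo_on f U" "open U" "\<delta> > 0"
    and "\<And>s. cmod s \<le> \<delta> \<Longrightarrow> x + s *\<^sub>C v \<in> U \<and> cmod (f (x + s *\<^sub>C v)) \<le> B"
  shows "cmod (dird v f x) \<le> B / \<delta>"
proof -
  have hol: "(\<lambda>s. f (x + s *\<^sub>C v)) holomorphic_on cball 0 \<delta>"
    using slice_holomorphic[OF assms(1)] by (rule holomorphic_on_subset) (use assms(4) in auto)
  have "cmod ((deriv ^^ 1) (\<lambda>s. f (x + s *\<^sub>C v)) 0) \<le> fact 1 * B / \<delta> ^ 1"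
    by (rule Cauchy_inequality)
      (use hol assms(3,4) in \<open>auto intro: holomorphic_on_imp_continuous_on holomorphic_on_subset\<close>)
  then show ?thesis by (simp add: dird_def)
qed

text \<open>Cauchy's formula on the circle of radius \<open>\<delta>\<close> around \<open>x\<close> in the complex line
  spanned by \<open>v\<close>.\<close>

lemma dird_integral:
  fixes f :: "'a::complex_normed \<Rightarrow> complex"
  assumes "holo_on f U" "open U" "\<delta> > 0"
    and "\<And>s. cmod s \<le> \<delta> \<Longrightarrow> x + s *\<^sub>C v \<in> U"
  shows "dird v f x = integral (cbox 0 1) (\<lambda>t::real. f (x + circlepath 0 \<delta> t *\<^sub>C v) /
      circlepath 0 \<delta> t)"
proof -
  let ?F = "\<lambda>s. f (x + s *\<^sub>C v)"
  have hol: "?F holomorphic_on cball 0 \<delta>"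
    using slice_holomorphic[OF assms(1)] by (rule holomorphic_on_subset) (use assms(4) in auto)
  have "(?F has_field_derivative
      (1 / (2 * of_real pi * \<i>) * contour_integral (circlepath 0 \<delta>) (\<lambda>u. ?F u / (u - 0)^2))) (at 0)"
    by (rule Cauchy_derivative_integral_circlepath(2))
      (use hol assms(3) in \<open>auto intro: holomorphic_on_imp_continuous_on holomorphic_on_subset\<close>)
  then have "dird v f x
      = 1 / (2 * of_real pi * \<i>) * contour_integral (circlepath 0 \<delta>) (\<lambda>u. ?F u / (u - 0)^2)"
    unfolding dird_def by (rule DERIV_imp_deriv)
  also have "\<dots> = integral {0..1} (\<lambda>t. 1 / (2 * of_real pi * \<i>) *
      (?F (circlepath 0 \<delta> t) / (circlepath 0 \<delta> t - 0)^2 * vector_derivative (circlepath 0 \<delta>) (at t)))"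
    unfolding contour_integral_integral integral_mult_right ..
  also have "\<dots> = integral {0..1} (\<lambda>t. ?F (circlepath 0 \<delta> t) / circlepath 0 \<delta> t)"
  proof (rule integral_cong)
    fix t :: real
    have "circlepath 0 \<delta> t \<noteq> 0" using assms(3) by (simp add: circlepath)
    moreover have "vector_derivative (circlepath 0 \<delta>) (at t) = 2 * pi * \<i> * circlepath 0 \<delta> t"
      unfolding vector_derivative_circlepath by (simp add: circlepath)
    ultimately show "1 / (2 * of_real pi * \<i>) * (?F (circlepath 0 \<delta> t) / (circlepath 0 \<delta> t - 0)^2 *
        vector_derivative (circlepath 0 \<delta>) (at t)) = ?F (circlepath 0 \<delta> t) / circlepath 0 \<delta> t"
      by (simp add: power2_eq_square)
  qed
  finally show ?thesis by simp
qed

lemma circlepath_facts: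
  assumes "\<delta> > 0"
  shows "cmod (circlepath 0 \<delta> t) = \<delta>" "circlepath 0 \<delta> t \<noteq> 0" "continuous_on X (circlepath 0 \<delta>)"
proof -
  show "cmod (circlepath 0 \<delta> t) = \<delta>" "circlepath 0 \<delta> t \<noteq> 0"
    using assms by (auto simp: circlepath norm_mult)
  show "continuous_on X (circlepath 0 \<delta>)"
    unfolding circlepath by (intro continuous_intros)
qed

text \<open>Discs of a common radius in the direction \<open>v\<close>, for all centers near \<open>x0\<close>.\<close>

lemma uniform_slice:
  fixes x0 :: "'a::complex_normed"
  assumes "open U" "x0 \<in> U"
  obtains \<delta> r where "\<delta> > 0" "r > 0" "\<And>x s. cmod s \<le> \<delta> \<Longrightarrow> x \<in> ball x0 r \<Longrightarrow> x + s *\<^sub>C v \<in> U"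
proof -
  obtain R where R: "R > 0" "ball x0 R \<subseteq> U" using assms open_contains_ball by blast
  define \<delta> where "\<delta> = R / (2 * (norm v + 1))"
  have \<delta>: "\<delta> > 0" using R(1) norm_ge_zero[of v] by (simp add: \<delta>_def add_nonneg_pos)
  have "x + s *\<^sub>C v \<in> U" if "cmod s \<le> \<delta>" "x \<in> ball x0 (R / 2)" for x s
  proof -
    have "cmod s * norm v \<le> \<delta> * norm v" using that by (simp add: mult_right_mono)
    also have "\<dots> < \<delta> * (norm v + 1)" using \<delta> by simp
    also have "\<dots> = R / 2" using norm_ge_zero[of v] by (simp add: \<delta>_def field_simps add_nonneg_eq_0_iff)
    finally have "norm (s *\<^sub>C v) < R / 2" by (simp add: norm_scaleC)
    moreover have "norm (x0 - (x + s *\<^sub>C v)) \<le> norm (x0 - x) + norm (s *\<^sub>C v)"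
      by (metis diff_diff_eq norm_triangle_ineq4)
    ultimately have "dist x0 (x + s *\<^sub>C v) < R" using that(2) by (simp add: dist_norm)
    then show ?thesis using R(2) by auto
  qed
  then show thesis using that[of \<delta> "R / 2"] \<delta> R(1) by simp
qed

text \<open>Complex differentiability at every point suffices for the continuity of the derivative,
  because Cauchy's formula expresses the derivative by values of \<open>f\<close>.\<close>

lemma continuous_on_dird:
  fixes f :: "'a::complex_normed \<Rightarrow> complex"
  assumes f: "holo_on f U" and U: "open U"
  shows "continuous_on U (dird h f)"
proof (rule continuous_at_imp_continuous_on, safe)
  fix y assume y: "y \<in> U"
  obtain \<epsilon> r where \<epsilon>: "\<epsilon> > 0" and r: "r > 0"
    and inU: "\<And>x s. cmod s \<le> \<epsilon> \<Longrightarrow> x \<in> ball y r \<Longrightarrow> x + s *\<^sub>C h \<in> U"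
    using uniform_slice[OF U y, of h] by blast
  note circ = circlepath_facts[OF \<epsilon>]
  have "continuous_on (ball y r \<times> cbox 0 1)
      (\<lambda>(x, t). f (x + circlepath 0 \<epsilon> t *\<^sub>C h) / circlepath 0 \<epsilon> t)"
    unfolding split_beta
  proof (intro continuous_intros continuous_on_compose2[OF holo_on_imp_continuous_on[OF f]])
    show "continuous_on (ball y r \<times> cbox 0 1) (\<lambda>p. circlepath 0 \<epsilon> (snd p))"
      by (intro continuous_on_compose2[OF circ(3)[of UNIV]] continuous_intros) auto
    then show "continuous_on (ball y r \<times> cbox 0 1) (\<lambda>p. circlepath 0 \<epsilon> (snd p) *\<^sub>C h)"
      by (rule bounded_linear.continuous_on[OF bounded_linear_scaleC_left])
    show "(\<lambda>p. fst p + circlepath 0 \<epsilon> (snd p) *\<^sub>C h) ` (ball y r \<times> cbox 0 1) \<subseteq> U"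
      using inU circ(1) by (auto simp del: mem_ball)
  qed (use circ(2) in auto)
  then have "continuous_on (ball y r)
      (\<lambda>x. integral (cbox 0 1) (\<lambda>t. f (x + circlepath 0 \<epsilon> t *\<^sub>C h) / circlepath 0 \<epsilon> t))"
    by (rule integral_continuous_on_param)
  then have "continuous_on (ball y r) (dird h f)"
    by (rule continuous_on_eq) (use dird_integral[OF f U \<epsilon>] inU in auto)
  then show "isCont (dird h f) y"
    using r by (simp add: continuous_on_eq_continuous_at)
qed

text \<open>Differentiation under the integral sign in Cauchy's formula.\<close>

lemma has_derivative_dird:
  fixes f :: "'a::{complex_normed, euclidean_space} \<Rightarrow> complex"
  assumes f: "holo_on f U" and U: "open U" and x0: "x0 \<in> U"
  obtains \<delta> where "\<delta> > 0" "\<And>s. cmod s \<le> \<delta> \<Longrightarrow> x0 + s *\<^sub>C v \<in> U"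
    "(dird v f has_derivative (\<lambda>h. integral (cbox 0 1)
      (\<lambda>t::real. dird h f (x0 + circlepath 0 \<delta> t *\<^sub>C v) / circlepath 0 \<delta> t))) (at x0)"
proof -
  obtain \<delta> r where \<delta>: "\<delta> > 0" and r: "r > 0"
    and inU: "\<And>x s. cmod s \<le> \<delta> \<Longrightarrow> x \<in> ball x0 r \<Longrightarrow> x + s *\<^sub>C v \<in> U"
    using uniform_slice[OF U x0, of v] by blast
  note circ = circlepath_facts(1)[OF \<delta>] and ne = circlepath_facts(2)[OF \<delta>]
    and contcirc = circlepath_facts(3)[OF \<delta>]
  let ?B = "ball x0 r"
  have x0B: "x0 \<in> ?B" using r by simp
  define P where "P = (\<lambda>(x::'a, t::real). x + circlepath 0 \<delta> t *\<^sub>C v)"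
  have contP: "continuous_on X P" for X
    unfolding P_def split_beta
    by (intro continuous_intros bounded_linear.continuous_on[OF bounded_linear_scaleC_left]
        continuous_on_compose2[OF contcirc[of UNIV]]) auto
  have PU: "P p \<in> U" if "p \<in> ?B \<times> cbox 0 1" for p
    using that inU[of "circlepath 0 \<delta> (snd p)" "fst p"] circ by (auto simp: P_def split_beta)
  have eq: "dird h f x = integral (cbox 0 1) (\<lambda>t::real. f (x + circlepath 0 \<epsilon> t *\<^sub>C h) / circlepath 0 \<epsilon> t)"
    if "\<epsilon> > 0" "\<And>s. cmod s \<le> \<epsilon> \<Longrightarrow> x + s *\<^sub>C h \<in> U" for h x \<epsilon>
    by (rule dird_integral[OF f U that])
  have cont: "continuous_on U (dird h f)" for h by (rule continuous_on_dird[OF f U])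
  have bl: "bounded_linear (\<lambda>h. dird h f (P p) / circlepath 0 \<delta> (snd p))" if "p \<in> ?B \<times> cbox 0 1" for p
    using has_derivative_bounded_linear[OF holo_on_has_derivative(1)[OF f PU[OF that]]]
    by (rule bounded_linear_divide[THEN bounded_linear_compose])
  define fx where "fx = (\<lambda>x t. Blinfun (\<lambda>h. dird h f (P (x, t)) / circlepath 0 \<delta> t))"
  have fx: "blinfun_apply (fx x t) = (\<lambda>h. dird h f (P (x, t)) / circlepath 0 \<delta> t)"
    if "x \<in> ?B" "t \<in> cbox 0 1" for x t
    unfolding fx_def using bl[of "(x, t)"] that by (simp add: bounded_linear_Blinfun_apply)
  have "((\<lambda>x. integral (cbox 0 1) (\<lambda>t::real. f (x + circlepath 0 \<delta> t *\<^sub>C v) / circlepath 0 \<delta> t))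
      has_derivative integral (cbox 0 1) (fx x0)) (at x0 within ?B)"
  proof (rule leibniz_rule)
    show "convex ?B" "x0 \<in> ?B" using r by auto
    fix x and t :: real assume x: "x \<in> ?B" and t: "t \<in> cbox 0 1"
    have "((\<lambda>x. x + circlepath 0 \<delta> t *\<^sub>C v) has_derivative (\<lambda>h. h)) (at x)"
      by (auto intro!: derivative_eq_intros)
    moreover have "(f has_derivative (\<lambda>h. dird h f (P (x, t)))) (at (x + circlepath 0 \<delta> t *\<^sub>C v))"
      using holo_on_has_derivative(1)[OF f PU[of "(x, t)"]] x t by (simp add: P_def)
    ultimately have "((\<lambda>x. f (x + circlepath 0 \<delta> t *\<^sub>C v)) has_derivative (\<lambda>h. dird h f (P (x, t)))) (at x)"
      by (rule has_derivative_compose)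
    from bounded_linear.has_derivative[OF bounded_linear_divide this]
    show "((\<lambda>x. f (x + circlepath 0 \<delta> t *\<^sub>C v) / circlepath 0 \<delta> t) has_derivative blinfun_apply (fx x t))
        (at x within ?B)"
      unfolding fx[OF x t] by (rule has_derivative_at_withinI)
  next
    fix x assume x: "x \<in> ?B"
    have "continuous_on (cbox 0 1) (\<lambda>t::real. f (P (x, t)) / circlepath 0 \<delta> t)"
      by (intro continuous_intros continuous_on_compose2[OF holo_on_imp_continuous_on[OF f]]
          continuous_on_compose2[OF contP[of UNIV]] contcirc)
        (use ne PU x in auto)
    from integrable_continuous[OF this]
    show "(\<lambda>t. f (x + circlepath 0 \<delta> t *\<^sub>C v) / circlepath 0 \<delta> t) integrable_on cbox 0 1"
      by (simp add: P_def)
  next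
    show "continuous_on (?B \<times> cbox 0 1) (\<lambda>(x, t). fx x t)"
      unfolding split_beta
    proof (rule continuous_on_blinfun_componentwise)
      fix h :: 'a
      have "continuous_on (?B \<times> cbox 0 1) (\<lambda>p. dird h f (P p) / circlepath 0 \<delta> (snd p))"
        by (intro continuous_intros continuous_on_compose2[OF cont] contP
            continuous_on_compose2[OF contcirc[of UNIV]]) (use ne PU in auto)
      then show "continuous_on (?B \<times> cbox 0 1) (\<lambda>p. blinfun_apply (fx (fst p) (snd p)) h)"
        by (rule continuous_on_eq) (auto simp: fx)
    qed
  qed
  then have "((\<lambda>x. integral (cbox 0 1) (\<lambda>t::real. f (x + circlepath 0 \<delta> t *\<^sub>C v) / circlepath 0 \<delta> t))
      has_derivative integral (cbox 0 1) (fx x0)) (at x0)"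
    unfolding at_within_open[OF x0B open_ball] .
  then have d: "(dird v f has_derivative integral (cbox 0 1) (fx x0)) (at x0)"
    by (rule has_derivative_transform_within_open[OF _ open_ball x0B])
      (rule eq[OF \<delta> inU, symmetric])
  have "fx x0 integrable_on cbox 0 1"
  proof (rule integrable_continuous)
    show "continuous_on (cbox 0 1) (fx x0)"
    proof (rule continuous_on_blinfun_componentwise)
      fix h :: 'a
      have "continuous_on (cbox 0 1) (\<lambda>t. dird h f (P (x0, t)) / circlepath 0 \<delta> t)"
        by (intro continuous_intros continuous_on_compose2[OF cont]
            continuous_on_compose2[OF contP[of UNIV]] contcirc) (use ne PU x0B in auto)
      then show "continuous_on (cbox 0 1) (\<lambda>t. blinfun_apply (fx x0 t) h)"
        by (rule continuous_on_eq) (use x0B in \<open>simp add: fx\<close>)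
    qed
  qed
  then have "blinfun_apply (integral (cbox 0 1) (fx x0)) h
      = integral (cbox 0 1) (\<lambda>t. dird h f (P (x0, t)) / circlepath 0 \<delta> t)" for h
    by (subst blinfun_apply_integral) (auto intro!: integral_cong simp: fx[OF x0B] simp del: cbox_interval)
  then have "blinfun_apply (integral (cbox 0 1) (fx x0)) =
      (\<lambda>h. integral (cbox 0 1) (\<lambda>t. dird h f (x0 + circlepath 0 \<delta> t *\<^sub>C v) / circlepath 0 \<delta> t))"
    by (auto simp: P_def)
  with d have D: "(dird v f has_derivative (\<lambda>h. integral (cbox 0 1)
      (\<lambda>t. dird h f (x0 + circlepath 0 \<delta> t *\<^sub>C v) / circlepath 0 \<delta> t))) (at x0)" by simp
  show thesis by (rule that[OF \<delta> inU[OF _ x0B] D])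
qed

text \<open>Derivatives of holomorphic functions are holomorphic: the derivative found by differentiation
  under the integral sign is again complex linear.\<close>

lemma holo_on_dird:
  fixes f :: "'a::{complex_normed, euclidean_space} \<Rightarrow> complex"
  assumes f: "holo_on f U" and U: "open U"
  shows "holo_on (dird v f) U"
  unfolding holo_on_def
proof
  fix x assume x: "x \<in> U"
  obtain \<delta> where \<delta>: "\<delta> > 0" "\<And>s. cmod s \<le> \<delta> \<Longrightarrow> x + s *\<^sub>C v \<in> U"
    "(dird v f has_derivative (\<lambda>h. integral (cbox 0 1)
      (\<lambda>t::real. dird h f (x + circlepath 0 \<delta> t *\<^sub>C v) / circlepath 0 \<delta> t))) (at x)"
    by (rule has_derivative_dird[OF f U x, of v]) (rule that)
  have mem: "x + circlepath 0 \<delta> t *\<^sub>C v \<in> U" for t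
    by (rule \<delta>(2)) (use \<delta>(1) in \<open>simp add: circlepath norm_mult\<close>)
  have "integral (cbox 0 1) (\<lambda>t::real. dird (c *\<^sub>C h) f (x + circlepath 0 \<delta> t *\<^sub>C v) / circlepath 0 \<delta> t)
      = c *\<^sub>C integral (cbox 0 1) (\<lambda>t::real. dird h f (x + circlepath 0 \<delta> t *\<^sub>C v) / circlepath 0 \<delta> t)"
    for c h
    unfolding holo_on_has_derivative(2)[OF f mem] scaleC_complex
      times_divide_eq_right[symmetric] integral_mult_right ..
  with \<delta>(3)
  show "\<exists>D. (dird v f has_derivative D) (at x) \<and> (\<forall>c h. D (c *\<^sub>C h) = c *\<^sub>C D h)"
    by blast
qed

lemma dird_commute:
  fixes f :: "'a::{complex_normed, euclidean_space} \<Rightarrow> complex"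
  assumes f: "holo_on f U" and U: "open U" and x: "x \<in> U"
  shows "dird u (dird v f) x = dird v (dird u f) x"
proof -
  obtain \<delta> where \<delta>: "\<delta> > 0" "\<And>s. cmod s \<le> \<delta> \<Longrightarrow> x + s *\<^sub>C v \<in> U"
    "(dird v f has_derivative (\<lambda>h. integral (cbox 0 1)
      (\<lambda>t::real. dird h f (x + circlepath 0 \<delta> t *\<^sub>C v) / circlepath 0 \<delta> t))) (at x)"
    by (rule has_derivative_dird[OF f U x, of v]) (rule that)
  have "(dird v f has_derivative (\<lambda>h. dird h (dird v f) x)) (at x)"
    using holo_on_has_derivative(1)[OF holo_on_dird[OF f U] x] .
  from has_derivative_unique[OF this \<delta>(3)]
  have "dird u (dird v f) x = integral (cbox 0 1)
      (\<lambda>t::real. dird u f (x + circlepath 0 \<delta> t *\<^sub>C v) / circlepath 0 \<delta> t)" by metis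
  also have "\<dots> = dird v (dird u f) x"
    by (rule dird_integral[symmetric, OF holo_on_dird[OF f U] U \<delta>(1,2)])
  finally show ?thesis .
qed

section \<open>The operator \<open>\<langle>\<partial>\<^sub>\<zeta>, \<partial>\<^sub>z\<rangle>\<close> and its powers\<close>

lemma d_base_eq: "d_base i F = dird (axis i 1, 0) F"
  by (rule ext) (auto simp: d_base_def dird_def scaleC_axis)

lemma d_fiber_eq: "d_fiber i F = dird (0, axis i 1) F"
  by (rule ext) (auto simp: d_fiber_def dird_def scaleC_axis)

lemma d_pairing_eq: "d_pairing F p = (\<Sum>i\<in>UNIV. dird (0, axis i 1) (dird (axis i 1, 0) F) p)"
  by (simp add: d_pairing_def d_base_eq d_fiber_eq)

lemma holo_on_d_pairing:
  assumes "holo_on F U" "open U"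
  shows "holo_on (d_pairing F) U"
  unfolding d_pairing_eq[abs_def] by (intro holo_on_sum holo_on_dird assms)

lemma holo_on_d_pairing_power:
  assumes "holo_on F U" "open U"
  shows "holo_on ((d_pairing ^^ j) F) U"
  by (induction j) (simp_all add: assms holo_on_d_pairing)

lemma d_pairing_cong:
  assumes "open U" "p \<in> U" "\<And>q. q \<in> U \<Longrightarrow> F q = G q"
  shows "d_pairing F p = d_pairing G p"
  unfolding d_pairing_eq
  by (intro sum.cong refl dird_cong[OF assms(1,2)] dird_cong[OF assms(1)] assms(3))

lemma d_pairing_power_cong:
  assumes "open U" "p \<in> U" "\<And>q. q \<in> U \<Longrightarrow> F q = G q"
  shows "(d_pairing ^^ j) F p = (d_pairing ^^ j) G p"
  using assms(2)
proof (induction j arbitrary: p)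
  case (Suc j)
  have "d_pairing ((d_pairing ^^ j) F) p = d_pairing ((d_pairing ^^ j) G) p"
    by (rule d_pairing_cong[OF assms(1) Suc.prems Suc.IH])
  then show ?case by simp
qed (simp add: assms(3))

lemma d_pairing_sum:
  assumes "\<And>i. i \<in> I \<Longrightarrow> holo_on (F i) U" "open U" "p \<in> U"
  shows "d_pairing (\<lambda>q. \<Sum>i\<in>I. F i q) p = (\<Sum>i\<in>I. d_pairing (F i) p)"
proof -
  have "dird (0, axis k 1) (dird (axis k 1, 0) (\<lambda>q. \<Sum>i\<in>I. F i q)) p
      = (\<Sum>i\<in>I. dird (0, axis k 1) (dird (axis k 1, 0) (F i)) p)" for k
  proof -
    have "dird (0, axis k 1) (dird (axis k 1, 0) (\<lambda>q. \<Sum>i\<in>I. F i q)) p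
        = dird (0, axis k 1) (\<lambda>q. \<Sum>i\<in>I. dird (axis k 1, 0) (F i) q) p"
      by (rule dird_cong[OF assms(2,3)], rule dird_sum) (use assms(1) in auto)
    also have "\<dots> = (\<Sum>i\<in>I. dird (0, axis k 1) (dird (axis k 1, 0) (F i)) p)"
      by (rule dird_sum[OF _ assms(3)]) (intro holo_on_dird assms(1,2))
    finally show ?thesis .
  qed
  then show ?thesis by (simp add: d_pairing_eq sum.swap[of _ I])
qed

lemma d_pairing_power_sum:
  assumes "\<And>i. i \<in> I \<Longrightarrow> holo_on (F i) U" "open U" "p \<in> U"
  shows "(d_pairing ^^ j) (\<lambda>q. \<Sum>i\<in>I. F i q) p = (\<Sum>i\<in>I. (d_pairing ^^ j) (F i) p)"
  using assms(3)
proof (induction j arbitrary: p)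
  case (Suc j)
  have "d_pairing ((d_pairing ^^ j) (\<lambda>q. \<Sum>i\<in>I. F i q)) p
      = d_pairing (\<lambda>q. \<Sum>i\<in>I. (d_pairing ^^ j) (F i) q) p"
    by (rule d_pairing_cong[OF assms(2) Suc.prems Suc.IH])
  also have "\<dots> = (\<Sum>i\<in>I. d_pairing ((d_pairing ^^ j) (F i)) p)"
    by (rule d_pairing_sum[OF _ assms(2) Suc.prems]) (intro holo_on_d_pairing_power assms(1,2))
  finally show ?case by simp
qed simp

lemma d_pairing_cmult:
  assumes "holo_on F U" "open U" "p \<in> U"
  shows "d_pairing (\<lambda>q. c * F q) p = c * d_pairing F p"
proof -
  have "dird (0, axis k 1) (dird (axis k 1, 0) (\<lambda>q. c * F q)) p
      = c * dird (0, axis k 1) (dird (axis k 1, 0) F) p" for k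
  proof -
    have "dird (0, axis k 1) (dird (axis k 1, 0) (\<lambda>q. c * F q)) p
        = dird (0, axis k 1) (\<lambda>q. c * dird (axis k 1, 0) F q) p"
      by (rule dird_cong[OF assms(2,3)], rule dird_cmult[OF assms(1)])
    also have "\<dots> = c * dird (0, axis k 1) (dird (axis k 1, 0) F) p"
      by (rule dird_cmult[OF holo_on_dird[OF assms(1,2)] assms(3)])
    finally show ?thesis .
  qed
  then show ?thesis by (simp add: d_pairing_eq sum_distrib_left)
qed

lemma d_pairing_power_cmult:
  assumes "holo_on F U" "open U" "p \<in> U"
  shows "(d_pairing ^^ j) (\<lambda>q. c * F q) p = c * (d_pairing ^^ j) F p"
  using assms(3)
proof (induction j arbitrary: p)
  case (Suc j)
  have "d_pairing ((d_pairing ^^ j) (\<lambda>q. c * F q)) p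
      = d_pairing (\<lambda>q. c * (d_pairing ^^ j) F q) p"
    by (rule d_pairing_cong[OF assms(2) Suc.prems Suc.IH])
  also have "\<dots> = c * d_pairing ((d_pairing ^^ j) F) p"
    by (rule d_pairing_cmult[OF holo_on_d_pairing_power[OF assms(1,2)] assms(2) Suc.prems])
  finally show ?case by simp
qed simp

subsection \<open>Dependence on parameters\<close>

text \<open>\<open>d_pairing\<close> acting on the second argument of a function of a parameter and a cotangent
  vector.\<close>

definition d_pairing_par ::
    "('a::complex_normed \<times> 'n::finite cotangent \<Rightarrow> complex) \<Rightarrow> 'a \<times> 'n cotangent \<Rightarrow> complex"
  where "d_pairing_par F = (\<lambda>(p, q). d_pairing (\<lambda>q. F (p, q)) q)"

lemma dird_first: "dird u (\<lambda>p. F (p, q)) p = dird (u, 0) F (p, q)"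
  by (simp add: dird_def)

lemma d_pairing_par_eq: "d_pairing_par F x =
    (\<Sum>i\<in>UNIV. dird (0, (0, axis i 1)) (dird (0, (axis i 1, 0)) F) x)"
  by (cases x) (simp add: d_pairing_par_def d_pairing_eq dird_def)

lemma d_pairing_par_power: "(d_pairing ^^ j) (\<lambda>q. F (p, q)) q = (d_pairing_par ^^ j) F (p, q)"
proof (induction j arbitrary: q)
  case (Suc j)
  have "(d_pairing ^^ j) (\<lambda>q. F (p, q)) = (\<lambda>q. (d_pairing_par ^^ j) F (p, q))"
    using Suc.IH by auto
  then show ?case by (simp add: d_pairing_par_def[of "(d_pairing_par ^^ j) F"])
qed simp

lemma holo_on_d_pairing_par:
  fixes F :: "'a::{complex_normed, euclidean_space} \<times> 'n::finite cotangent \<Rightarrow> complex"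
  assumes "holo_on F U" "open U"
  shows "holo_on (d_pairing_par F) U"
  unfolding d_pairing_par_eq[abs_def] by (intro holo_on_sum holo_on_dird assms)

lemma holo_on_d_pairing_par_power:
  fixes F :: "'a::{complex_normed, euclidean_space} \<times> 'n::finite cotangent \<Rightarrow> complex"
  assumes "holo_on F U" "open U"
  shows "holo_on ((d_pairing_par ^^ j) F) U"
  by (induction j) (simp_all add: assms holo_on_d_pairing_par)

lemma d_pairing_par_cong:
  assumes "open U" "p \<in> U" "\<And>q. q \<in> U \<Longrightarrow> F q = G q"
  shows "d_pairing_par F p = d_pairing_par G p"
  unfolding d_pairing_par_eq
  by (intro sum.cong refl dird_cong[OF assms(1,2)] dird_cong[OF assms(1)] assms(3))

lemma d_pairing_par_power_cong:
  assumes "open U" "p \<in> U" "\<And>q. q \<in> U \<Longrightarrow> F q = G q"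
  shows "(d_pairing_par ^^ j) F p = (d_pairing_par ^^ j) G p"
  using assms(2)
proof (induction j arbitrary: p)
  case (Suc j)
  have "d_pairing_par ((d_pairing_par ^^ j) F) p = d_pairing_par ((d_pairing_par ^^ j) G) p"
    by (rule d_pairing_par_cong[OF assms(1) Suc.prems Suc.IH])
  then show ?case by simp
qed (simp add: assms(3))

text \<open>Here \<open>v\<close> is an arbitrary direction; the case of interest is a direction in the parameters.\<close>

lemma dird_d_pairing_par:
  fixes F :: "'a::{complex_normed, euclidean_space} \<times> 'n::finite cotangent \<Rightarrow> complex"
  assumes "holo_on F U" "open U" "x \<in> U"
  shows "dird v (d_pairing_par F) x = d_pairing_par (dird v F) x"
proof -
  have "dird v (d_pairing_par F) x
      = (\<Sum>i\<in>UNIV. dird v (dird (0, (0, axis i 1)) (dird (0, (axis i 1, 0)) F)) x)"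
    unfolding d_pairing_par_eq[abs_def]
    by (rule dird_sum[OF _ assms(3)]) (intro holo_on_dird assms)
  also have "\<dots> = (\<Sum>i\<in>UNIV. dird (0, (0, axis i 1)) (dird v (dird (0, (axis i 1, 0)) F)) x)"
    by (intro sum.cong refl dird_commute[OF holo_on_dird[OF assms(1,2)] assms(2,3)])
  also have "\<dots> = (\<Sum>i\<in>UNIV. dird (0, (0, axis i 1)) (dird (0, (axis i 1, 0)) (dird v F)) x)"
    by (intro sum.cong refl dird_cong[OF assms(2,3)] dird_commute[OF assms(1,2)])
  finally show ?thesis by (simp add: d_pairing_par_eq)
qed

lemma dird_d_pairing_par_power:
  fixes F :: "'a::{complex_normed, euclidean_space} \<times> 'n::finite cotangent \<Rightarrow> complex"
  assumes "holo_on F U" "open U" "x \<in> U"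
  shows "dird v ((d_pairing_par ^^ j) F) x = (d_pairing_par ^^ j) (dird v F) x"
  using assms(3)
proof (induction j arbitrary: x)
  case (Suc j)
  have "dird v (d_pairing_par ((d_pairing_par ^^ j) F)) x
      = d_pairing_par (dird v ((d_pairing_par ^^ j) F)) x"
    by (rule dird_d_pairing_par[OF holo_on_d_pairing_par_power[OF assms(1,2)] assms(2) Suc.prems])
  also have "\<dots> = d_pairing_par ((d_pairing_par ^^ j) (dird v F)) x"
    by (rule d_pairing_par_cong[OF assms(2) Suc.prems Suc.IH])
  finally show ?case by simp
qed simp

lemma holo_on_dird_power:
  fixes F :: "'a::{complex_normed, euclidean_space} \<Rightarrow> complex"
  assumes "holo_on F U" "open U"
  shows "holo_on ((dird v ^^ j) F) U"
  by (induction j) (simp_all add: assms holo_on_dird)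

lemma dird_power_d_pairing_par_power:
  fixes F :: "'a::{complex_normed, euclidean_space} \<times> 'n::finite cotangent \<Rightarrow> complex"
  assumes "holo_on F U" "open U" "x \<in> U"
  shows "(dird v ^^ i) ((d_pairing_par ^^ j) F) x = (d_pairing_par ^^ j) ((dird v ^^ i) F) x"
  using assms(3)
proof (induction i arbitrary: x)
  case (Suc i)
  have "dird v ((dird v ^^ i) ((d_pairing_par ^^ j) F)) x
      = dird v ((d_pairing_par ^^ j) ((dird v ^^ i) F)) x"
    by (rule dird_cong[OF assms(2) Suc.prems Suc.IH])
  also have "\<dots> = (d_pairing_par ^^ j) (dird v ((dird v ^^ i) F)) x"
    by (rule dird_d_pairing_par_power[OF holo_on_dird_power[OF assms(1,2)] assms(2) Suc.prems])
  finally show ?case by simp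
qed simp

subsection \<open>Cauchy estimates\<close>

lemma norm_axis_complex: "norm (axis i (a::complex)) = cmod a"
  by (simp add: norm_eq_sqrt_inner inner_axis_axis)

text \<open>Product of two closed balls, for the Euclidean norms.\<close>

definition bibox :: "real \<Rightarrow> real \<Rightarrow> 'n::finite cotangent set"
  where "bibox a b = {(z, \<zeta>). norm z \<le> a \<and> norm \<zeta> \<le> b}"

lemma d_pairing_bound:
  fixes F :: "'n::finite cotangent \<Rightarrow> complex"
  assumes F: "holo_on F U" "open U" and box: "bibox a b \<subseteq> U"
    and M: "\<And>p. p \<in> bibox a b \<Longrightarrow> cmod (F p) \<le> M"
    and \<delta>: "\<delta> > 0" "\<epsilon> > 0" and p: "p \<in> bibox (a - \<delta>) (b - \<epsilon>)"
  shows "cmod (d_pairing F p) \<le> real CARD('n) * (M / (\<delta> * \<epsilon>))"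
proof -
  have 1: "cmod (dird (axis i 1, 0) F q) \<le> M / \<delta>" if q: "q \<in> bibox (a - \<delta>) b" for i q
  proof (rule dird_Cauchy_bound[OF F \<delta>(1)])
    fix s :: complex assume s: "cmod s \<le> \<delta>"
    have "norm (fst q + axis i s) \<le> a"
      using norm_triangle_ineq[of "fst q" "axis i s"] s q
      by (auto simp: bibox_def norm_axis_complex split_beta)
    then have "q + s *\<^sub>C (axis i 1, 0) \<in> bibox a b"
      using q by (cases q) (auto simp: bibox_def scaleC_axis)
    then show "q + s *\<^sub>C (axis i 1, 0) \<in> U \<and> cmod (F (q + s *\<^sub>C (axis i 1, 0))) \<le> M"
      using box M by auto
  qed
  have "cmod (dird (0, axis i 1) (dird (axis i 1, 0) F) p) \<le> (M / \<delta>) / \<epsilon>" for i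
  proof (rule dird_Cauchy_bound[OF holo_on_dird[OF F] F(2) \<delta>(2)])
    fix s :: complex assume s: "cmod s \<le> \<epsilon>"
    have "norm (snd p + axis i s) \<le> b"
      using norm_triangle_ineq[of "snd p" "axis i s"] s p
      by (auto simp: bibox_def norm_axis_complex split_beta)
    then have *: "p + s *\<^sub>C (0, axis i 1) \<in> bibox (a - \<delta>) b"
      using p by (cases p) (auto simp: bibox_def scaleC_axis)
    moreover have "bibox (a - \<delta>) b \<subseteq> bibox a b" using \<delta>(1) by (auto simp: bibox_def)
    ultimately show "p + s *\<^sub>C (0, axis i 1) \<in> U \<and>
        cmod (dird (axis i 1, 0) F (p + s *\<^sub>C (0, axis i 1))) \<le> M / \<delta>"
      using box 1[OF *] by auto
  qed
  then have "cmod (d_pairing F p) \<le> (\<Sum>i\<in>(UNIV::'n set). (M / \<delta>) / \<epsilon>)"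
    unfolding d_pairing_eq by (rule sum_norm_le)
  then show ?thesis by simp
qed

lemma power_self_le_fact: "real j ^ j \<le> 3 ^ j * fact j"
proof -
  have "real j ^ j /\<^sub>R fact j \<le> (\<Sum>n. real j ^ n /\<^sub>R fact n)"
    using sum_le_suminf[OF summable_exp_generic, of "{j}" "real j"] by simp
  also have "\<dots> = exp (real j * 1)" by (simp add: exp_def)
  also have "\<dots> = exp 1 ^ j" by (rule exp_of_nat_mult)
  also have "\<dots> \<le> 3 ^ j" by (rule power_mono[OF exp_le]) simp
  finally show ?thesis by (simp add: field_simps)
qed

text \<open>Each of the \<open>j\<close> applications of \<open>d_pairing\<close> uses up the \<open>j\<close>-th part of both radii; the
  resulting factor \<open>j\<^sup>2\<^sup>j\<close> is compensated up to \<open>j\<^sup>j\<close> by the factorial.\<close>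

lemma d_pairing_power_bound:
  fixes F :: "'n::finite cotangent \<Rightarrow> complex"
  assumes F: "holo_on F U" "open U" and ab: "a > 0" "b > 0" and box: "bibox a b \<subseteq> U"
    and M: "\<And>p. p \<in> bibox a b \<Longrightarrow> cmod (F p) \<le> M"
  shows "cmod ((d_pairing ^^ j) F (0, 0) / fact j) \<le> (3 * real CARD('n) * real j / (a * b)) ^ j * M"
proof (cases "j = 0")
  case True
  then show ?thesis using M[of "(0, 0)"] ab by (simp add: bibox_def)
next
  case False
  define c where "c = real CARD('n) * (real j)\<^sup>2 / (a * b)"
  have "(0, 0) \<in> bibox a b" using ab by (simp add: bibox_def)
  from order_trans[OF norm_ge_zero M[OF this]] have M0: "M \<ge> 0" .
  have "\<forall>p\<in>bibox (a - k * (a / j)) (b - k * (b / j)). cmod ((d_pairing ^^ k) F p) \<le> c ^ k * M" for k :: nat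
  proof (induction k)
    case 0
    then show ?case using M by simp
  next
    case (Suc k)
    show ?case
    proof
      fix p :: "'n cotangent" assume "p \<in> bibox (a - (Suc k) * (a / j)) (b - (Suc k) * (b / j))"
      then have p: "p \<in> bibox ((a - k * (a / j)) - a / j) ((b - k * (b / j)) - b / j)"
        using False by (simp add: algebra_simps add_divide_distrib)
      have "bibox (a - k * (a / j)) (b - k * (b / j)) \<subseteq> (bibox a b :: 'n cotangent set)"
        unfolding bibox_def using ab by (auto intro: order_trans)
      then have "cmod (d_pairing ((d_pairing ^^ k) F) p)
          \<le> real CARD('n) * ((c ^ k * M) / ((a / j) * (b / j)))"
        using Suc.IH box False ab
        by (intro d_pairing_bound[OF holo_on_d_pairing_power[OF F] F(2) _ _ _ _ p]) auto
      also have "\<dots> = c ^ Suc k * M" by (simp add: c_def power2_eq_square field_simps)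
      finally show "cmod ((d_pairing ^^ Suc k) F p) \<le> c ^ Suc k * M" by simp
    qed
  qed
  from this[of j] False have "cmod ((d_pairing ^^ j) F (0, 0)) \<le> c ^ j * M"
    by (simp add: bibox_def)
  then have "cmod ((d_pairing ^^ j) F (0, 0) / fact j) \<le> c ^ j * M / fact j"
    by (simp add: norm_divide divide_right_mono)
  also have "c ^ j * M / fact j = (real CARD('n) * real j / (a * b)) ^ j * M * (real j ^ j / fact j)"
    by (simp add: c_def power2_eq_square power_mult_distrib power_divide)
  also have "\<dots> \<le> (real CARD('n) * real j / (a * b)) ^ j * M * 3 ^ j"
    using power_self_le_fact[of j] M0 ab
    by (intro mult_left_mono) (auto simp: divide_le_eq)
  also have "\<dots> = (3 * real CARD('n) * real j / (a * b)) ^ j * M"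
    by (simp add: power_mult_distrib power_divide)
  finally show ?thesis .
qed

section \<open>Exponentials determine continuous functionals\<close>

text \<open>The bilinear pairing of vectors and covectors, without conjugation.\<close>

definition cdot :: "complex ^ 'n \<Rightarrow> complex ^ 'n \<Rightarrow> complex"
  where "cdot x y = (\<Sum>i\<in>UNIV. x $ i * y $ i)"

lemma holo_on_cdot:
  assumes "holo_on f U" "holo_on g U"
  shows "holo_on (\<lambda>p. cdot (f p) (g p)) U"
  unfolding cdot_def by (intro holo_on_sum holo_on_mult holo_on_nth assms)

text \<open>The transpose is adjoint with respect to \<open>cdot\<close>.\<close>

lemma cdot_transpose: "cdot x (transpose A *v l) = cdot (A *v x) l"
proof -
  have "cdot x (transpose A *v l) = (\<Sum>i\<in>UNIV. \<Sum>j\<in>UNIV. x $ i * (A $ j $ i * l $ j))"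
    by (simp add: cdot_def matrix_vector_mult_def transpose_def sum_distrib_left)
  also have "\<dots> = (\<Sum>j\<in>UNIV. \<Sum>i\<in>UNIV. x $ i * (A $ j $ i * l $ j))" by (rule sum.swap)
  also have "\<dots> = cdot (A *v x) l"
    by (simp add: cdot_def matrix_vector_mult_def sum_distrib_right sum_distrib_left mult_ac)
  finally show ?thesis .
qed

lemma cdot_add: "cdot x (y + z) = cdot x y + cdot x z" "cdot (x + y) z = cdot x z + cdot y z"
  by (simp_all add: cdot_def algebra_simps sum.distrib)

lemma cdot_axis: "cdot (axis i s) y = s * y $ i" "cdot y (axis i s) = y $ i * s"
  by (simp_all add: cdot_def axis_def if_distrib[of "\<lambda>x. x * _"] if_distrib[of "\<lambda>x. _ * x"] cong: if_cong)

text \<open>Iterated directional derivatives are ordinary derivatives along complex lines.\<close>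

lemma higher_deriv_slice:
  fixes f :: "'a::{complex_normed, euclidean_space} \<Rightarrow> complex"
  assumes f: "holo_on f U" and U: "open U" and x: "a + s *\<^sub>C v \<in> U"
  shows "(deriv ^^ k) (\<lambda>s. f (a + s *\<^sub>C v)) s = (dird v ^^ k) f (a + s *\<^sub>C v)"
  using x
proof (induction k arbitrary: s)
  case (Suc k)
  have ev: "eventually (\<lambda>t. (a + s *\<^sub>C v) + t *\<^sub>C v \<in> U) (nhds 0)"
    by (rule open_eventually_dird[OF U Suc.prems])
  have "eventually (\<lambda>t. a + t *\<^sub>C v \<in> U) (nhds s)"
  proof -
    have "continuous_on UNIV (\<lambda>s. a + s *\<^sub>C v)"
      by (intro continuous_intros linear_continuous_on bounded_linear_scaleC_left)
    then have "open ((\<lambda>s. a + s *\<^sub>C v) -` U)"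
      using U by (simp add: continuous_on_open_vimage)
    then show ?thesis using Suc.prems unfolding eventually_nhds by blast
  qed
  then have "eventually (\<lambda>t. (deriv ^^ k) (\<lambda>s. f (a + s *\<^sub>C v)) t = (dird v ^^ k) f (a + t *\<^sub>C v)) (nhds s)"
    by eventually_elim (rule Suc.IH)
  from deriv_cong_ev[OF this refl]
  have "(deriv ^^ Suc k) (\<lambda>s. f (a + s *\<^sub>C v)) s = deriv (\<lambda>t. (dird v ^^ k) f (a + t *\<^sub>C v)) s"
    by simp
  also have "\<dots> = dird v ((dird v ^^ k) f) (a + s *\<^sub>C v)"
    using holo_on_dird_power[OF f U, where v = v and j = k] Suc.prems
    by (intro DERIV_imp_deriv slice_has_derivative)
      (auto intro: holo_on_has_derivative)
  finally show ?case by simp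
qed simp

text \<open>Open and closed polydiscs with center \<open>c\<close> and all radii equal to \<open>R\<close>.\<close>

definition polydisc :: "complex ^ 'n \<Rightarrow> real \<Rightarrow> (complex ^ 'n) set"
  where "polydisc c R = {\<zeta>. \<forall>i. cmod (\<zeta> $ i - c $ i) < R}"

definition cpolydisc :: "complex ^ 'n \<Rightarrow> real \<Rightarrow> (complex ^ 'n) set"
  where "cpolydisc c R = {\<zeta>. \<forall>i. cmod (\<zeta> $ i - c $ i) \<le> R}"

lemma open_polydisc: "open (polydisc c R)"
proof -
  have "polydisc c R = (\<Inter>i\<in>UNIV. {\<zeta>. cmod (\<zeta> $ i - c $ i) < R})"
    by (auto simp: polydisc_def)
  also have "open \<dots>"
    by (intro open_INT ballI open_Collect_less continuous_intros) auto
  finally show ?thesis .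
qed

lemma cpolydisc_subset_polydisc: "r < R \<Longrightarrow> cpolydisc c r \<subseteq> polydisc c R"
  by (auto simp: cpolydisc_def polydisc_def intro: le_less_trans)

lemma compact_cpolydisc: "compact (cpolydisc (c :: complex ^ 'n) R)"
proof -
  have "closed (cpolydisc c R)"
    unfolding cpolydisc_def by (intro closed_Collect_all closed_Collect_le continuous_intros)
  moreover have "bounded (cpolydisc c R)"
  proof (rule boundedI)
    fix \<zeta> assume z: "\<zeta> \<in> cpolydisc c R"
    have "norm \<zeta> \<le> (\<Sum>i\<in>UNIV. cmod (\<zeta> $ i))" 
      unfolding norm_vec_def by (rule L2_set_le_sum) simp
    also have "\<dots> \<le> (\<Sum>i\<in>(UNIV::'n set). R + cmod (c $ i))"
    proof (rule sum_mono)
      fix i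
      have "cmod (\<zeta> $ i - c $ i) \<le> R" using z by (simp add: cpolydisc_def)
      then show "cmod (\<zeta> $ i) \<le> R + cmod (c $ i)"
        using norm_triangle_sub[of "\<zeta> $ i" "c $ i"] by linarith
    qed
    finally show "norm \<zeta> \<le> (\<Sum>i\<in>(UNIV::'n set). R + cmod (c $ i))" .
  qed
  ultimately show ?thesis by (simp add: compact_eq_bounded_closed)
qed

lemma bounded_on_cpolydisc:
  assumes "holo_on f (polydisc c R)" "r < R"
  obtains M where "M > 0" "\<And>\<zeta>. \<zeta> \<in> cpolydisc c r \<Longrightarrow> cmod (f \<zeta>) \<le> M"
proof -
  have "continuous_on (cpolydisc c r) f"
    using holo_on_imp_continuous_on[OF assms(1)] cpolydisc_subset_polydisc[OF assms(2)]
    by (rule continuous_on_subset)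
  then have "bounded (f ` cpolydisc c r)"
    by (intro compact_imp_bounded compact_continuous_image compact_cpolydisc)
  then show thesis using that unfolding bounded_pos by blast
qed

lemma cmod_exp_diff_quotient:
  assumes "s > 0" "s \<le> 1" "cmod u \<le> T"
  shows "cmod ((exp (of_real s * u) - 1) / of_real s - u) \<le> exp T * T\<^sup>2 * s"
proof -
  have T: "0 \<le> T" using assms(3) norm_ge_zero order_trans by blast
  let ?z = "of_real s * u"
  have "cmod (exp ?z - (\<Sum>k\<le>1. ?z ^ k / fact k)) \<le> exp \<bar>Re ?z\<bar> * cmod ?z ^ Suc 1 / fact 1"
    by (rule Taylor_exp)
  then have "cmod (exp ?z - 1 - ?z) \<le> exp \<bar>Re ?z\<bar> * (s * cmod u)\<^sup>2"
    using assms(1) by (simp add: norm_mult diff_diff_eq power2_eq_square)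
  also have "\<dots> \<le> exp T * (s * T)\<^sup>2"
  proof (rule mult_mono)
    have "\<bar>Re ?z\<bar> \<le> cmod ?z" by (rule abs_Re_le_cmod)
    also have "\<dots> = s * cmod u" using assms by (simp add: norm_mult)
    also have "\<dots> \<le> 1 * T" by (rule mult_mono) (use assms in auto)
    finally show "exp \<bar>Re ?z\<bar> \<le> exp T" by simp
    have "s * cmod u \<le> s * T" by (rule mult_left_mono) (use assms in auto)
    then show "(s * cmod u)\<^sup>2 \<le> (s * T)\<^sup>2" by (rule power_mono) (use assms(1) in simp)
  qed simp_all
  finally have "cmod (exp ?z - 1 - ?z) / s \<le> exp T * (s * T)\<^sup>2 / s"
    using assms(1) by (simp add: divide_right_mono)
  moreover have "(exp ?z - 1) / of_real s - u = (exp ?z - 1 - ?z) / of_real s"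
    using assms(1) by (simp add: field_simps)
  ultimately show ?thesis using assms(1)
    by (simp add: norm_divide power2_eq_square mult_ac)
qed

text \<open>The functionals to be compared are of finite order at the point \<open>c\<close>, hence bounded with
  respect to the maximum on a small polydisc.  Let \<open>A\<close> consist of the \<open>f\<close> with
  \<open>L (f e\<^sub>x) = 0\<close> for all exponentials \<open>e\<^sub>x\<close>.  Differentiation in \<open>x\<close> shows that \<open>A\<close> is closed
  under multiplication by coordinates, and Taylor expansion in one coordinate after the other
  that it contains every holomorphic function.\<close>

lemma exp_determines:
  fixes L :: "(complex ^ 'n \<Rightarrow> complex) \<Rightarrow> complex"
  assumes r: "0 < r" "r < R"
    and add: "\<And>f g. holo_on f (polydisc c R) \<Longrightarrow> holo_on g (polydisc c R) \<Longrightarrow>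
      L (\<lambda>\<zeta>. f \<zeta> + g \<zeta>) = L f + L g"
    and cmult: "\<And>f a. holo_on f (polydisc c R) \<Longrightarrow> L (\<lambda>\<zeta>. a * f \<zeta>) = a * L f"
    and bound: "\<And>f B. holo_on f (polydisc c R) \<Longrightarrow>
      (\<And>\<zeta>. \<zeta> \<in> cpolydisc c r \<Longrightarrow> cmod (f \<zeta>) \<le> B) \<Longrightarrow> cmod (L f) \<le> C * B"
    and exps: "\<And>x. L (\<lambda>\<zeta>. exp (cdot x \<zeta>)) = 0"
    and f: "holo_on f (polydisc c R)"
  shows "L f = 0"
proof -
  let ?U = "polydisc c R" and ?K = "cpolydisc c r"
  have KU: "?K \<subseteq> ?U" by (rule cpolydisc_subset_polydisc[OF r(2)])
  have hexp: "holo_on (\<lambda>\<zeta>. exp (cdot x \<zeta>)) ?U" for x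
    by (intro holo_on_exp holo_on_cdot holo_on_const holo_on_id)
  have C0: "C \<ge> 0"
  proof -
    have "cmod (L (\<lambda>\<zeta>. 0 * 1)) \<le> C * 1"
      by (rule bound) (auto intro: holo_on_const)
    from order_trans[OF norm_ge_zero this] show ?thesis by simp
  qed
  \<comment> \<open>\<open>L\<close> is continuous with respect to uniform convergence on \<open>?K\<close>\<close>
  have lim: "L g = 0" if g: "holo_on g ?U"
    and ap: "\<And>\<epsilon>. \<epsilon> > 0 \<Longrightarrow> \<exists>h. holo_on h ?U \<and> L h = 0 \<and> (\<forall>\<zeta>\<in>?K. cmod (g \<zeta> - h \<zeta>) \<le> \<epsilon>)" for g
  proof -
    have "cmod (L g) \<le> 0 + \<epsilon>" if e: "\<epsilon> > 0" for \<epsilon>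
    proof -
      obtain h where h: "holo_on h ?U" "L h = 0" "\<forall>\<zeta>\<in>?K. cmod (g \<zeta> - h \<zeta>) \<le> \<epsilon> / (C + 1)"
        using ap[of "\<epsilon> / (C + 1)"] e C0 by auto
      have "L (\<lambda>\<zeta>. g \<zeta> + (-1) * h \<zeta>) = L g + L (\<lambda>\<zeta>. (-1) * h \<zeta>)"
        by (rule add[OF g]) (intro holo_intros h(1))
      also have "\<dots> = L g" unfolding cmult[OF h(1)] using h(2) by simp
      finally have "cmod (L g) \<le> C * (\<epsilon> / (C + 1))"
        using bound[of "\<lambda>\<zeta>. g \<zeta> + (-1) * h \<zeta>" "\<epsilon> / (C + 1)"] h g
        by (simp add: holo_on_diff)
      also have "\<dots> \<le> \<epsilon>" using C0 e by (simp add: field_simps)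
      finally show ?thesis by simp
    qed
    then have "cmod (L g) \<le> 0" by (rule field_le_epsilon)
    then show ?thesis by simp
  qed
  define A where "A = {g. holo_on g ?U \<and> (\<forall>x. L (\<lambda>\<zeta>. g \<zeta> * exp (cdot x \<zeta>)) = 0)}"
  have A_one: "(\<lambda>\<zeta>. 1) \<in> A" by (simp add: A_def exps holo_on_const)
  have A_add: "(\<lambda>\<zeta>. g \<zeta> + h \<zeta>) \<in> A" if "g \<in> A" "h \<in> A" for g h
  proof -
    have "L (\<lambda>\<zeta>. g \<zeta> * exp (cdot x \<zeta>) + h \<zeta> * exp (cdot x \<zeta>)) = 0" for x
      using that by (subst add) (auto simp: A_def intro: holo_on_mult hexp)
    then show ?thesis using that by (auto simp: A_def holo_on_add distrib_right)
  qed
  have A_cmult: "(\<lambda>\<zeta>. a * g \<zeta>) \<in> A" if "g \<in> A" for g a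
  proof -
    have "L (\<lambda>\<zeta>. a * (g \<zeta> * exp (cdot x \<zeta>))) = 0" for x
      using that by (subst cmult) (auto simp: A_def intro: holo_on_mult hexp)
    then show ?thesis using that by (auto simp: A_def holo_on_mult holo_on_const mult.assoc)
  qed
  have A_const: "(\<lambda>\<zeta>. a) \<in> A" for a using A_cmult[OF A_one, of a] by simp
  have A_lim: "g \<in> A" if g: "holo_on g ?U"
    and ap: "\<And>\<epsilon>. \<epsilon> > 0 \<Longrightarrow> \<exists>h\<in>A. \<forall>\<zeta>\<in>?K. cmod (g \<zeta> - h \<zeta>) \<le> \<epsilon>" for g
  proof -
    have "L (\<lambda>\<zeta>. g \<zeta> * exp (cdot x \<zeta>)) = 0" for x
    proof (rule lim)
      show "holo_on (\<lambda>\<zeta>. g \<zeta> * exp (cdot x \<zeta>)) ?U" by (intro holo_on_mult g hexp)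
      fix \<epsilon> :: real assume e: "\<epsilon> > 0"
      obtain M where M: "M > 0" "\<And>\<zeta>. \<zeta> \<in> ?K \<Longrightarrow> cmod (exp (cdot x \<zeta>)) \<le> M"
        using bounded_on_cpolydisc[OF hexp r(2)] by metis
      obtain h where h: "h \<in> A" "\<forall>\<zeta>\<in>?K. cmod (g \<zeta> - h \<zeta>) \<le> \<epsilon> / M"
        using ap[of "\<epsilon> / M"] M(1) e by auto
      have "cmod (g \<zeta> * exp (cdot x \<zeta>) - h \<zeta> * exp (cdot x \<zeta>)) \<le> \<epsilon>" if z: "\<zeta> \<in> ?K" for \<zeta>
      proof -
        have "cmod (g \<zeta> * exp (cdot x \<zeta>) - h \<zeta> * exp (cdot x \<zeta>))
            = cmod (g \<zeta> - h \<zeta>) * cmod (exp (cdot x \<zeta>))"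
          by (simp only: norm_mult left_diff_distrib[symmetric])
        also have "\<dots> \<le> (\<epsilon> / M) * M"
          using h(2) M z by (intro mult_mono) (auto simp: less_imp_le e)
        finally show ?thesis using M(1) by simp
      qed
      then show "\<exists>k. holo_on k ?U \<and> L k = 0 \<and>
          (\<forall>\<zeta>\<in>?K. cmod (g \<zeta> * exp (cdot x \<zeta>) - k \<zeta>) \<le> \<epsilon>)"
        using h(1) by (intro exI[of _ "\<lambda>\<zeta>. h \<zeta> * exp (cdot x \<zeta>)"])
          (auto simp: A_def intro: holo_on_mult hexp)
    qed
    then show ?thesis using g by (simp add: A_def)
  qed
  have A_coord: "(\<lambda>\<zeta>. g \<zeta> * \<zeta> $ i) \<in> A" if gA: "g \<in> A" for g i
  proof -
    have g: "holo_on g ?U" using gA by (simp add: A_def)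
    have "L (\<lambda>\<zeta>. g \<zeta> * \<zeta> $ i * exp (cdot x \<zeta>)) = 0" for x
    proof (rule lim)
      show "holo_on (\<lambda>\<zeta>. g \<zeta> * \<zeta> $ i * exp (cdot x \<zeta>)) ?U"
        by (intro holo_on_mult g hexp holo_on_nth holo_on_id)
      fix \<epsilon> :: real assume e: "\<epsilon> > 0"
      obtain M where M: "M > 0" "\<And>\<zeta>. \<zeta> \<in> ?K \<Longrightarrow> cmod (g \<zeta> * exp (cdot x \<zeta>)) \<le> M"
        using bounded_on_cpolydisc[OF holo_on_mult[OF g hexp] r(2)] by metis
      define T where "T = cmod (c $ i) + r"
      have T: "cmod (\<zeta> $ i) \<le> T" if "\<zeta> \<in> ?K" for \<zeta>
      proof -
        have "cmod (\<zeta> $ i) \<le> cmod (c $ i) + cmod (\<zeta> $ i - c $ i)" by (rule norm_triangle_sub)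
        moreover have "cmod (\<zeta> $ i - c $ i) \<le> r" using that by (simp add: cpolydisc_def)
        ultimately show ?thesis by (simp add: T_def)
      qed
      have T0: "T > 0" using r(1) by (simp add: T_def add_nonneg_pos)
      define s where "s = min 1 (\<epsilon> / (M * (exp T * T\<^sup>2)))"
      have s: "s > 0" "s \<le> 1" "M * (exp T * T\<^sup>2 * s) \<le> \<epsilon>"
      proof -
        have p: "M * (exp T * T\<^sup>2) > 0" using M(1) T0 by simp
        then show "s > 0" "s \<le> 1" using e by (auto simp: s_def)
        have "s \<le> \<epsilon> / (M * (exp T * T\<^sup>2))" by (simp add: s_def)
        then show "M * (exp T * T\<^sup>2 * s) \<le> \<epsilon>"
          using p by (simp add: pos_le_divide_eq mult_ac)
      qed
      let ?s = "of_real s :: complex"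
      \<comment> \<open>the difference quotient of \<open>g e\<^sub>x\<close> with respect to the \<open>i\<close>-th component of \<open>x\<close>\<close>
      define k where "k = (\<lambda>\<zeta>. (1 / ?s) * (g \<zeta> * exp (cdot (x + axis i ?s) \<zeta>))
        + (- 1 / ?s) * (g \<zeta> * exp (cdot x \<zeta>)))"
      have "holo_on k ?U" unfolding k_def
        by (intro holo_on_add holo_on_mult holo_on_const g hexp)
      moreover have "L k = 0"
      proof -
        have "L k = L (\<lambda>\<zeta>. (1 / ?s) * (g \<zeta> * exp (cdot (x + axis i ?s) \<zeta>)))
            + L (\<lambda>\<zeta>. (- 1 / ?s) * (g \<zeta> * exp (cdot x \<zeta>)))"
          unfolding k_def by (rule add) (intro holo_on_mult holo_on_const g hexp)+
        also have "\<dots> = (1 / ?s) * L (\<lambda>\<zeta>. g \<zeta> * exp (cdot (x + axis i ?s) \<zeta>))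
            + (- 1 / ?s) * L (\<lambda>\<zeta>. g \<zeta> * exp (cdot x \<zeta>))"
          by (subst (1 2) cmult) (intro holo_on_mult g hexp refl)+
        also have "\<dots> = 0" using gA by (simp add: A_def)
        finally show ?thesis .
      qed
      moreover have "cmod (g \<zeta> * \<zeta> $ i * exp (cdot x \<zeta>) - k \<zeta>) \<le> \<epsilon>" if z: "\<zeta> \<in> ?K" for \<zeta>
      proof -
        have "g \<zeta> * \<zeta> $ i * exp (cdot x \<zeta>) - k \<zeta>
            = - (g \<zeta> * exp (cdot x \<zeta>)) * ((exp (?s * \<zeta> $ i) - 1) / ?s - \<zeta> $ i)"
          using s(1) by (simp add: k_def cdot_add cdot_axis exp_add field_simps)
        then have "cmod (g \<zeta> * \<zeta> $ i * exp (cdot x \<zeta>) - k \<zeta>)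
            = cmod (g \<zeta> * exp (cdot x \<zeta>)) * cmod ((exp (?s * \<zeta> $ i) - 1) / ?s - \<zeta> $ i)"
          by (simp only: norm_mult norm_minus_cancel)
        also have "\<dots> \<le> M * (exp T * T\<^sup>2 * s)"
          by (intro mult_mono M z cmod_exp_diff_quotient s T) (use M(1) in auto)
        also have "\<dots> \<le> \<epsilon>" by (rule s(3))
        finally show ?thesis .
      qed
      ultimately show "\<exists>k. holo_on k ?U \<and> L k = 0 \<and>
          (\<forall>\<zeta>\<in>?K. cmod (g \<zeta> * \<zeta> $ i * exp (cdot x \<zeta>) - k \<zeta>) \<le> \<epsilon>)" by blast
    qed
    moreover have "holo_on (\<lambda>\<zeta>. g \<zeta> * \<zeta> $ i) ?U" by (intro holo_on_mult g holo_on_nth holo_on_id)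
    ultimately show ?thesis by (simp add: A_def)
  qed
  have A_power: "(\<lambda>\<zeta>. g \<zeta> * (\<zeta> $ i - c $ i) ^ k) \<in> A" if "g \<in> A" for g i k
  proof (induction k)
    case (Suc k)
    have "(\<lambda>\<zeta>. (g \<zeta> * (\<zeta> $ i - c $ i) ^ k) * \<zeta> $ i + (- (c $ i)) * (g \<zeta> * (\<zeta> $ i - c $ i) ^ k)) \<in> A"
      by (intro A_add A_cmult A_coord Suc.IH)
    then show ?case by (simp add: algebra_simps)
  qed (use that in simp)
  have A_sum: "(\<lambda>\<zeta>. \<Sum>k<N. g k \<zeta>) \<in> A" if "\<And>k. g k \<in> A" for g and N :: nat
    by (induction N) (auto intro: A_const A_add that)
  \<comment> \<open>induction on the set \<open>S\<close> of the coordinates on which \<open>g\<close> depends\<close>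
  have main: "g \<in> A" if "finite S" "holo_on g ?U"
    "\<And>\<zeta> \<zeta>'. \<zeta> \<in> ?U \<Longrightarrow> \<zeta>' \<in> ?U \<Longrightarrow> \<forall>i\<in>S. \<zeta> $ i = \<zeta>' $ i \<Longrightarrow> g \<zeta> = g \<zeta>'" for g and S :: "'n set"
    using that
  proof (induction S arbitrary: g rule: finite_induct)
    case empty
    have cU: "c \<in> ?U" using r by (simp add: polydisc_def)
    show ?case
    proof (rule A_lim[OF empty.prems(1)])
      fix \<epsilon> :: real assume "\<epsilon> > 0"
      then show "\<exists>h\<in>A. \<forall>\<zeta>\<in>?K. cmod (g \<zeta> - h \<zeta>) \<le> \<epsilon>"
        using empty.prems(2)[OF _ cU] KU by (intro bexI[OF _ A_const[of "g c"]]) fastforce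
    qed
  next
    case (insert i S)
    \<comment> \<open>\<open>pr\<close> replaces the \<open>i\<close>-th coordinate by that of the center; \<open>a k\<close> below is the \<open>k\<close>-th
      Taylor coefficient in this coordinate and depends only on the others\<close>
    define pr where "pr = (\<lambda>\<zeta>. \<zeta> + axis i (c $ i - \<zeta> $ i))"
    have pr_nth: "pr \<zeta> $ j = (if j = i then c $ i else \<zeta> $ j)" for \<zeta> j
      by (simp add: pr_def axis_def)
    have pr_U: "pr \<zeta> \<in> polydisc c Q" if "\<zeta> \<in> polydisc c Q" "Q > 0" for \<zeta> Q
      using that by (simp add: polydisc_def pr_nth)
    have pr_back: "\<zeta> = pr \<zeta> + (\<zeta> $ i - c $ i) *\<^sub>C axis i 1" for \<zeta>
      by (simp add: vec_eq_iff pr_nth axis_def)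
    have pr_slice: "pr \<zeta> + s *\<^sub>C axis i 1 \<in> polydisc c Q" if "\<zeta> \<in> polydisc c Q" "cmod s < Q" for \<zeta> s Q
      using that by (auto simp: polydisc_def pr_nth axis_def)
    have holo_pr: "holo_on pr ?U"
      unfolding pr_def by (intro holo_intros)
    define a where "a = (\<lambda>k \<zeta>. (1 / fact k) * (dird (axis i 1) ^^ k) g (pr \<zeta>))"
    have R: "R > 0" using r by simp
    have a_holo: "holo_on (a k) ?U" for k
      unfolding a_def
      by (intro holo_on_mult holo_on_const holo_on_compose[OF holo_pr
          holo_on_dird_power[OF insert.prems(1) open_polydisc]] pr_U R)
    have a_eq: "a k \<zeta> = (deriv ^^ k) (\<lambda>s. g (pr \<zeta> + s *\<^sub>C axis i 1)) 0 / fact k"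
      if "\<zeta> \<in> ?U" for k \<zeta>
      using higher_deriv_slice[OF insert.prems(1) open_polydisc, of "pr \<zeta>" 0 "axis i 1" k] pr_U[OF that R]
      by (simp add: a_def)
    have aA: "a k \<in> A" for k
    proof (rule insert.IH[OF a_holo])
      fix \<zeta> \<zeta>' assume z: "\<zeta> \<in> ?U" "\<zeta>' \<in> ?U" "\<forall>j\<in>S. \<zeta> $ j = \<zeta>' $ j"
      have "g (pr \<zeta> + s *\<^sub>C axis i 1) = g (pr \<zeta>' + s *\<^sub>C axis i 1)" if "s \<in> ball 0 R" for s
        by (rule insert.prems(2)) (use z that in \<open>auto intro!: pr_slice simp: pr_nth\<close>)
      then have "eventually (\<lambda>s. g (pr \<zeta> + s *\<^sub>C axis i 1) = g (pr \<zeta>' + s *\<^sub>C axis i 1)) (nhds 0)"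
        using R by (intro eventually_nhds[THEN iffD2] exI[of _ "ball 0 R"]) auto
      from higher_deriv_cong_ev[OF this refl, of k] show "a k \<zeta> = a k \<zeta>'"
        unfolding a_eq[OF z(1)] a_eq[OF z(2)] by simp
    qed
    \<comment> \<open>a radius between \<open>r\<close> and \<open>R\<close>, so that the Taylor series converges uniformly on \<open>?K\<close>\<close>
    define Q where "Q = (r + R) / 2"
    have Q: "r < Q" "Q < R" "Q > 0" using r by (auto simp: Q_def)
    obtain M where M: "M > 0" "\<And>\<zeta>. \<zeta> \<in> cpolydisc c Q \<Longrightarrow> cmod (g \<zeta>) \<le> M"
      using bounded_on_cpolydisc[OF insert.prems(1) Q(2)] by metis
    have slice: "pr \<zeta> + s *\<^sub>C axis i 1 \<in> cpolydisc c Q" if "\<zeta> \<in> ?K" "cmod s \<le> Q" for \<zeta> s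
      unfolding cpolydisc_def
    proof (rule CollectI, rule allI)
      fix j
      have "cmod (\<zeta> $ j - c $ j) \<le> r" using that(1) by (simp add: cpolydisc_def)
      then show "cmod ((pr \<zeta> + s *\<^sub>C axis i 1) $ j - c $ j) \<le> Q"
        using that(2) Q by (simp add: pr_nth axis_def)
    qed
    have a_bound: "cmod (a k \<zeta>) \<le> M / Q ^ k" if z: "\<zeta> \<in> ?K" for k \<zeta>
    proof -
      have zU: "\<zeta> \<in> ?U" using z KU by auto
      have sub: "{s. cmod s \<le> Q} \<subseteq> {s. pr \<zeta> + s *\<^sub>C axis i 1 \<in> ?U}"
        using Q zU by (auto intro!: pr_slice)
      have hol: "(\<lambda>s. g (pr \<zeta> + s *\<^sub>C axis i 1)) holomorphic_on cball 0 Q"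
        using slice_holomorphic[OF insert.prems(1)]
        by (rule holomorphic_on_subset) (use sub in \<open>auto simp: cball_def\<close>)
      have "cmod ((deriv ^^ k) (\<lambda>s. g (pr \<zeta> + s *\<^sub>C axis i 1)) 0) \<le> fact k * M / Q ^ k"
        by (rule Cauchy_inequality)
          (use hol Q(3) slice[OF z] M(2) in \<open>auto intro: holomorphic_on_imp_continuous_on holomorphic_on_subset\<close>)
      then show ?thesis unfolding a_eq[OF zU] by (simp add: norm_divide field_simps)
    qed
    have sums: "(\<lambda>k. a k \<zeta> * (\<zeta> $ i - c $ i) ^ k) sums g \<zeta>" if z: "\<zeta> \<in> ?K" for \<zeta>
    proof -
      have zU: "\<zeta> \<in> ?U" using z KU by auto
      have "(\<lambda>s. g (pr \<zeta> + s *\<^sub>C axis i 1)) holomorphic_on ball 0 R"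
        using slice_holomorphic[OF insert.prems(1)]
        by (rule holomorphic_on_subset) (use zU in \<open>auto intro!: pr_slice\<close>)
      from holomorphic_power_series[OF this, of "\<zeta> $ i - c $ i"] zU
      have "(\<lambda>k. (deriv ^^ k) (\<lambda>s. g (pr \<zeta> + s *\<^sub>C axis i 1)) 0 / fact k * (\<zeta> $ i - c $ i - 0) ^ k)
          sums g (pr \<zeta> + (\<zeta> $ i - c $ i) *\<^sub>C axis i 1)"
        by (simp add: polydisc_def)
      then show ?thesis unfolding pr_back[symmetric] by (simp add: a_eq[OF zU])
    qed
    define q where "q = r / Q"
    have q: "0 < q" "q < 1" using r Q by (auto simp: q_def)
    show ?case
    proof (rule A_lim[OF insert.prems(1)])
      fix \<epsilon> :: real assume e: "\<epsilon> > 0"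
      have "(\<lambda>N. M * q ^ N / (1 - q)) \<longlonglongrightarrow> M * 0 / (1 - q)"
        by (intro tendsto_intros LIMSEQ_power_zero) (use q in auto)
      then have "eventually (\<lambda>N. M * q ^ N / (1 - q) < \<epsilon>) sequentially"
        using e by (intro order_tendstoD(2)) auto
      then obtain N where N: "M * q ^ N / (1 - q) < \<epsilon>"
        using eventually_happens' sequentially_bot by blast
      define h where "h = (\<lambda>\<zeta>. \<Sum>k<N. a k \<zeta> * (\<zeta> $ i - c $ i) ^ k)"
      have "h \<in> A" unfolding h_def by (intro A_sum A_power aA)
      moreover have "cmod (g \<zeta> - h \<zeta>) \<le> \<epsilon>" if z: "\<zeta> \<in> ?K" for \<zeta>
      proof -
        let ?t = "\<lambda>k. a k \<zeta> * (\<zeta> $ i - c $ i) ^ k"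
        have tb: "cmod (?t k) \<le> M * q ^ k" for k
        proof -
          have "cmod (?t k) \<le> (M / Q ^ k) * r ^ k"
            unfolding norm_mult norm_power using z M(1) Q(3)
            by (intro mult_mono power_mono a_bound) (auto simp: cpolydisc_def)
          then show ?thesis by (simp add: q_def power_divide)
        qed
        have gs: "(\<lambda>k. M * q ^ (k + N)) sums (M * q ^ N / (1 - q))"
          using sums_mult[OF geometric_sums[of q], of "M * q ^ N"] q by (simp add: power_add mult_ac)
        have "(\<lambda>k. ?t (k + N)) sums (g \<zeta> - h \<zeta>)"
          unfolding h_def by (rule sums_split_initial_segment[OF sums[OF z]])
        then have "g \<zeta> - h \<zeta> = (\<Sum>k. ?t (k + N))" by (rule sums_unique)
        also have "cmod \<dots> \<le> (\<Sum>k. M * q ^ (k + N))"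
          by (rule norm_suminf_le[OF tb sums_summable[OF gs]])
        also have "\<dots> = M * q ^ N / (1 - q)" using gs by (rule sums_unique[symmetric])
        finally show ?thesis using N by simp
      qed
      ultimately show "\<exists>h\<in>A. \<forall>\<zeta>\<in>?K. cmod (g \<zeta> - h \<zeta>) \<le> \<epsilon>" by blast
    qed
  qed
  have "f \<in> A" by (rule main[of UNIV, OF _ f]) (auto simp: vec_eq_iff intro: arg_cong[of _ _ f])
  then have "L (\<lambda>\<zeta>. f \<zeta> * exp (cdot 0 \<zeta>)) = 0" by (simp add: A_def)
  then show ?thesis by (simp add: cdot_def)
qed

text \<open>Covectors are multiplied by transposed matrices from the left, which simplification would
  turn into products \<open>l v* A\<close>.\<close>

declare transpose_matrix_vector [simp del]

section \<open>The transformation of symbols in one fiber\<close>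

text \<open>In \<open>\<Phi>\<^sup>*P(w, \<lambda>)\<close> only the fiber of \<open>P\<close> over the fixed point \<open>\<Phi>(w)\<close> enters.
  \<open>fiber_coeff G l j f\<close> is the coefficient of \<open>t\<^sup>j\<close> in
  \<open>e\<^bsup>t\<langle>\<partial>\<^sub>\<zeta>, \<partial>\<^sub>z\<rangle>\<^esup> f(\<zeta> + \<^sup>tG(z) l)\<close> at \<open>z = 0\<close>, \<open>\<zeta> = 0\<close>, for a symbol \<open>f\<close> on this fiber.\<close>

definition fiber_coeff ::
    "(complex^'n \<Rightarrow> complex^'n^'n) \<Rightarrow> complex^'n \<Rightarrow> nat \<Rightarrow> (complex^'n::finite \<Rightarrow> complex) \<Rightarrow> complex"
  where "fiber_coeff G l j f =
    (d_pairing ^^ j) (\<lambda>(z, \<zeta>). f (\<zeta> + transpose (G z) *v l)) (0, 0) / fact j"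

text \<open>The function to which the powers of \<open>d_pairing\<close> are applied, with the covector \<open>l\<close> as a
  parameter, and its domain for \<open>G\<close> on \<open>N\<close> and \<open>f\<close> on \<open>U\<close>.\<close>

definition fiber_fun ::
    "(complex^'n \<Rightarrow> complex^'n^'n) \<Rightarrow> (complex^'n::finite \<Rightarrow> complex) \<Rightarrow> (complex^'n) \<times> 'n cotangent \<Rightarrow> complex"
  where "fiber_fun G f = (\<lambda>(l, z, \<zeta>). f (\<zeta> + transpose (G z) *v l))"

definition fiber_dom ::
    "(complex^'n \<Rightarrow> complex^'n^'n) \<Rightarrow> (complex^'n) set \<Rightarrow> (complex^'n) set \<Rightarrow> ((complex^'n) \<times> 'n::finite cotangent) set"
  where "fiber_dom G N U = {(l, z, \<zeta>). z \<in> N \<and> \<zeta> + transpose (G z) *v l \<in> U}"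

lemma holo_fiber_arg:
  fixes G :: "complex^'n \<Rightarrow> complex^'n^'n"
  assumes "holo_on G N"
  shows "holo_on (\<lambda>(l, z, \<zeta>). \<zeta> + transpose (G z) *v l) {(l, z, \<zeta>). z \<in> N}"
proof -
  have "holo_on (\<lambda>x. G (fst (snd x))) {(l, z, \<zeta>). z \<in> N}"
    by (rule holo_on_compose[OF _ assms]) (auto intro!: holo_intros)
  then show ?thesis
    unfolding split_beta
    by (intro holo_on_add holo_on_transpose_vector holo_on_snd holo_on_fst holo_on_id)
qed

lemma open_preimage_holo:
  assumes "holo_on f U" "open U" "open V"
  shows "open {x \<in> U. f x \<in> V}"
  using continuous_open_preimage[OF holo_on_imp_continuous_on[OF assms(1)] assms(2,3)]
  by (simp add: vimage_def Int_def)

lemma open_second: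
  assumes "open N"
  shows "open {(l :: 'a::topological_space, z, \<zeta> :: 'b::topological_space). z \<in> N}"
proof -
  have "{(l :: 'a, z, \<zeta> :: 'b). z \<in> N} = UNIV \<times> N \<times> UNIV" by auto
  then show ?thesis using assms by (simp add: open_Times)
qed

lemma open_fiber_dom:
  assumes "holo_on G N" "open N" "open U"
  shows "open (fiber_dom G N U)"
proof -
  have "fiber_dom G N U = {x \<in> {(l, z, \<zeta>). z \<in> N}. (\<lambda>(l, z, \<zeta>). \<zeta> + transpose (G z) *v l) x \<in> U}"
    by (auto simp: fiber_dom_def)
  then show ?thesis
    using open_preimage_holo[OF holo_fiber_arg[OF assms(1)] open_second[OF assms(2)] assms(3)] by simp
qed

lemma holo_fiber_fun:
  assumes "holo_on G N" "holo_on f U"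
  shows "holo_on (fiber_fun G f) (fiber_dom G N U)"
proof -
  have "holo_on (\<lambda>x. f ((\<lambda>(l, z, \<zeta>). \<zeta> + transpose (G z) *v l) x)) (fiber_dom G N U)"
    by (rule holo_on_compose[OF holo_on_subset[OF holo_fiber_arg[OF assms(1)]] assms(2)])
      (auto simp: fiber_dom_def)
  then show ?thesis unfolding fiber_fun_def split_beta .
qed

lemma fiber_coeff_eq: "fiber_coeff G l j f = (d_pairing_par ^^ j) (fiber_fun G f) (l, 0, 0) / fact j"
proof -
  have "(\<lambda>(z, \<zeta>). f (\<zeta> + transpose (G z) *v l)) = (\<lambda>q. fiber_fun G f (l, q))"
    by (auto simp: fiber_fun_def)
  then show ?thesis by (simp add: fiber_coeff_def d_pairing_par_power)
qed

lemma holo_slice: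
  assumes "holo_on F U" shows "holo_on (\<lambda>q. F (p, q)) {q. (p, q) \<in> U}"
  by (rule holo_on_compose[OF _ assms]) (auto intro!: holo_intros)

lemma open_slice: "open U \<Longrightarrow> open {q. (p, q) \<in> U}"
  using open_vimage[of U "\<lambda>q. (p, q)"] by (simp add: vimage_def continuous_intros)

lemma fiber_slice:
  "(\<lambda>(z, \<zeta>). f (\<zeta> + transpose (G z) *v l)) = (\<lambda>q. fiber_fun G f (l, q))"
  by (auto simp: fiber_fun_def)

lemma fiber_coeff_alt:
  "fiber_coeff G l j f = (d_pairing ^^ j) (\<lambda>q. fiber_fun G f (l, q)) (0, 0) / fact j"
  by (simp only: fiber_coeff_def fiber_slice)

lemma fiber_coeff_cong:
  assumes G: "holo_on G N" "open N" "0 \<in> N" and U: "open U" "transpose (G 0) *v l \<in> U"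
    and eq: "\<And>\<zeta>. \<zeta> \<in> U \<Longrightarrow> f \<zeta> = g \<zeta>"
  shows "fiber_coeff G l j f = fiber_coeff G l j g"
proof -
  have "(d_pairing_par ^^ j) (fiber_fun G f) (l, 0, 0) = (d_pairing_par ^^ j) (fiber_fun G g) (l, 0, 0)"
    by (rule d_pairing_par_power_cong[OF open_fiber_dom[OF G(1,2) U(1)]])
      (use G U eq in \<open>auto simp: fiber_dom_def fiber_fun_def\<close>)
  then show ?thesis by (simp add: fiber_coeff_eq)
qed

lemma fiber_coeff_sum:
  assumes G: "holo_on G N" "open N" "0 \<in> N" and U: "open U" "transpose (G 0) *v l \<in> U"
    and f: "\<And>i. i \<in> I \<Longrightarrow> holo_on (f i) U"
  shows "fiber_coeff G l j (\<lambda>\<zeta>. \<Sum>i\<in>I. f i \<zeta>) = (\<Sum>i\<in>I. fiber_coeff G l j (f i))"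
proof -
  have "(d_pairing ^^ j) (\<lambda>q. \<Sum>i\<in>I. fiber_fun G (f i) (l, q)) (0, 0)
      = (\<Sum>i\<in>I. (d_pairing ^^ j) (\<lambda>q. fiber_fun G (f i) (l, q)) (0, 0))"
    by (rule d_pairing_power_sum[OF holo_slice[OF holo_fiber_fun[OF G(1) f]]
          open_slice[OF open_fiber_dom[OF G(1,2) U(1)]]])
      (use G U in \<open>auto simp: fiber_dom_def\<close>)
  moreover have "(\<lambda>q. fiber_fun G (\<lambda>\<zeta>. \<Sum>i\<in>I. f i \<zeta>) (l, q)) = (\<lambda>q. \<Sum>i\<in>I. fiber_fun G (f i) (l, q))"
    by (auto simp: fiber_fun_def)
  ultimately show ?thesis by (simp add: fiber_coeff_alt sum_divide_distrib)
qed

lemma fiber_coeff_add: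
  assumes "holo_on G N" "open N" "0 \<in> N" and "open U" "transpose (G 0) *v l \<in> U"
    and "holo_on f U" "holo_on g U"
  shows "fiber_coeff G l j (\<lambda>\<zeta>. f \<zeta> + g \<zeta>) = fiber_coeff G l j f + fiber_coeff G l j g"
  using fiber_coeff_sum[OF assms(1-5), of UNIV "\<lambda>b. if b then f else g" j] assms(6,7)
  by (simp add: UNIV_bool add.commute)

lemma fiber_coeff_cmult:
  assumes G: "holo_on G N" "open N" "0 \<in> N" and U: "open U" "transpose (G 0) *v l \<in> U"
    and f: "holo_on f U"
  shows "fiber_coeff G l j (\<lambda>\<zeta>. a * f \<zeta>) = a * fiber_coeff G l j f"
proof -
  have "(d_pairing ^^ j) (\<lambda>q. a * fiber_fun G f (l, q)) (0, 0)
      = a * (d_pairing ^^ j) (\<lambda>q. fiber_fun G f (l, q)) (0, 0)"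
    by (rule d_pairing_power_cmult[OF holo_slice[OF holo_fiber_fun[OF G(1) f]]
          open_slice[OF open_fiber_dom[OF G(1,2) U(1)]]])
      (use G U in \<open>auto simp: fiber_dom_def\<close>)
  moreover have "(\<lambda>q. fiber_fun G (\<lambda>\<zeta>. a * f \<zeta>) (l, q)) = (\<lambda>q. a * fiber_fun G f (l, q))"
    by (auto simp: fiber_fun_def)
  ultimately show ?thesis by (simp add: fiber_coeff_alt)
qed

lemma holo_fiber_coeff:
  assumes G: "holo_on G N" "open N" "0 \<in> N" and f: "holo_on f U" "open U"
  shows "holo_on (\<lambda>l. fiber_coeff G l j f) {l. transpose (G 0) *v l \<in> U}"
proof -
  have "holo_on ((d_pairing_par ^^ j) (fiber_fun G f)) (fiber_dom G N U)"
    by (intro holo_on_d_pairing_par_power holo_fiber_fun open_fiber_dom G f)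
  then have "holo_on (\<lambda>l. (d_pairing_par ^^ j) (fiber_fun G f) (l, 0, 0)) {l. transpose (G 0) *v l \<in> U}"
    by (rule holo_on_compose[rotated]) (use G in \<open>auto intro!: holo_intros simp: fiber_dom_def\<close>)
  then have "holo_on (\<lambda>l. (1 / fact j) * (d_pairing_par ^^ j) (fiber_fun G f) (l, 0, 0))
      {l. transpose (G 0) *v l \<in> U}"
    by (intro holo_on_mult holo_on_const)
  then show ?thesis by (simp add: fiber_coeff_eq)
qed

lemma open_fiber_preimage: "open U \<Longrightarrow> open {l :: complex ^ 'n. A *v l \<in> U}" for A :: "complex ^ 'n ^ 'm"
  using open_preimage_holo[OF holo_on_matrix_vector[OF holo_on_const holo_on_id], of UNIV U A] by simp

text \<open>\<open>fiber_coeff\<close> is bounded by the values on a neighborhood \<open>K\<close> of \<open>\<^sup>tG(0) l0\<close>, which may be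
  arbitrarily small, uniformly for covectors near \<open>l0\<close>.\<close>

lemma fiber_coeff_bound:
  fixes G :: "complex^'n::finite \<Rightarrow> complex^'n^'n"
  assumes G: "holo_on G N" "open N" "0 \<in> N" and U: "open U" and KU: "K \<subseteq> U"
    and V: "open V" "V \<subseteq> K" "transpose (G 0) *v l0 \<in> V"
  obtains \<delta> C where "\<delta> > 0"
    "\<And>l f B. l \<in> cball l0 \<delta> \<Longrightarrow> holo_on f U \<Longrightarrow> (\<And>\<zeta>. \<zeta> \<in> K \<Longrightarrow> cmod (f \<zeta>) \<le> B) \<Longrightarrow>
      cmod (fiber_coeff G l j f) \<le> C * B"
proof -
  have "open (fiber_dom G N V)" by (intro open_fiber_dom G V)
  moreover have "(l0, 0, 0) \<in> fiber_dom G N V" using G V by (simp add: fiber_dom_def)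
  ultimately obtain e where e: "e > 0" "ball (l0, 0, 0) e \<subseteq> fiber_dom G N V"
    using open_contains_ball by blast
  define \<delta> where "\<delta> = e / 4"
  have \<delta>: "\<delta> > 0" using e(1) by (simp add: \<delta>_def)
  have sub: "(l, z, \<zeta>) \<in> fiber_dom G N V" if "l \<in> cball l0 \<delta>" "(z, \<zeta>) \<in> bibox \<delta> \<delta>" for l z \<zeta>
  proof -
    have "dist (l0, 0, 0) (l, z, \<zeta>) \<le> dist l0 l + (norm z + norm \<zeta>)"
      using norm_Pair_le[of "l0 - l" "(- z, - \<zeta>)"] norm_Pair_le[of "- z" "- \<zeta>"]
      by (simp add: dist_norm)
    also have "\<dots> \<le> \<delta> + (\<delta> + \<delta>)" using that by (intro add_mono) (auto simp: bibox_def)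
    also have "\<dots> < e" using e(1) by (simp add: \<delta>_def)
    finally show ?thesis using e(2) by auto
  qed
  show thesis
  proof (rule that[OF \<delta>, of "(3 * real CARD('n) * real j / (\<delta> * \<delta>)) ^ j"])
    fix l f B
    assume l: "l \<in> cball l0 \<delta>" and f: "holo_on f U" and B: "\<And>\<zeta>. \<zeta> \<in> K \<Longrightarrow> cmod (f \<zeta>) \<le> B"
    have "cmod ((d_pairing ^^ j) (\<lambda>q. fiber_fun G f (l, q)) (0, 0) / fact j)
        \<le> (3 * real CARD('n) * real j / (\<delta> * \<delta>)) ^ j * B"
    proof (rule d_pairing_power_bound[OF holo_slice[OF holo_fiber_fun[OF G(1) f]]
          open_slice[OF open_fiber_dom[OF G(1,2) U]] \<delta> \<delta>])
      show "bibox \<delta> \<delta> \<subseteq> {q. (l, q) \<in> fiber_dom G N U}"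
        using sub[OF l] V KU by (fastforce simp: fiber_dom_def)
      fix p :: "'n cotangent" assume "p \<in> bibox \<delta> \<delta>"
      then show "cmod (fiber_fun G f (l, p)) \<le> B"
        using sub[OF l, of "fst p" "snd p"] V B by (auto simp: fiber_dom_def fiber_fun_def split_beta)
    qed
    then show "cmod (fiber_coeff G l j f) \<le> (3 * real CARD('n) * real j / (\<delta> * \<delta>)) ^ j * B"
      by (simp add: fiber_coeff_alt)
  qed
qed

subsection \<open>Exponentials\<close>

lemma d_pairing_exp:
  fixes \<phi> :: "complex^'n::finite \<Rightarrow> complex"
  assumes \<phi>: "holo_on \<phi> N" "z \<in> N"
  shows "d_pairing (\<lambda>(z, \<zeta>). exp (cdot x \<zeta>) * \<phi> z) (z, \<zeta>) = exp (cdot x \<zeta>) * dird x \<phi> z"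
proof -
  have 1: "dird (axis i 1, 0) (\<lambda>(z, \<zeta>). exp (cdot x \<zeta>) * \<phi> z) (z, \<zeta>) = exp (cdot x \<zeta>) * dird (axis i 1) \<phi> z"
    for i \<zeta>
    using dird_cmult[OF \<phi>, of "axis i 1" "exp (cdot x \<zeta>)"] by (simp add: dird_def)
  have 2: "dird (0, axis i 1) (dird (axis i 1, 0) (\<lambda>(z, \<zeta>). exp (cdot x \<zeta>) * \<phi> z)) (z, \<zeta>)
      = x $ i * (exp (cdot x \<zeta>) * dird (axis i 1) \<phi> z)" for i
  proof -
    have "dird (0, axis i 1) (dird (axis i 1, 0) (\<lambda>(z, \<zeta>). exp (cdot x \<zeta>) * \<phi> z)) (z, \<zeta>)
        = deriv (\<lambda>s. exp (cdot x \<zeta> + x $ i * s) * dird (axis i 1) \<phi> z) 0"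
      unfolding dird_def[of "(0, axis i 1)"] by (simp add: 1 scaleC_axis cdot_add cdot_axis)
    also have "\<dots> = x $ i * (exp (cdot x \<zeta>) * dird (axis i 1) \<phi> z)"
      by (rule DERIV_imp_deriv) (auto intro!: derivative_eq_intros)
    finally show ?thesis .
  qed
  have "x = (\<Sum>i\<in>UNIV. (x $ i) *\<^sub>C axis i 1)"
    by (simp add: vec_eq_iff axis_def if_distrib[of "\<lambda>y. _ * y"] cong: if_cong)
  then have "dird x \<phi> z = (\<Sum>i\<in>UNIV. x $ i * dird (axis i 1) \<phi> z)"
    using dird_sum_direction[OF \<phi>, of "\<lambda>i. (x $ i) *\<^sub>C axis i 1" UNIV] holo_on_has_derivative(2)[OF \<phi>]
    by simp
  then show ?thesis
    by (simp only: d_pairing_eq 2) (simp add: sum_distrib_left mult_ac)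
qed

lemma d_pairing_power_exp:
  fixes \<phi> :: "complex^'n::finite \<Rightarrow> complex"
  assumes \<phi>: "holo_on \<phi> N" "open N" and z: "z \<in> N"
  shows "(d_pairing ^^ j) (\<lambda>(z, \<zeta>). exp (cdot x \<zeta>) * \<phi> z) (z, \<zeta>) = exp (cdot x \<zeta>) * (dird x ^^ j) \<phi> z"
  using z
proof (induction j arbitrary: z \<zeta>)
  case (Suc j)
  have "d_pairing ((d_pairing ^^ j) (\<lambda>(z, \<zeta>). exp (cdot x \<zeta>) * \<phi> z)) (z, \<zeta>)
      = d_pairing (\<lambda>(z, \<zeta>). exp (cdot x \<zeta>) * (dird x ^^ j) \<phi> z) (z, \<zeta>)"
    by (rule d_pairing_cong[of "N \<times> UNIV"]) (use Suc.prems \<phi>(2) Suc.IH in \<open>auto intro: open_Times\<close>)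
  also have "\<dots> = exp (cdot x \<zeta>) * dird x ((dird x ^^ j) \<phi>) z"
    by (rule d_pairing_exp[OF holo_on_dird_power[OF \<phi>] Suc.prems])
  finally show ?case by simp
qed simp

text \<open>On exponentials the coefficients are those of a power series in one variable: \<open>\<partial>\<^sub>\<zeta>\<close> acts as
  multiplication by \<open>x\<close>, and \<open>\<langle>x, \<partial>\<^sub>z\<rangle>\<close> is the derivative in the direction \<open>x\<close>.\<close>

lemma fiber_coeff_exp:
  assumes G: "holo_on G N" "open N" "0 \<in> N"
  shows "fiber_coeff G l j (\<lambda>\<zeta>. exp (cdot x \<zeta>))
    = (deriv ^^ j) (\<lambda>s. exp (cdot (G (s *\<^sub>C x) *v x) l)) 0 / fact j"
proof -
  let ?\<phi> = "\<lambda>z. exp (cdot (G z *v x) l)"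
  have \<phi>: "holo_on ?\<phi> N"
    by (intro holo_on_exp holo_on_cdot holo_on_matrix_vector G holo_on_const)
  have "fiber_coeff G l j (\<lambda>\<zeta>. exp (cdot x \<zeta>))
      = (d_pairing ^^ j) (\<lambda>(z, \<zeta>). exp (cdot x \<zeta>) * ?\<phi> z) (0, 0) / fact j"
    by (simp add: fiber_coeff_def cdot_add cdot_transpose exp_add)
  also have "\<dots> = (dird x ^^ j) ?\<phi> 0 / fact j"
    by (subst d_pairing_power_exp[OF \<phi> G(2,3)]) (simp add: cdot_def)
  also have "(dird x ^^ j) ?\<phi> 0 = (deriv ^^ j) (\<lambda>s. ?\<phi> (0 + s *\<^sub>C x)) 0"
    using higher_deriv_slice[OF \<phi> G(2), of 0 0 x j] G(3) by simp
  finally show ?thesis by simp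
qed

text \<open>A family of linear maps \<open>g z\<close> enters \<open>fiber_coeff_exp\<close> through \<open>g (s x) x\<close> for \<open>s\<close> near \<open>0\<close>.
  This expression is determined by the values \<open>g z z\<close>: for \<open>s \<noteq> 0\<close> by homogeneity, and for \<open>s = 0\<close> by
  continuity.\<close>

lemma linear_maps_agree:
  fixes g h :: "complex^'n \<Rightarrow> complex^'n \<Rightarrow> complex^'n"
  assumes holo: "\<And>x. holo_on (\<lambda>z. g z x) N" "\<And>x. holo_on (\<lambda>z. h z x) N" and N: "open N" "0 \<in> N"
    and lin: "\<And>z s x. g z (s *\<^sub>C x) = s *\<^sub>C g z x" "\<And>z s x. h z (s *\<^sub>C x) = s *\<^sub>C h z x"
    and eq: "\<And>z. z \<in> N \<Longrightarrow> g z z = h z z"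
  shows "eventually (\<lambda>s. g (s *\<^sub>C x) x = h (s *\<^sub>C x) x) (nhds 0)" and "g 0 x = h 0 x"
proof -
  have ne: "g (s *\<^sub>C x) x = h (s *\<^sub>C x) x" if "s *\<^sub>C x \<in> N" "s \<noteq> 0" for s
  proof -
    have "s *\<^sub>C g (s *\<^sub>C x) x = s *\<^sub>C h (s *\<^sub>C x) x"
      using eq[OF that(1)] by (simp only: lin)
    then have "inverse s *\<^sub>C s *\<^sub>C g (s *\<^sub>C x) x = inverse s *\<^sub>C s *\<^sub>C h (s *\<^sub>C x) x" by simp
    then show ?thesis using that(2) by (simp add: scaleC_scaleC del: scaleC_complex)
  qed
  have evN: "eventually (\<lambda>s. s *\<^sub>C x \<in> N) (nhds 0)"
    using open_eventually_dird[OF N, of x] by simp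
  have lim: "((\<lambda>s. f (s *\<^sub>C x) x) \<longlongrightarrow> f 0 x) (at 0)" if "holo_on (\<lambda>z. f z x) N"
    for f :: "complex^'n \<Rightarrow> complex^'n \<Rightarrow> complex^'n"
  proof -
    have "holo_on (\<lambda>s. f (s *\<^sub>C x) x) {s. s *\<^sub>C x \<in> N}"
      by (rule holo_on_compose[OF _ that]) (auto intro: holo_intros)
    moreover have "0 \<in> {s. s *\<^sub>C x \<in> N}" using N by simp
    ultimately have "isCont (\<lambda>s. f (s *\<^sub>C x) x) 0"
      by (rule holo_onD) (rule has_derivative_continuous)
    then show ?thesis by (simp add: isCont_def)
  qed
  have "eventually (\<lambda>s. g (s *\<^sub>C x) x = h (s *\<^sub>C x) x) (at 0)"
    using evN unfolding eventually_at_filter by eventually_elim (use ne in auto)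
  from Lim_transform_eventually[OF lim[of g, OF holo(1)] this] lim[of h, OF holo(2)]
  show zero: "g 0 x = h 0 x" by (rule tendsto_unique[OF trivial_limit_at])
  have "g (s *\<^sub>C x) x = h (s *\<^sub>C x) x" if "s *\<^sub>C x \<in> N" for s
    using ne[OF that] zero by (cases "s = 0") simp_all
  with evN show "eventually (\<lambda>s. g (s *\<^sub>C x) x = h (s *\<^sub>C x) x) (nhds 0)"
    by (rule eventually_mono)
qed

subsection \<open>Invariance and composition\<close>

lemma matrix_vector_scaleC: "A *v (s *\<^sub>C y) = s *\<^sub>C (A *v y)" for A :: "complex^'n^'m"
  by (simp add: vec_eq_iff matrix_vector_mult_def sum_distrib_left mult_ac)

lemma polydisc_in_open:
  fixes c :: "complex ^ 'n"
  assumes "open U" "c \<in> U"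
  obtains R where "R > 0" "polydisc c R \<subseteq> U"
proof -
  obtain e where e: "e > 0" "ball c e \<subseteq> U" using assms open_contains_ball by blast
  define R where "R = e / real CARD('n)"
  have R: "R > 0" using e by (simp add: R_def)
  have "polydisc c R \<subseteq> ball c e"
  proof
    fix \<zeta> assume z: "\<zeta> \<in> polydisc c R"
    have "norm (\<zeta> - c) \<le> (\<Sum>i\<in>UNIV. cmod ((\<zeta> - c) $ i))"
      unfolding norm_vec_def by (rule L2_set_le_sum) simp
    also have "\<dots> < (\<Sum>i\<in>(UNIV::'n set). R)"
      using z by (intro sum_strict_mono) (auto simp: polydisc_def)
    also have "\<dots> = e" by (simp add: R_def)
    finally show "\<zeta> \<in> ball c e" by (simp add: dist_norm norm_minus_commute)
  qed
  then show thesis using that R e(2) by blast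
qed

text \<open>If \<open>G(z)z = z\<close>, then the transformation is trivial; \<open>G\<close> itself need not be constant if \<open>n > 1\<close>.\<close>

lemma fiber_coeff_identity:
  fixes G :: "complex^'n::finite \<Rightarrow> complex^'n^'n"
  assumes G: "holo_on G N" "open N" "0 \<in> N" and id: "\<And>z. z \<in> N \<Longrightarrow> G z *v z = z"
    and f: "holo_on f U" "open U" "l \<in> U"
  shows "fiber_coeff G l j f = (if j = 0 then f l else 0)"
proof -
  have hG: "holo_on (\<lambda>z. G z *v x) N" for x by (intro holo_on_matrix_vector G holo_on_const)
  have agree: "eventually (\<lambda>s. G (s *\<^sub>C x) *v x = x) (nhds 0)" "G 0 *v x = x" for x
    by (rule linear_maps_agree[of "\<lambda>z x. G z *v x" N "\<lambda>z x. x"];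
        use G id hG in \<open>simp add: matrix_vector_scaleC holo_on_const\<close>)+
  have "G 0 = mat 1" by (subst matrix_eq) (simp add: agree(2))
  then have l0: "transpose (G 0) *v l = l" by simp
  obtain R where R: "R > 0" "polydisc l R \<subseteq> U" using polydisc_in_open[OF f(2,3)] by blast
  define r where "r = R / 2"
  have r: "0 < r" "r < R" using R(1) by (auto simp: r_def)
  have lR: "transpose (G 0) *v l \<in> polydisc l R" using R(1) by (simp add: l0 polydisc_def)
  have lr: "transpose (G 0) *v l \<in> polydisc l r" using r(1) by (simp add: l0 polydisc_def)
  have sub: "polydisc l r \<subseteq> cpolydisc l r" by (auto simp: polydisc_def cpolydisc_def less_imp_le)
  obtain \<delta> C where C: "\<delta> > 0" "\<And>k f B. k \<in> cball l \<delta> \<Longrightarrow> holo_on f (polydisc l R) \<Longrightarrow>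
      (\<And>\<zeta>. \<zeta> \<in> cpolydisc l r \<Longrightarrow> cmod (f \<zeta>) \<le> B) \<Longrightarrow> cmod (fiber_coeff G k j f) \<le> C * B"
    using fiber_coeff_bound[OF G open_polydisc cpolydisc_subset_polydisc[OF r(2)] open_polydisc sub lr]
    by metis
  define L where "L = (\<lambda>f. fiber_coeff G l j f - (if j = 0 then f l else 0))"
  have "L f = 0"
  proof (rule exp_determines[OF r, of l L "C + 1"])
    fix g h :: "complex^'n \<Rightarrow> complex"
    assume "holo_on g (polydisc l R)" "holo_on h (polydisc l R)"
    then show "L (\<lambda>\<zeta>. g \<zeta> + h \<zeta>) = L g + L h"
      by (simp add: L_def fiber_coeff_add[OF G open_polydisc lR])
  next
    fix g :: "complex^'n \<Rightarrow> complex" and a assume "holo_on g (polydisc l R)"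
    then show "L (\<lambda>\<zeta>. a * g \<zeta>) = a * L g"
      by (simp add: L_def fiber_coeff_cmult[OF G open_polydisc lR] algebra_simps)
  next
    fix g :: "complex^'n \<Rightarrow> complex" and B
    assume g: "holo_on g (polydisc l R)" and B: "\<And>\<zeta>. \<zeta> \<in> cpolydisc l r \<Longrightarrow> cmod (g \<zeta>) \<le> B"
    have 1: "cmod (fiber_coeff G l j g) \<le> C * B"
      using C(1) by (intro C(2) g B) auto
    have "l \<in> cpolydisc l r" using r(1) by (simp add: cpolydisc_def)
    then have gl: "cmod (g l) \<le> B" by (rule B)
    then have 2: "cmod (if j = 0 then g l else 0) \<le> B"
      using order_trans[OF norm_ge_zero gl] by simp
    have "cmod (L g) \<le> cmod (fiber_coeff G l j g) + cmod (if j = 0 then g l else 0)"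
      unfolding L_def by (rule norm_triangle_ineq4)
    then show "cmod (L g) \<le> (C + 1) * B" using 1 2 by (simp add: algebra_simps)
  next
    fix x :: "complex^'n"
    have "eventually (\<lambda>s. exp (cdot (G (s *\<^sub>C x) *v x) l) = exp (cdot x l)) (nhds 0)"
      using agree(1)[of x] by eventually_elim simp
    from higher_deriv_cong_ev[OF this refl, of j]
    have "fiber_coeff G l j (\<lambda>\<zeta>. exp (cdot x \<zeta>)) = (deriv ^^ j) (\<lambda>s. exp (cdot x l)) 0 / fact j"
      by (simp add: fiber_coeff_exp[OF G])
    then show "L (\<lambda>\<zeta>. exp (cdot x \<zeta>)) = 0" by (simp add: L_def higher_deriv_const)
  next
    show "holo_on f (polydisc l R)" using f(1) R(2) by (rule holo_on_subset)
  qed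
  then show ?thesis by (simp add: L_def)
qed

lemma dird_power_commute:
  fixes F :: "'a::{complex_normed, euclidean_space} \<Rightarrow> complex"
  assumes "holo_on F U" "open U" "x \<in> U"
  shows "dird v ((dird u ^^ i) F) x = (dird u ^^ i) (dird v F) x"
  using assms(3)
proof (induction i arbitrary: x)
  case (Suc i)
  have "dird v (dird u ((dird u ^^ i) F)) x = dird u (dird v ((dird u ^^ i) F)) x"
    by (rule dird_commute[OF holo_on_dird_power[OF assms(1,2)] assms(2) Suc.prems])
  also have "\<dots> = dird u ((dird u ^^ i) (dird v F)) x"
    by (rule dird_cong[OF assms(2) Suc.prems Suc.IH])
  finally show ?case by simp
qed simp

lemma pascal_sum:
  fixes T :: "nat \<Rightarrow> nat \<Rightarrow> complex"
  shows "(\<Sum>j\<le>n. of_nat (n choose j) * (T (Suc (n - j)) j + T (n - j) (Suc j)))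
    = (\<Sum>j\<le>Suc n. of_nat (Suc n choose j) * T (Suc n - j) j)"
proof -
  have "(\<Sum>j\<le>Suc n. of_nat (Suc n choose j) * T (Suc n - j) j)
      = T (Suc n) 0 + (\<Sum>j\<le>n. of_nat (n choose Suc j) * T (n - j) (Suc j))
        + (\<Sum>j\<le>n. of_nat (n choose j) * T (n - j) (Suc j))"
    by (subst sum.atMost_Suc_shift) (simp add: algebra_simps sum.distrib)
  also have "T (Suc n) 0 + (\<Sum>j\<le>n. of_nat (n choose Suc j) * T (n - j) (Suc j))
      = (\<Sum>j\<le>Suc n. of_nat (n choose j) * T (Suc n - j) j)"
    by (subst sum.atMost_Suc_shift) simp
  also have "\<dots> = (\<Sum>j\<le>n. of_nat (n choose j) * T (Suc (n - j)) j)"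
    by (simp add: Suc_diff_le)
  finally show ?thesis by (simp add: algebra_simps sum.distrib)
qed

text \<open>Binomial theorem for commuting directional derivatives.\<close>

lemma dird_add_power:
  fixes F :: "'a::{complex_normed, euclidean_space} \<Rightarrow> complex"
  assumes F: "holo_on F U" "open U" and x: "x \<in> U"
  shows "(dird (u + v) ^^ n) F x = (\<Sum>j\<le>n. of_nat (n choose j) * (dird u ^^ (n - j)) ((dird v ^^ j) F) x)"
  using x
proof (induction n arbitrary: x)
  case (Suc n)
  let ?T = "\<lambda>i j. (dird u ^^ i) ((dird v ^^ j) F)"
  have T: "holo_on (?T i j) U" for i j by (intro holo_on_dird_power F)
  have step: "dird (u + v) (?T i j) x = ?T (Suc i) j x + ?T i (Suc j) x" for i j
    using holo_on_has_derivative(3)[OF T[of i j] Suc.prems, of u v]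
      dird_power_commute[OF holo_on_dird_power[OF F, where v = v and j = j] F(2) Suc.prems,
        where v = v and u = u and i = i]
    by simp
  have "dird (u + v) ((dird (u + v) ^^ n) F) x
      = dird (u + v) (\<lambda>x. \<Sum>j\<le>n. of_nat (n choose j) * ?T (n - j) j x) x"
    by (rule dird_cong[OF F(2) Suc.prems Suc.IH])
  also have "\<dots> = (\<Sum>j\<le>n. dird (u + v) (\<lambda>x. of_nat (n choose j) * ?T (n - j) j x) x)"
    by (rule dird_sum[OF _ Suc.prems]) (intro holo_on_mult holo_on_const T)
  also have "\<dots> = (\<Sum>j\<le>n. of_nat (n choose j) * (?T (Suc (n - j)) j x + ?T (n - j) (Suc j) x))"
    by (intro sum.cong refl) (simp only: dird_cmult[OF T Suc.prems] step)
  also have "\<dots> = (\<Sum>j\<le>Suc n. of_nat (Suc n choose j) * ?T (Suc n - j) j x)"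
    by (rule pascal_sum[of n "\<lambda>i j. ?T i j x"])
  finally show ?case by simp
qed simp

text \<open>Functoriality on the exponential with frequency \<open>x\<close>.  Both sides are Taylor coefficients:
  with \<open>y s = G (s x) x\<close> the left-hand side collects the terms of order \<open>n\<close> of
  \<open>K(s, t) = exp \<langle>H (t y(s)) y(s), \<xi>\<rangle>\<close>, and \<open>K(s, s) = exp \<langle>M (s x) x, \<xi>\<rangle>\<close>.\<close>

lemma fiber_coeff_compose_exp:
  fixes G H M :: "complex^'n::finite \<Rightarrow> complex^'n^'n"
  assumes G: "holo_on G N" "open N" "0 \<in> N" and H: "holo_on H N'" "open N'" "0 \<in> N'"
    and M: "holo_on M N"
    and comp: "\<And>z. z \<in> N \<Longrightarrow> G z *v z \<in> N'"
      "\<And>z. z \<in> N \<Longrightarrow> H (G z *v z) *v (G z *v z) = M z *v z"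
  shows "(\<Sum>j\<le>n. fiber_coeff H \<xi> j (\<lambda>\<mu>. fiber_coeff G \<mu> (n - j) (\<lambda>\<zeta>. exp (cdot x \<zeta>))))
    = fiber_coeff M \<xi> n (\<lambda>\<zeta>. exp (cdot x \<zeta>))"
proof -
  define S where "S = {s. s *\<^sub>C x \<in> N}"
  have hs: "holo_on (\<lambda>s. s *\<^sub>C x) UNIV" by (intro holo_intros)
  have S: "open S" "0 \<in> S"
    using open_preimage_holo[OF hs open_UNIV G(2)] G(3) by (auto simp: S_def)
  define y where "y = (\<lambda>s. G (s *\<^sub>C x) *v x)"
  have hy: "holo_on y S" unfolding y_def
    by (intro holo_on_matrix_vector holo_on_const holo_on_compose[OF holo_on_subset[OF hs] G(1)])
      (auto simp: S_def)
  define E where "E = (\<lambda>(s, q). exp (cdot (y s) (snd q + transpose (H (fst q)) *v \<xi>)))"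
  define OE :: "(complex \<times> 'n cotangent) set" where "OE = S \<times> N' \<times> UNIV"
  have OE: "open OE" unfolding OE_def by (intro open_Times S H open_UNIV)
  have hE: "holo_on E OE"
  proof -
    have 1: "holo_on (\<lambda>p. y (fst p)) OE" 
      by (rule holo_on_compose[OF _ hy], intro holo_on_fst holo_on_id) (auto simp: OE_def)
    have 2: "holo_on (\<lambda>p. H (fst (snd p))) OE"
      by (rule holo_on_compose[OF _ H(1)], intro holo_on_fst holo_on_snd holo_on_id) (auto simp: OE_def)
    show ?thesis unfolding E_def split_beta
      by (intro holo_on_exp holo_on_cdot holo_on_add holo_on_transpose_vector 1 2 holo_on_snd
          holo_on_id holo_on_const)
  qed
  define K where "K = (\<lambda>(s, t). exp (cdot (H (t *\<^sub>C y s) *v y s) \<xi>))"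
  define OK where "OK = {p \<in> S \<times> UNIV. snd p *\<^sub>C y (fst p) \<in> N'}"
  have yfst: "holo_on (\<lambda>p :: complex \<times> complex. y (fst p)) (S \<times> UNIV)"
    by (rule holo_on_compose[OF _ hy]) (auto intro: holo_intros)
  have ty: "holo_on (\<lambda>p :: complex \<times> complex. snd p *\<^sub>C y (fst p)) (S \<times> UNIV)"
    by (rule holo_on_vec) (simp add: scaleC_nth, intro holo_on_mult holo_on_nth yfst holo_on_snd holo_on_id)
  have OK: "open OK" unfolding OK_def
    by (rule open_preimage_holo[OF ty _ H(2)]) (intro open_Times S open_UNIV)
  have S0: "(s, 0) \<in> OK" if "s \<in> S" for s using that H(3) by (simp add: OK_def)
  have hK: "holo_on K OK"
  proof -
    have 1: "holo_on (\<lambda>p. H (snd p *\<^sub>C y (fst p))) OK"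
      by (rule holo_on_compose[OF holo_on_subset[OF ty] H(1)]) (auto simp: OK_def)
    have 2: "holo_on (\<lambda>p. y (fst p)) OK"
      using yfst by (rule holo_on_subset) (auto simp: OK_def)
    show ?thesis unfolding K_def split_beta
      by (intro holo_on_exp holo_on_cdot holo_on_matrix_vector 1 2 holo_on_const)
  qed
  have inner: "fiber_coeff H \<xi> j (\<lambda>\<mu>. fiber_coeff G \<mu> i (\<lambda>\<zeta>. exp (cdot x \<zeta>)))
      = (dird (1, 0) ^^ i) ((dird (0, 1) ^^ j) K) (0, 0) / (fact i * fact j)" for i j
  proof -
    have zero: "(0, 0) \<in> N' \<times> (UNIV :: (complex^'n) set)" using H(3) by simp
    have oN: "open (N' \<times> (UNIV :: (complex^'n) set))" by (intro open_Times H open_UNIV)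
    have z0: "(0, 0, 0) \<in> OE" using S H by (simp add: OE_def)
    have "fiber_coeff H \<xi> j (\<lambda>\<mu>. fiber_coeff G \<mu> i (\<lambda>\<zeta>. exp (cdot x \<zeta>)))
        = (d_pairing ^^ j) (\<lambda>(z, \<zeta>). (deriv ^^ i) (\<lambda>s. exp (cdot (y s) (\<zeta> + transpose (H z) *v \<xi>))) 0 / fact i)
            (0, 0) / fact j"
      by (simp add: fiber_coeff_def[of H] fiber_coeff_exp[OF G] y_def)
    also have "(d_pairing ^^ j) (\<lambda>(z, \<zeta>). (deriv ^^ i) (\<lambda>s. exp (cdot (y s) (\<zeta> + transpose (H z) *v \<xi>))) 0 / fact i) (0, 0)
        = (d_pairing ^^ j) (\<lambda>q. (1 / fact i) * (dird (1, 0) ^^ i) E (0, q)) (0, 0)"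
    proof (rule d_pairing_power_cong[OF oN zero])
      fix q :: "'n cotangent" assume q: "q \<in> N' \<times> UNIV"
      have "(0, q) + 0 *\<^sub>C (1, 0) \<in> OE" using q S by (auto simp: OE_def)
      from higher_deriv_slice[OF hE OE this, of i]
      have "(deriv ^^ i) (\<lambda>s. E (s, q)) 0 = (dird (1, 0) ^^ i) E (0, q)" by simp
      then show "(case q of (z, \<zeta>) \<Rightarrow> (deriv ^^ i) (\<lambda>s. exp (cdot (y s) (\<zeta> + transpose (H z) *v \<xi>))) 0 / fact i)
          = (1 / fact i) * (dird (1, 0) ^^ i) E (0, q)"
        by (simp add: E_def split_beta)
    qed
    also have "\<dots> = (1 / fact i) * (d_pairing ^^ j) (\<lambda>q. (dird (1, 0) ^^ i) E (0, q)) (0, 0)"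
      by (rule d_pairing_power_cmult[OF holo_slice[OF holo_on_dird_power[OF hE OE]] open_slice[OF OE]])
        (use z0 in simp)
    also have "(d_pairing ^^ j) (\<lambda>q. (dird (1, 0) ^^ i) E (0, q)) (0, 0)
        = (dird (1, 0) ^^ i) ((d_pairing_par ^^ j) E) (0, 0, 0)"
      unfolding d_pairing_par_power
      by (rule dird_power_d_pairing_par_power[OF hE OE z0, symmetric])
    also have "\<dots> = (deriv ^^ i) (\<lambda>s. (d_pairing_par ^^ j) E (s, 0, 0)) 0"
      using higher_deriv_slice[OF holo_on_d_pairing_par_power[OF hE OE, where j = j] OE,
          of "(0, 0, 0)" 0 "(1, 0)" i] z0
      by simp
    also have "\<dots> = (deriv ^^ i) (\<lambda>s. (dird (0, 1) ^^ j) K (s, 0)) 0"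
    proof (rule higher_deriv_cong_ev)
      have "(d_pairing_par ^^ j) E (s, 0, 0) = (dird (0, 1) ^^ j) K (s, 0)" if s: "s \<in> S" for s
      proof -
        have "(d_pairing_par ^^ j) E (s, 0, 0) = (d_pairing ^^ j) (\<lambda>q. E (s, q)) (0, 0)"
          by (simp add: d_pairing_par_power)
        also have "\<dots> = fact j * fiber_coeff H \<xi> j (\<lambda>\<zeta>. exp (cdot (y s) \<zeta>))"
          by (simp add: fiber_coeff_def E_def split_beta')
        also have "\<dots> = (deriv ^^ j) (\<lambda>t. K (s, t)) 0"
          by (simp add: fiber_coeff_exp[OF H] K_def)
        also have "\<dots> = (dird (0, 1) ^^ j) K (s, 0)"
          using higher_deriv_slice[OF hK OK, of "(s, 0)" 0 "(0, 1)" j] S0[OF s] by simp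
        finally show ?thesis .
      qed
      then show "eventually (\<lambda>s. (d_pairing_par ^^ j) E (s, 0, 0) = (dird (0, 1) ^^ j) K (s, 0)) (nhds 0)"
        using S unfolding eventually_nhds by blast
    qed simp
    also have "\<dots> = (dird (1, 0) ^^ i) ((dird (0, 1) ^^ j) K) (0, 0)"
      using higher_deriv_slice[OF holo_on_dird_power[OF hK OK, where v = "(0, 1)" and j = j] OK,
          of "(0, 0)" 0 "(1, 0)" i] S0[OF S(2)]
      by simp
    finally show ?thesis by simp
  qed
  have "(\<Sum>j\<le>n. fiber_coeff H \<xi> j (\<lambda>\<mu>. fiber_coeff G \<mu> (n - j) (\<lambda>\<zeta>. exp (cdot x \<zeta>))))
      = (\<Sum>j\<le>n. of_nat (n choose j) * (dird (1, 0) ^^ (n - j)) ((dird (0, 1) ^^ j) K) (0, 0)) / fact n"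
    unfolding inner sum_divide_distrib
    by (intro sum.cong refl) (simp add: binomial_fact field_simps)
  also have "\<dots> = (dird ((1, 0) + (0, 1)) ^^ n) K (0, 0) / fact n"
    by (simp only: dird_add_power[OF hK OK S0[OF S(2)]])
  also have "(dird ((1, 0) + (0, 1)) ^^ n) K (0, 0) = (deriv ^^ n) (\<lambda>s. K (s, s)) 0"
    using higher_deriv_slice[OF hK OK, of "(0, 0)" 0 "(1, 1)" n] S0[OF S(2)] by simp
  also have "\<dots> = (deriv ^^ n) (\<lambda>s. exp (cdot (M (s *\<^sub>C x) *v x) \<xi>)) 0"
  proof (rule higher_deriv_cong_ev)
    have hGz: "holo_on (\<lambda>z. G z *v z) N" by (intro holo_on_matrix_vector G holo_on_id)
    have "eventually (\<lambda>s. H (G (s *\<^sub>C x) *v (s *\<^sub>C x)) *v (G (s *\<^sub>C x) *v x) = M (s *\<^sub>C x) *v x) (nhds 0)"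
    proof (rule linear_maps_agree(1)[of "\<lambda>z x. H (G z *v z) *v (G z *v x)" N "\<lambda>z x. M z *v x"])
      show "holo_on (\<lambda>z. H (G z *v z) *v (G z *v x)) N" for x
        by (intro holo_on_matrix_vector G holo_on_const holo_on_compose[OF hGz H(1)] comp(1))
      show "holo_on (\<lambda>z. M z *v x) N" for x
        by (intro holo_on_matrix_vector M holo_on_const)
    qed (use G comp(2) in \<open>auto simp: matrix_vector_scaleC\<close>)
    then show "eventually (\<lambda>s. K (s, s) = exp (cdot (M (s *\<^sub>C x) *v x) \<xi>)) (nhds 0)"
      by eventually_elim (simp add: K_def y_def matrix_vector_scaleC)
  qed simp
  also have "\<dots> / fact n = fiber_coeff M \<xi> n (\<lambda>\<zeta>. exp (cdot x \<zeta>))"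
    by (rule fiber_coeff_exp[OF M G(2,3), symmetric])
  finally show ?thesis .
qed

text \<open>The chain rule for the linear parts at \<open>0\<close>.\<close>

lemma compose_at_zero:
  fixes G H M :: "complex^'n::finite \<Rightarrow> complex^'n^'n"
  assumes G: "holo_on G N" "open N" "0 \<in> N" and H: "holo_on H N'" "open N'" "0 \<in> N'"
    and M: "holo_on M N"
    and comp: "\<And>z. z \<in> N \<Longrightarrow> G z *v z \<in> N'"
      "\<And>z. z \<in> N \<Longrightarrow> H (G z *v z) *v (G z *v z) = M z *v z"
  shows "transpose (G 0) *v (transpose (H 0) *v \<xi>) = transpose (M 0) *v \<xi>"
proof -
  have M0: "H 0 *v (G 0 *v x) = M 0 *v x" for x
  proof -
    have hGz: "holo_on (\<lambda>z. G z *v z) N" by (intro holo_on_matrix_vector G holo_on_id)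
    have "H (G 0 *v 0) *v (G 0 *v x) = M 0 *v x"
    proof (rule linear_maps_agree(2)[of "\<lambda>z x. H (G z *v z) *v (G z *v x)" N "\<lambda>z x. M z *v x"])
      show "holo_on (\<lambda>z. H (G z *v z) *v (G z *v x)) N" for x
        by (intro holo_on_matrix_vector G holo_on_const holo_on_compose[OF hGz H(1)] comp(1))
      show "holo_on (\<lambda>z. M z *v x) N" for x
        by (intro holo_on_matrix_vector M holo_on_const)
    qed (use G comp(2) in \<open>auto simp: matrix_vector_scaleC\<close>)
    then show ?thesis by simp
  qed
  have "M 0 = H 0 ** G 0" by (subst matrix_eq) (simp add: M0 flip: matrix_vector_mul_assoc)
  then show ?thesis by (simp add: matrix_transpose_mul matrix_vector_mul_assoc)
qed

text \<open>Functoriality: if \<open>z \<mapsto> M(z)z\<close> is the composition of \<open>z \<mapsto> G(z)z\<close> and \<open>y \<mapsto> H(y)y\<close>, then the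
  formal series of the transformations compose accordingly, without a remainder.\<close>

lemma fiber_coeff_compose:
  fixes G H M :: "complex^'n::finite \<Rightarrow> complex^'n^'n"
  assumes G: "holo_on G N" "open N" "0 \<in> N" and H: "holo_on H N'" "open N'" "0 \<in> N'"
    and M: "holo_on M N"
    and comp: "\<And>z. z \<in> N \<Longrightarrow> G z *v z \<in> N'"
      "\<And>z. z \<in> N \<Longrightarrow> H (G z *v z) *v (G z *v z) = M z *v z"
    and f: "holo_on f U" "open U" "transpose (M 0) *v \<xi> \<in> U"
  shows "(\<Sum>j\<le>n. fiber_coeff H \<xi> j (\<lambda>\<mu>. fiber_coeff G \<mu> (n - j) f)) = fiber_coeff M \<xi> n f"
proof -
  define c where "c = transpose (M 0) *v \<xi>"
  define \<mu>0 where "\<mu>0 = transpose (H 0) *v \<xi>"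
  have c: "transpose (G 0) *v \<mu>0 = c"
    unfolding c_def \<mu>0_def by (rule compose_at_zero[OF G H M comp])
  obtain R where R: "R > 0" "polydisc c R \<subseteq> U" using polydisc_in_open[OF f(2,3)] unfolding c_def by blast
  define r where "r = R / 2"
  have r: "0 < r" "r < R" using R(1) by (auto simp: r_def)
  let ?U = "polydisc c R" and ?K = "cpolydisc c r" and ?V = "polydisc c r"
  have KU: "?K \<subseteq> ?U" by (rule cpolydisc_subset_polydisc[OF r(2)])
  have VK: "?V \<subseteq> ?K" by (auto simp: polydisc_def cpolydisc_def less_imp_le)
  have cV: "c \<in> ?V" and cU: "c \<in> ?U" using r R by (auto simp: polydisc_def)
  define U1 where "U1 = {\<mu>. transpose (G 0) *v \<mu> \<in> ?U}"
  have U1: "open U1" "\<mu>0 \<in> U1"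
    unfolding U1_def by (auto intro: open_fiber_preimage open_polydisc simp: c cU)
  have hin: "holo_on (\<lambda>\<mu>. fiber_coeff G \<mu> i g) U1" if "holo_on g ?U" for g i
    unfolding U1_def by (rule holo_fiber_coeff[OF G that open_polydisc])
  have "\<exists>C. \<forall>g B. holo_on g ?U \<longrightarrow> (\<forall>\<zeta>\<in>?K. cmod (g \<zeta>) \<le> B) \<longrightarrow>
      cmod (fiber_coeff H \<xi> j (\<lambda>\<mu>. fiber_coeff G \<mu> (n - j) g)) \<le> C * B" for j
  proof -
    obtain \<delta> C where C: "\<delta> > 0" "\<And>\<mu> g B. \<mu> \<in> cball \<mu>0 \<delta> \<Longrightarrow> holo_on g ?U \<Longrightarrow>
      (\<And>\<zeta>. \<zeta> \<in> ?K \<Longrightarrow> cmod (g \<zeta>) \<le> B) \<Longrightarrow> cmod (fiber_coeff G \<mu> (n - j) g) \<le> C * B"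
      using fiber_coeff_bound[OF G open_polydisc KU open_polydisc VK, of \<mu>0 "n - j"] c cV by metis
    have V1: "open (ball \<mu>0 \<delta> \<inter> U1)" "ball \<mu>0 \<delta> \<inter> U1 \<subseteq> cball \<mu>0 \<delta> \<inter> U1"
      "transpose (H 0) *v \<xi> \<in> ball \<mu>0 \<delta> \<inter> U1" "cball \<mu>0 \<delta> \<inter> U1 \<subseteq> U1"
      using U1 C(1) by (auto simp: \<mu>0_def)
    obtain \<delta>' C' where C': "\<delta>' > 0" "\<And>l g B. l \<in> cball \<xi> \<delta>' \<Longrightarrow> holo_on g U1 \<Longrightarrow>
      (\<And>\<zeta>. \<zeta> \<in> cball \<mu>0 \<delta> \<inter> U1 \<Longrightarrow> cmod (g \<zeta>) \<le> B) \<Longrightarrow> cmod (fiber_coeff H l j g) \<le> C' * B"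
      using fiber_coeff_bound[OF H U1(1) V1(4) V1(1-3), of j] by metis
    have "cmod (fiber_coeff H \<xi> j (\<lambda>\<mu>. fiber_coeff G \<mu> (n - j) g)) \<le> (C' * C) * B"
      if "holo_on g ?U" "\<forall>\<zeta>\<in>?K. cmod (g \<zeta>) \<le> B" for g B
      using C'(2)[of \<xi> "\<lambda>\<mu>. fiber_coeff G \<mu> (n - j) g" "C * B"] C'(1) hin[OF that(1)] C(2)[OF _ that(1), of _ B] that(2)
      by (simp add: mult.assoc)
    then show ?thesis by blast
  qed
  then obtain C where C: "\<And>j g B. holo_on g ?U \<Longrightarrow> (\<forall>\<zeta>\<in>?K. cmod (g \<zeta>) \<le> B) \<Longrightarrow>
      cmod (fiber_coeff H \<xi> j (\<lambda>\<mu>. fiber_coeff G \<mu> (n - j) g)) \<le> C j * B"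
    by metis
  obtain \<delta> C0 where C0: "\<delta> > 0" "\<And>l g B. l \<in> cball \<xi> \<delta> \<Longrightarrow> holo_on g ?U \<Longrightarrow>
      (\<And>\<zeta>. \<zeta> \<in> ?K \<Longrightarrow> cmod (g \<zeta>) \<le> B) \<Longrightarrow> cmod (fiber_coeff M l n g) \<le> C0 * B"
    using fiber_coeff_bound[OF M G(2,3) open_polydisc KU open_polydisc VK, of \<xi> n] cV unfolding c_def by metis
  have McU: "transpose (M 0) *v \<xi> \<in> ?U" using cU by (simp add: c_def)
  have cG: "transpose (G 0) *v \<mu> \<in> ?U" if "\<mu> \<in> U1" for \<mu> using that by (simp add: U1_def)
  have HU1: "transpose (H 0) *v \<xi> \<in> U1" using U1 by (simp add: \<mu>0_def)
  define L where "L = (\<lambda>f. (\<Sum>j\<le>n. fiber_coeff H \<xi> j (\<lambda>\<mu>. fiber_coeff G \<mu> (n - j) f)) - fiber_coeff M \<xi> n f)"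
  have "L f = 0"
  proof (rule exp_determines[OF r, of c L "(\<Sum>j\<le>n. C j) + C0"])
    fix g h :: "complex^'n \<Rightarrow> complex" assume gh: "holo_on g ?U" "holo_on h ?U"
    have "fiber_coeff H \<xi> j (\<lambda>\<mu>. fiber_coeff G \<mu> i (\<lambda>\<zeta>. g \<zeta> + h \<zeta>))
        = fiber_coeff H \<xi> j (\<lambda>\<mu>. fiber_coeff G \<mu> i g) + fiber_coeff H \<xi> j (\<lambda>\<mu>. fiber_coeff G \<mu> i h)" for i j
    proof -
      have "fiber_coeff H \<xi> j (\<lambda>\<mu>. fiber_coeff G \<mu> i (\<lambda>\<zeta>. g \<zeta> + h \<zeta>))
          = fiber_coeff H \<xi> j (\<lambda>\<mu>. fiber_coeff G \<mu> i g + fiber_coeff G \<mu> i h)"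
        by (rule fiber_coeff_cong[OF H U1(1) HU1], rule fiber_coeff_add[OF G open_polydisc cG gh])
      also have "\<dots> = fiber_coeff H \<xi> j (\<lambda>\<mu>. fiber_coeff G \<mu> i g) + fiber_coeff H \<xi> j (\<lambda>\<mu>. fiber_coeff G \<mu> i h)"
        by (rule fiber_coeff_add[OF H U1(1) HU1 hin hin]) (rule gh)+
      finally show ?thesis .
    qed
    then show "L (\<lambda>\<zeta>. g \<zeta> + h \<zeta>) = L g + L h"
      by (simp add: L_def fiber_coeff_add[OF M G(2,3) open_polydisc McU gh] sum.distrib)
  next
    fix g :: "complex^'n \<Rightarrow> complex" and a assume g: "holo_on g ?U"
    have "fiber_coeff H \<xi> j (\<lambda>\<mu>. fiber_coeff G \<mu> i (\<lambda>\<zeta>. a * g \<zeta>))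
        = a * fiber_coeff H \<xi> j (\<lambda>\<mu>. fiber_coeff G \<mu> i g)" for i j
    proof -
      have "fiber_coeff H \<xi> j (\<lambda>\<mu>. fiber_coeff G \<mu> i (\<lambda>\<zeta>. a * g \<zeta>))
          = fiber_coeff H \<xi> j (\<lambda>\<mu>. a * fiber_coeff G \<mu> i g)"
        by (rule fiber_coeff_cong[OF H U1(1) HU1], rule fiber_coeff_cmult[OF G open_polydisc cG g])
      also have "\<dots> = a * fiber_coeff H \<xi> j (\<lambda>\<mu>. fiber_coeff G \<mu> i g)"
        by (rule fiber_coeff_cmult[OF H U1(1) HU1 hin[OF g]])
      finally show ?thesis .
    qed
    then show "L (\<lambda>\<zeta>. a * g \<zeta>) = a * L g"
      by (simp add: L_def fiber_coeff_cmult[OF M G(2,3) open_polydisc McU g] sum_distrib_left right_diff_distrib)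
  next
    fix g :: "complex^'n \<Rightarrow> complex" and B
    assume g: "holo_on g ?U" and B: "\<And>\<zeta>. \<zeta> \<in> ?K \<Longrightarrow> cmod (g \<zeta>) \<le> B"
    have "cmod (L g) \<le> cmod (\<Sum>j\<le>n. fiber_coeff H \<xi> j (\<lambda>\<mu>. fiber_coeff G \<mu> (n - j) g)) + cmod (fiber_coeff M \<xi> n g)"
      unfolding L_def by (rule norm_triangle_ineq4)
    also have "\<dots> \<le> (\<Sum>j\<le>n. C j * B) + C0 * B"
      using C0(1) g B by (intro add_mono sum_norm_le C C0(2)) auto
    also have "\<dots> = ((\<Sum>j\<le>n. C j) + C0) * B" by (simp add: sum_distrib_right distrib_right)
    finally show "cmod (L g) \<le> ((\<Sum>j\<le>n. C j) + C0) * B" .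
  next
    fix x :: "complex^'n"
    show "L (\<lambda>\<zeta>. exp (cdot x \<zeta>)) = 0"
      by (simp add: L_def fiber_coeff_compose_exp[OF G H M comp])
  next
    show "holo_on f ?U" using f(1) R(2) by (rule holo_on_subset)
  qed
  then show ?thesis by (simp add: L_def)
qed

section \<open>Geometry of a coordinate transformation\<close>

lemma cmod_le_maxnorm: "cmod (z $ i) \<le> maxnorm z"
  unfolding maxnorm_def by (rule Max_ge) auto

lemma maxnorm_le_iff: "maxnorm z \<le> c \<longleftrightarrow> (\<forall>i. cmod (z $ i) \<le> c)"
  unfolding maxnorm_def by (subst Max_le_iff) auto

lemma maxnorm_ge_0: "0 \<le> maxnorm z"
  using cmod_le_maxnorm[of z undefined] norm_ge_zero order_trans by blast

lemma maxnorm_le_norm: "maxnorm z \<le> norm z"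
  by (simp add: maxnorm_le_iff Finite_Cartesian_Product.norm_nth_le)

lemma norm_le_maxnorm: "norm (z :: complex^'n) \<le> real CARD('n) * maxnorm z"
proof -
  have "norm z \<le> (\<Sum>i\<in>UNIV. cmod (z $ i))"
    unfolding norm_vec_def by (rule L2_set_le_sum) simp
  also have "\<dots> \<le> (\<Sum>i\<in>(UNIV::'n set). maxnorm z)"
    by (intro sum_mono cmod_le_maxnorm)
  finally show ?thesis by simp
qed

lemma maxnorm_scale: "maxnorm (c *s z) = cmod c * maxnorm z"
proof (rule antisym)
  show "maxnorm (c *s z) \<le> cmod c * maxnorm z"
    by (simp add: maxnorm_le_iff norm_mult mult_left_mono cmod_le_maxnorm)
  show "cmod c * maxnorm z \<le> maxnorm (c *s z)"
  proof (cases "c = 0")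
    case False
    have "maxnorm z \<le> maxnorm (c *s z) / cmod c"
      unfolding maxnorm_le_iff
    proof
      fix i
      show "cmod (z $ i) \<le> maxnorm (c *s z) / cmod c"
        using cmod_le_maxnorm[of "c *s z" i] False by (simp add: norm_mult field_simps)
    qed
    then show ?thesis using False by (simp add: field_simps)
  qed (simp add: maxnorm_ge_0)
qed

lemma norm_transpose_vector:
  fixes A :: "complex^'n^'n"
  shows "norm (transpose A *v l) \<le> (real CARD('n))\<^sup>2 * norm A * norm l"
proof -
  have "maxnorm (transpose A *v l) \<le> real CARD('n) * norm A * norm l"
    unfolding maxnorm_le_iff
  proof
    fix i
    have "cmod ((transpose A *v l) $ i) \<le> (\<Sum>j\<in>(UNIV::'n set). norm A * norm l)"
      unfolding matrix_vector_mult_def transpose_def vec_lambda_beta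
    proof (rule sum_norm_le)
      fix j
      have "cmod (A $ j $ i) \<le> norm A"
        by (rule order_trans[OF Finite_Cartesian_Product.norm_nth_le Finite_Cartesian_Product.norm_nth_le])
      then show "cmod (A $ j $ i * l $ j) \<le> norm A * norm l"
        unfolding norm_mult by (intro mult_mono Finite_Cartesian_Product.norm_nth_le) auto
    qed
    then show "cmod ((transpose A *v l) $ i) \<le> real CARD('n) * norm A * norm l" by simp
  qed
  then have "real CARD('n) * maxnorm (transpose A *v l) \<le> real CARD('n) * (real CARD('n) * norm A * norm l)"
    by (rule mult_left_mono) simp
  from order_trans[OF norm_le_maxnorm this] show ?thesis
    by (simp only: power2_eq_square mult.assoc)
qed

text \<open>Two coordinate systems \<open>z\<close>, \<open>w\<close> on \<open>W\<close> with \<open>z = \<Phi>(w)\<close>, and a matrix \<open>J\<close> as required of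
  \<open>J\<^sup>*\<^sub>\<Phi>\<close>, defined on the neighborhood \<open>D\<close> of the diagonal; the inverse of \<open>\<Phi>\<close> is expressed by
  means of the points of \<open>W\<close>.\<close>

definition transition ::
    "(complex^'n) set \<Rightarrow> (complex^'n \<Rightarrow> complex^'n) \<Rightarrow> (complex^'n \<Rightarrow> complex^'n) \<Rightarrow>
      (complex^'n \<Rightarrow> complex^'n) \<Rightarrow> ((complex^'n) \<times> (complex^'n) \<Rightarrow> complex^'n^'n) \<Rightarrow>
      ((complex^'n) \<times> (complex^'n)) set \<Rightarrow> bool"
  where "transition W z w \<Phi> J D \<longleftrightarrow>
    local_coords W z \<and> local_coords W w \<and> (\<forall>x\<in>W. z x = \<Phi> (w x)) \<and>
    open D \<and> holo_on J D \<and> D \<subseteq> z ` W \<times> z ` W \<and> (\<forall>x\<in>W. (z x, z x) \<in> D) \<and>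
    (\<forall>x\<in>W. \<forall>x'\<in>W. (z x', z x) \<in> D \<longrightarrow> w x' - w x = J (z x', z x) *v (z x' - z x))"

lemma transitionD:
  assumes "transition W z w \<Phi> J D"
  shows "local_coords W z" "local_coords W w" "\<And>x. x \<in> W \<Longrightarrow> \<Phi> (w x) = z x"
    "open D" "holo_on J D" "D \<subseteq> z ` W \<times> z ` W" "\<And>x. x \<in> W \<Longrightarrow> (z x, z x) \<in> D"
    "\<And>x x'. x \<in> W \<Longrightarrow> x' \<in> W \<Longrightarrow> (z x', z x) \<in> D \<Longrightarrow> w x' - w x = J (z x', z x) *v (z x' - z x)"
  using assms unfolding transition_def by metis+

lemma local_coordsD:
  assumes "local_coords W z"
  shows "open W" "inj_on z W" "holo_on z W" "open (z ` W)" "holo_on (inv_into W z) (z ` W)"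
  using assms unfolding local_coords_def by auto

lemma is_Jstar_imp_transition:
  assumes z: "local_coords W z" and w: "local_coords W w" and zw: "\<forall>x\<in>W. z x = \<Phi> (w x)"
    and J: "is_Jstar (w ` W) \<Phi> J"
  obtains D where "transition W z w \<Phi> J D"
proof -
  have im: "\<Phi> ` w ` W = z ` W" using zw by (auto simp: image_image)
  have inj: "inj_on \<Phi> (w ` W)"
    using local_coordsD(2)[OF z] zw by (auto simp: inj_on_def)
  have inv: "inv_into (w ` W) \<Phi> (z x) = w x" if "x \<in> W" for x
    using inv_into_f_f[OF inj, of "w x"] that zw by auto
  obtain D where D: "open D" "D \<subseteq> z ` W \<times> z ` W" "\<forall>x\<in>z ` W. (x, x) \<in> D" "holo_on J D"
    "\<forall>(z', z0)\<in>D. inv_into (w ` W) \<Phi> z' - inv_into (w ` W) \<Phi> z0 = J (z', z0) *v (z' - z0)"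
    using J unfolding is_Jstar_def im by blast
  have "w x' - w x = J (z x', z x) *v (z x' - z x)" if "x \<in> W" "x' \<in> W" "(z x', z x) \<in> D" for x x'
    using D(5) that(3) inv[OF that(1)] inv[OF that(2)] by auto
  then have "transition W z w \<Phi> J D"
    unfolding transition_def using z w zw D by blast
  then show thesis by (rule that)
qed

lemma transition_holo:
  assumes "transition W z w \<Phi> J D"
  shows "holo_on \<Phi> (w ` W)"
proof (rule holo_on_cong[of _ "\<lambda>y. z (inv_into W w y)"])
  note t = transitionD[OF assms]
  show "open (w ` W)" by (rule local_coordsD[OF t(2)])
  show "z (inv_into W w y) = \<Phi> y" if "y \<in> w ` W" for y
    using t(3) local_coordsD(2)[OF t(2)] that by auto
  show "holo_on (\<lambda>y. z (inv_into W w y)) (w ` W)"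
    by (rule holo_on_compose[OF local_coordsD(5)[OF t(2)] local_coordsD(3)[OF t(1)]])
      (rule inv_into_into)
qed

subsection \<open>The fiber coordinates\<close>

lemma frechet_holo:
  fixes z :: "complex^'n \<Rightarrow> complex^'m"
  assumes "holo_on z W" "x \<in> W"
  shows "(z has_derivative frechet_derivative z (at x)) (at x)"
    "frechet_derivative z (at x) (c *\<^sub>C h) = c *\<^sub>C frechet_derivative z (at x) h"
    "frechet_derivative z (at x) h $ i = dird h (\<lambda>x. z x $ i) x"
proof -
  obtain D where D: "(z has_derivative D) (at x)" "\<And>c h. D (c *\<^sub>C h) = c *\<^sub>C D h"
    using holo_onD[OF assms] by blast
  have eq: "frechet_derivative z (at x) = D" using frechet_derivative_at[OF D(1)] by simp
  show "(z has_derivative frechet_derivative z (at x)) (at x)"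
    "frechet_derivative z (at x) (c *\<^sub>C h) = c *\<^sub>C frechet_derivative z (at x) h"
    unfolding eq using D by auto
  have "((\<lambda>x. z x $ i) has_derivative (\<lambda>h. D h $ i)) (at x)"
    by (rule bounded_linear.has_derivative[OF bounded_linear_vec_nth D(1)])
  from dird_eq[OF this] show "frechet_derivative z (at x) h $ i = dird h (\<lambda>x. z x $ i) x"
    unfolding eq by (simp add: D(2))
qed

lemma matrix_frechet:
  fixes z :: "complex^'n \<Rightarrow> complex^'m"
  assumes "holo_on z W" "x \<in> W"
  shows "matrix (frechet_derivative z (at x)) *v h = frechet_derivative z (at x) h"
proof -
  let ?D = "frechet_derivative z (at x)"
  have "h = (\<Sum>j\<in>UNIV. (h $ j) *\<^sub>C axis j 1)"
    by (simp add: vec_eq_iff axis_def if_distrib[of "\<lambda>y. _ * y"] cong: if_cong)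
  then have "?D h = ?D (\<Sum>j\<in>UNIV. (h $ j) *\<^sub>C axis j 1)" by simp
  also have "\<dots> = (\<Sum>j\<in>UNIV. ?D ((h $ j) *\<^sub>C axis j 1))"
    by (rule linear_sum[OF has_derivative_linear[OF frechet_holo(1)[OF assms]]])
  also have "\<dots> = matrix ?D *v h"
    by (simp add: vec_eq_iff matrix_vector_mult_def matrix_def frechet_holo(2)[OF assms] mult.commute)
  finally show ?thesis by simp
qed

lemma has_derivative_matrix_vector_zero:
  fixes A :: "'a::real_normed_vector \<Rightarrow> complex^'n^'m"
  assumes A: "(A has_derivative A') (at x)" and v: "(v has_derivative v') (at x)" and v0: "v x = 0"
  shows "((\<lambda>x. (A x *v v x) $ i) has_derivative (\<lambda>h. (A x *v v' h) $ i)) (at x)"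
proof -
  have 1: "((\<lambda>x. A x $ i $ j) has_derivative (\<lambda>h. A' h $ i $ j)) (at x)" for j
    by (intro bounded_linear.has_derivative[OF bounded_linear_vec_nth] A)
  have 2: "((\<lambda>x. v x $ j) has_derivative (\<lambda>h. v' h $ j)) (at x)" for j
    by (intro bounded_linear.has_derivative[OF bounded_linear_vec_nth] v)
  have "((\<lambda>x. \<Sum>j\<in>UNIV. A x $ i $ j * v x $ j) has_derivative
      (\<lambda>h. \<Sum>j\<in>UNIV. A x $ i $ j * v' h $ j + A' h $ i $ j * v x $ j)) (at x)"
    by (intro has_derivative_sum has_derivative_mult 1 2)
  then show ?thesis by (simp add: matrix_vector_mult_def v0)
qed

text \<open>On the diagonal \<open>J\<^sup>*\<close> is the Jacobian of \<open>w\<close> with respect to \<open>z\<close>, whatever the choice of \<open>J\<^sup>*\<close>.\<close>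

lemma Jstar_diagonal:
  assumes "transition W z w \<Phi> J D" and x: "x \<in> W"
  shows "J (z x, z x) *v frechet_derivative z (at x) h = frechet_derivative w (at x) h"
proof -
  note t = transitionD[OF assms(1)]
  have zh: "holo_on z W" and wh: "holo_on w W" and W: "open W"
    using local_coordsD t(1,2) by auto
  have W': "open {x' \<in> W. (z x', z x) \<in> D}"
    by (rule open_preimage_holo[OF holo_on_Pair[OF zh holo_on_const] W t(4)])
  have xW': "x \<in> {x' \<in> W. (z x', z x) \<in> D}" using x t(7) by auto
  have Jh: "holo_on (\<lambda>x'. J (z x', z x)) {x' \<in> W. (z x', z x) \<in> D}"
    by (rule holo_on_compose[OF holo_on_subset[OF holo_on_Pair[OF zh holo_on_const]] t(5)]) auto
  obtain J' where J': "((\<lambda>x'. J (z x', z x)) has_derivative J') (at x)"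
    by (rule holo_onD[OF Jh xW'])
  have zd: "((\<lambda>x'. z x' - z x) has_derivative frechet_derivative z (at x)) (at x)"
    using has_derivative_diff[OF frechet_holo(1)[OF zh x] has_derivative_const[of "z x"]] by simp
  show ?thesis
  proof (subst vec_eq_iff, rule allI)
    fix i
    have "((\<lambda>x'. (J (z x', z x) *v (z x' - z x)) $ i) has_derivative
        (\<lambda>h. (J (z x, z x) *v frechet_derivative z (at x) h) $ i)) (at x)"
      by (rule has_derivative_matrix_vector_zero[OF J' zd]) simp
    then have 1: "((\<lambda>x'. (w x' - w x) $ i) has_derivative
        (\<lambda>h. (J (z x, z x) *v frechet_derivative z (at x) h) $ i)) (at x)"
      by (rule has_derivative_transform_within_open[OF _ W' xW']) (use t(8) x in auto)
    have wd: "((\<lambda>x'. w x' - w x) has_derivative frechet_derivative w (at x)) (at x)"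
      using has_derivative_diff[OF frechet_holo(1)[OF wh x] has_derivative_const[of "w x"]] by simp
    have 2: "((\<lambda>x'. (w x' - w x) $ i) has_derivative (\<lambda>h. frechet_derivative w (at x) h $ i)) (at x)"
      by (rule bounded_linear.has_derivative[OF bounded_linear_vec_nth wd])
    show "(J (z x, z x) *v frechet_derivative z (at x) h) $ i = frechet_derivative w (at x) h $ i"
      using has_derivative_unique[OF 1 2] by metis
  qed
qed

text \<open>Accordingly, \<open>\<zeta> = \<^sup>tJ\<^sup>*(z, z)\<lambda>\<close> is the change of the fiber coordinate.\<close>

lemma transition_in_coords:
  assumes "transition W z w \<Phi> J D" and y: "(y, l) \<in> in_coords W w \<Omega>"
  obtains x where "x \<in> W" "y = w x" "x \<in> fst ` \<Omega>"
    "(\<Phi> y, transpose (J (\<Phi> y, \<Phi> y)) *v l) \<in> in_coords W z \<Omega>"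
proof -
  note t = transitionD[OF assms(1)]
  obtain x where x: "x \<in> W" "y = w x" "(x, transpose (matrix (frechet_derivative w (at x))) *v l) \<in> \<Omega>"
    using y unfolding in_coords_def by blast
  have zh: "holo_on z W" and wh: "holo_on w W"
    using local_coordsD t(1,2) by auto
  have "J (z x, z x) ** matrix (frechet_derivative z (at x)) = matrix (frechet_derivative w (at x))"
    by (subst matrix_eq)
      (simp add: matrix_vector_mul_assoc[symmetric] matrix_frechet[OF zh x(1)] matrix_frechet[OF wh x(1)]
        Jstar_diagonal[OF assms(1) x(1)])
  then have "transpose (matrix (frechet_derivative z (at x))) *v (transpose (J (z x, z x)) *v l)
      = transpose (matrix (frechet_derivative w (at x))) *v l"
    by (simp add: matrix_vector_mul_assoc flip: matrix_transpose_mul)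
  then have "(z x, transpose (J (z x, z x)) *v l) \<in> in_coords W z \<Omega>"
    using x(1,3) unfolding in_coords_def by auto
  then show thesis using that[of x] x t(3)[OF x(1)] by force
qed

lemma Jstar_diagonal_inj:
  assumes "transition W z w \<Phi> J D" and x: "x \<in> W" and l: "transpose (J (z x, z x)) *v l = 0"
  shows "l = 0"
proof -
  note t = transitionD[OF assms(1)]
  have wh: "holo_on w W" and W: "open W" and wi: "inj_on w W" and ow: "open (w ` W)"
    and ih: "holo_on (inv_into W w) (w ` W)"
    using local_coordsD t(2) by auto
  have wx: "w x \<in> w ` W" using x by simp
  obtain E where E: "(inv_into W w has_derivative E) (at (w x))"
    by (rule holo_onD[OF ih wx])
  have "(w has_derivative frechet_derivative w (at x)) (at (inv_into W w (w x)))"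
    using frechet_holo(1)[OF wh x] wi x by simp
  from has_derivative_compose[OF E this]
  have "((\<lambda>y. w (inv_into W w y)) has_derivative (\<lambda>h. frechet_derivative w (at x) (E h))) (at (w x))" .
  moreover have "((\<lambda>y. w (inv_into W w y)) has_derivative (\<lambda>h. h)) (at (w x))"
    by (rule has_derivative_transform_within_open[OF has_derivative_ident ow wx])
      (simp add: f_inv_into_f)
  ultimately have "frechet_derivative w (at x) (E h) = h" for h
    using has_derivative_unique by metis
  then have surj: "J (z x, z x) *v frechet_derivative z (at x) (E h) = h" for h
    by (simp add: Jstar_diagonal[OF assms(1) x])
  have "cdot h l = 0" for h
  proof -
    have "cdot h l = cdot (J (z x, z x) *v frechet_derivative z (at x) (E h)) l" by (simp add: surj)
    also have "\<dots> = cdot (frechet_derivative z (at x) (E h)) (transpose (J (z x, z x)) *v l)"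
      by (simp add: cdot_transpose)
    finally show ?thesis using l by (simp add: cdot_def)
  qed
  from this[of "axis i 1" for i] show ?thesis by (simp add: vec_eq_iff cdot_axis)
qed

subsection \<open>Thickened domains\<close>

text \<open>The set whose closure is \<open>thicken \<rho> \<Omega>\<close>.\<close>

definition thick_union :: "real \<Rightarrow> 'n::finite cotangent set \<Rightarrow> 'n cotangent set"
  where "thick_union \<rho> \<Omega> = (\<Union>(z, \<zeta>)\<in>\<Omega>.
    {(z + z', \<zeta> + \<zeta>') | z' \<zeta>'. maxnorm z' \<le> \<rho> \<and> maxnorm \<zeta>' \<le> \<rho> * maxnorm \<zeta>})"

lemma thicken_eq: "thicken \<rho> \<Omega> = closure (thick_union \<rho> \<Omega>)"
  by (simp add: thicken_def thick_union_def)

lemma thicken_mono: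
  assumes "\<rho> \<le> \<rho>'" shows "thicken \<rho> \<Omega> \<subseteq> thicken \<rho>' \<Omega>"
  unfolding thicken_eq
proof (rule closure_mono)
  have "maxnorm \<zeta>' \<le> \<rho>' * maxnorm \<zeta>" if "maxnorm \<zeta>' \<le> \<rho> * maxnorm \<zeta>" for \<zeta> \<zeta>' :: "complex^'n"
    using that mult_right_mono[OF assms maxnorm_ge_0[of \<zeta>]] by simp
  moreover have "maxnorm z' \<le> \<rho>'" if "maxnorm z' \<le> \<rho>" for z' :: "complex^'n"
    using that assms by simp
  ultimately show "thick_union \<rho> \<Omega> \<subseteq> thick_union \<rho>' \<Omega>"
    unfolding thick_union_def by fast
qed

lemma matrix_vector_scaleR: "A *v (s *\<^sub>R y) = s *\<^sub>R (A *v y)" for A :: "complex^'n^'m"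
  using matrix_vector_scaleC[of A "of_real s" y] by (simp add: scaleC_of_real)

text \<open>The constants by which a transformation is controlled: over the thickening with parameter
  \<open>\<rho>'\<close> in the coordinates \<open>(w; \<lambda>)\<close>, the balls of radii \<open>\<delta>\<close> and \<open>\<delta> |\<lambda>|\<close> in the auxiliary
  variables are mapped into the thickening with parameter \<open>\<rho>\<close> in the coordinates \<open>(z; \<zeta>)\<close>, and
  the sizes of the covectors are comparable.\<close>

definition controlled ::
    "(complex^'n::finite) set \<Rightarrow> (complex^'n \<Rightarrow> complex^'n) \<Rightarrow> (complex^'n \<Rightarrow> complex^'n) \<Rightarrow>
      (complex^'n \<Rightarrow> complex^'n) \<Rightarrow> ((complex^'n) \<times> (complex^'n) \<Rightarrow> complex^'n^'n) \<Rightarrow>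
      ((complex^'n) \<times> (complex^'n)) set \<Rightarrow> 'n cotangent set \<Rightarrow> real \<Rightarrow> real \<Rightarrow> real \<Rightarrow> real \<Rightarrow> real \<Rightarrow> bool"
  where "controlled W z w \<Phi> J D \<Omega> \<rho> \<rho>' \<delta> a b \<longleftrightarrow>
    0 < \<rho>' \<and> \<rho>' < 1 \<and> \<rho>' \<le> \<rho> \<and> 0 < \<delta> \<and> 0 < a \<and> 0 < b \<and>
    (\<forall>(y, l)\<in>thicken \<rho>' (in_coords W w \<Omega>). y \<in> w ` W \<and>
      (\<forall>z' \<zeta>'. norm z' \<le> \<delta> \<longrightarrow> norm \<zeta>' \<le> \<delta> * norm l \<longrightarrow>
        (\<Phi> y + z', \<Phi> y) \<in> D \<and>
        (\<Phi> y, \<zeta>' + transpose (J (\<Phi> y + z', \<Phi> y)) *v l) \<in> thicken \<rho> (in_coords W z \<Omega>) \<and>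
        a * maxnorm l \<le> maxnorm (\<zeta>' + transpose (J (\<Phi> y + z', \<Phi> y)) *v l) \<and>
        maxnorm (\<zeta>' + transpose (J (\<Phi> y + z', \<Phi> y)) *v l) \<le> b * maxnorm l))"

lemma controlledD:
  assumes "controlled W z w \<Phi> J D \<Omega> \<rho> \<rho>' \<delta> a b"
  shows "0 < \<rho>'" "\<rho>' < 1" "\<rho>' \<le> \<rho>" "0 < \<delta>" "0 < a" "0 < b"
    and "(y, l) \<in> thicken \<rho>' (in_coords W w \<Omega>) \<Longrightarrow> y \<in> w ` W"
    and "(y, l) \<in> thicken \<rho>' (in_coords W w \<Omega>) \<Longrightarrow> norm z' \<le> \<delta> \<Longrightarrow> norm \<zeta>' \<le> \<delta> * norm l \<Longrightarrow>
        (\<Phi> y + z', \<Phi> y) \<in> D \<and>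
        (\<Phi> y, \<zeta>' + transpose (J (\<Phi> y + z', \<Phi> y)) *v l) \<in> thicken \<rho> (in_coords W z \<Omega>) \<and>
        a * maxnorm l \<le> maxnorm (\<zeta>' + transpose (J (\<Phi> y + z', \<Phi> y)) *v l) \<and>
        maxnorm (\<zeta>' + transpose (J (\<Phi> y + z', \<Phi> y)) *v l) \<le> b * maxnorm l"
  using assms unfolding controlled_def by fast+

lemma mem_thick_union: "p \<in> thick_union \<rho> \<Omega> \<longleftrightarrow>
  (\<exists>z \<zeta> z' \<zeta>'. (z, \<zeta>) \<in> \<Omega> \<and> p = (z + z', \<zeta> + \<zeta>') \<and> maxnorm z' \<le> \<rho> \<and> maxnorm \<zeta>' \<le> \<rho> * maxnorm \<zeta>)"
  unfolding thick_union_def by fast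

lemma compact_lower_bound:
  fixes M :: "'a::metric_space \<Rightarrow> complex^'n^'n"
  assumes K: "compact K" and M: "continuous_on K M"
    and inj: "\<And>y l. y \<in> K \<Longrightarrow> transpose (M y) *v l = 0 \<Longrightarrow> l = 0"
  obtains a where "a > 0" "\<And>y l. y \<in> K \<Longrightarrow> a * norm l \<le> norm (transpose (M y) *v l)"
proof -
  let ?X = "K \<times> sphere (0 :: complex^'n) 1"
  have cont: "continuous_on ?X (\<lambda>p. norm (transpose (M (fst p)) *v snd p))"
  proof -
    have c1: "continuous_on ?X (\<lambda>p. M (fst p))"
      by (rule continuous_on_compose2[OF M continuous_on_fst[OF continuous_on_id]]) auto
    have "continuous_on ?X (\<lambda>p. transpose (M (fst p)) *v snd p)"
      unfolding matrix_vector_mult_def transpose_def vec_lambda_beta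
      by (intro continuous_on_vec_lambda continuous_intros c1)
    then show ?thesis by (rule continuous_on_norm)
  qed
  have ex: "\<exists>a>0. \<forall>p\<in>?X. a \<le> norm (transpose (M (fst p)) *v snd p)"
  proof (cases "?X = {}")
    case True
    then show ?thesis by (intro exI[of _ 1]) simp
  next
    case False
    have "compact ?X" by (intro compact_Times K compact_sphere)
    from continuous_attains_inf[OF this False cont]
    obtain p where p: "p \<in> ?X" "\<And>q. q \<in> ?X \<Longrightarrow> norm (transpose (M (fst p)) *v snd p) \<le> norm (transpose (M (fst q)) *v snd q)"
      by blast
    have "snd p \<noteq> 0" "fst p \<in> K" using p(1) by auto
    then have "transpose (M (fst p)) *v snd p \<noteq> 0" using inj by blast
    then show ?thesis using p(2) by (intro exI[of _ "norm (transpose (M (fst p)) *v snd p)"]) simp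
  qed
  then obtain a where a: "a > 0" "\<And>p. p \<in> ?X \<Longrightarrow> a \<le> norm (transpose (M (fst p)) *v snd p)" by blast
  have "a * norm l \<le> norm (transpose (M y) *v l)" if y: "y \<in> K" for y l
  proof (cases "l = 0")
    case False
    have "a \<le> norm (transpose (M y) *v ((1 / norm l) *\<^sub>R l))"
      using a(2)[of "(y, (1 / norm l) *\<^sub>R l)"] y False by simp
    then show ?thesis using False by (simp add: matrix_vector_scaleR field_simps)
  qed simp
  then show thesis using that a(1) by blast
qed

text \<open>All constants come from compactness: over a compact neighborhood \<open>K1\<close> of the closure of the
  base, \<open>\<Phi>\<close> and \<open>M(y, z') = J(\<Phi>(y) + z', \<Phi>(y))\<close> are uniformly continuous, \<open>M\<close> is bounded, and
  \<open>|\<^sup>tM(y, 0)\<lambda>| \<ge> a0 |\<lambda>|\<close>.\<close>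

lemma transition_controlled:
  fixes \<Omega> :: "'n::finite cotangent set"
  assumes t: "transition W z w \<Phi> J D" and B: "compact (closure (fst ` \<Omega>))" "closure (fst ` \<Omega>) \<subseteq> W"
    and \<rho>: "0 < \<rho>"
  obtains \<rho>' \<delta> a b where "controlled W z w \<Phi> J D \<Omega> \<rho> \<rho>' \<delta> a b"
proof -
  note tD = transitionD[OF t]
  define n where "n = real CARD('n)"
  have n: "n \<ge> 1" by (simp add: n_def Suc_le_eq)
  have wc: "continuous_on W w" using local_coordsD(3)[OF tD(2)] by (rule holo_on_imp_continuous_on)
  have wW: "open (w ` W)" by (rule local_coordsD(4)[OF tD(2)])
  define K0 where "K0 = w ` closure (fst ` \<Omega>)"
  have K0: "compact K0" "K0 \<subseteq> w ` W"
    unfolding K0_def using B wc by (auto intro: compact_continuous_image continuous_on_subset)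
  obtain \<epsilon>0 where \<epsilon>0: "\<epsilon>0 > 0" "(\<Union>x\<in>K0. cball x \<epsilon>0) \<subseteq> w ` W"
    using compact_subset_open_imp_cball_epsilon_subset[OF K0(1) wW K0(2)] by blast
  define K1 where "K1 = {x + y | x y. x \<in> K0 \<and> y \<in> cball 0 \<epsilon>0}"
  have K1: "compact K1" unfolding K1_def by (intro compact_sums K0 compact_cball)
  have K1W: "K1 \<subseteq> w ` W"
  proof
    fix y assume "y \<in> K1"
    then obtain x h where "y = x + h" "x \<in> K0" "norm h \<le> \<epsilon>0" by (auto simp: K1_def)
    then have "y \<in> cball x \<epsilon>0" by (simp add: dist_norm)
    then show "y \<in> w ` W" using \<epsilon>0(2) \<open>x \<in> K0\<close> by blast
  qed
  have K1I: "x + h \<in> K1" if "x \<in> K0" "norm h \<le> \<epsilon>0" for x h using that by (auto simp: K1_def)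
  have diag: "(\<Phi> y, \<Phi> y) \<in> D" if "y \<in> w ` W" for y using that tD(3,7) by auto
  have \<Phi>c: "continuous_on K1 \<Phi>"
    using holo_on_imp_continuous_on[OF transition_holo[OF t]] K1W by (rule continuous_on_subset)
  have "compact ((\<lambda>y. (\<Phi> y, \<Phi> y)) ` K1)"
    by (intro compact_continuous_image continuous_on_Pair \<Phi>c K1)
  moreover have "(\<lambda>y. (\<Phi> y, \<Phi> y)) ` K1 \<subseteq> D" using diag K1W by blast
  ultimately obtain \<delta>0 where \<delta>0: "\<delta>0 > 0" "(\<Union>p\<in>(\<lambda>y. (\<Phi> y, \<Phi> y)) ` K1. cball p \<delta>0) \<subseteq> D"
    using compact_subset_open_imp_cball_epsilon_subset[OF _ tD(4)] by blast
  have inD: "(\<Phi> y + z', \<Phi> y) \<in> D" if "y \<in> K1" "norm z' \<le> \<delta>0" for y z'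
  proof -
    have "(\<Phi> y + z', \<Phi> y) \<in> cball (\<Phi> y, \<Phi> y) \<delta>0" using that by (simp add: dist_Pair_Pair dist_norm)
    then show ?thesis using \<delta>0(2) that(1) by blast
  qed
  define M where "M = (\<lambda>p. J (\<Phi> (fst p) + snd p, \<Phi> (fst p)))"
  define Q where "Q = K1 \<times> cball (0 :: complex^'n) \<delta>0"
  have Q: "compact Q" unfolding Q_def by (intro compact_Times K1 compact_cball)
  have Mc: "continuous_on Q M"
  proof -
    have 1: "continuous_on Q (\<lambda>p. \<Phi> (fst p))"
      by (rule continuous_on_compose2[OF \<Phi>c]) (auto simp: Q_def intro: continuous_intros)
    show ?thesis unfolding M_def
      by (rule continuous_on_compose2[OF holo_on_imp_continuous_on[OF tD(5)]])
        (auto intro!: continuous_intros 1[unfolded Q_def] inD simp: Q_def)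
  qed
  have Mu: "uniformly_continuous_on Q M" by (rule compact_uniformly_continuous[OF Mc Q])
  have \<Phi>u: "uniformly_continuous_on K1 \<Phi>" by (rule compact_uniformly_continuous[OF \<Phi>c K1])
  have "bounded (M ` Q)" by (intro compact_imp_bounded compact_continuous_image Mc Q)
  then obtain Cm where Cm: "Cm > 0" "\<And>p. p \<in> Q \<Longrightarrow> norm (M p) \<le> Cm" unfolding bounded_pos by blast
  have M0c: "continuous_on K1 (\<lambda>y. M (y, 0))"
    by (rule continuous_on_compose2[OF Mc]) (use \<delta>0 in \<open>auto simp: Q_def intro!: continuous_intros\<close>)
  have M0i: "l = 0" if "y \<in> K1" "transpose (M (y, 0)) *v l = 0" for y l
  proof -
    obtain x where x: "x \<in> W" "y = w x" using K1W \<open>y \<in> K1\<close> by auto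
    show ?thesis
      by (rule Jstar_diagonal_inj[OF t x(1)]) (use that(2) x tD(3) in \<open>simp add: M_def\<close>)
  qed
  obtain a0 where a0: "a0 > 0" "\<And>y l. y \<in> K1 \<Longrightarrow> a0 * norm l \<le> norm (transpose (M (y, 0)) *v l)"
    by (rule compact_lower_bound[OF K1 M0c], erule (1) M0i, rule that)
  define \<rho>1 where "\<rho>1 = min \<rho> 1"
  have \<rho>1: "0 < \<rho>1" "\<rho>1 \<le> \<rho>" "\<rho>1 \<le> 1" using \<rho> by (auto simp: \<rho>1_def)
  \<comment> \<open>\<open>\<epsilon>\<close>, \<open>\<delta>\<close> and \<open>\<rho>'\<close> are such that the three error terms in \<open>core\<close> below add up to at most
    \<open>\<rho>1 a0 |l0| / n\<close>\<close>
  define \<epsilon> where "\<epsilon> = \<rho>1 * a0 / (8 * n^3)"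
  have \<epsilon>: "\<epsilon> > 0" using \<rho>1 a0(1) n by (simp add: \<epsilon>_def)
  obtain \<tau> where \<tau>: "\<tau> > 0" "\<And>p q. p \<in> Q \<Longrightarrow> q \<in> Q \<Longrightarrow> dist p q < \<tau> \<Longrightarrow> dist (M p) (M q) < \<epsilon>"
    using Mu[unfolded uniformly_continuous_on_def, rule_format, OF \<epsilon>] by blast
  obtain \<tau>' where \<tau>': "\<tau>' > 0" "\<And>p q. p \<in> K1 \<Longrightarrow> q \<in> K1 \<Longrightarrow> dist p q < \<tau>' \<Longrightarrow> dist (\<Phi> p) (\<Phi> q) < \<rho>"
    using \<Phi>u[unfolded uniformly_continuous_on_def, rule_format, OF \<rho>] by blast
  define \<delta> where "\<delta> = Min {\<delta>0, \<rho>1 * a0 / (8 * n), \<tau> / 4}"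
  have \<delta>: "\<delta> > 0" "\<delta> \<le> \<delta>0" "\<delta> \<le> \<rho>1 * a0 / (8 * n)" "\<delta> \<le> \<tau> / 4"
  proof -
    show "\<delta> > 0" using \<delta>0(1) \<rho>1 a0(1) n \<tau>(1) by (simp add: \<delta>_def)
    show "\<delta> \<le> \<delta>0" "\<delta> \<le> \<rho>1 * a0 / (8 * n)" "\<delta> \<le> \<tau> / 4"
      unfolding \<delta>_def by (rule Min_le, simp, blast)+
  qed
  define \<rho>' where "\<rho>' = Min {1 / 2, \<rho>, \<epsilon>0 / n, 1 / n, \<rho>1 * a0 / (4 * n^4 * Cm), \<tau> / (4 * n), \<tau>' / (2 * n)}"
  have \<rho>': "\<rho>' > 0" "\<rho>' \<le> 1 / 2" "\<rho>' \<le> \<rho>" "\<rho>' \<le> \<epsilon>0 / n" "\<rho>' \<le> 1 / n" "\<rho>' \<le> \<rho>1 * a0 / (4 * n^4 * Cm)"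
    "\<rho>' \<le> \<tau> / (4 * n)" "\<rho>' \<le> \<tau>' / (2 * n)"
  proof -
    show "\<rho>' > 0" using \<epsilon>0(1) \<rho> \<rho>1 a0(1) n \<tau>(1) \<tau>'(1) Cm(1) by (simp add: \<rho>'_def)
    show "\<rho>' \<le> 1 / 2" "\<rho>' \<le> \<rho>" "\<rho>' \<le> \<epsilon>0 / n" "\<rho>' \<le> 1 / n" "\<rho>' \<le> \<rho>1 * a0 / (4 * n^4 * Cm)"
      "\<rho>' \<le> \<tau> / (4 * n)" "\<rho>' \<le> \<tau>' / (2 * n)"
      unfolding \<rho>'_def by (rule Min_le, simp, blast)+
  qed
  have n\<rho>': "n * \<rho>' \<le> \<epsilon>0" "n * \<rho>' \<le> 1" "n * \<rho>' \<le> \<tau> / 4" "n * \<rho>' \<le> \<tau>' / 2"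
    "n^3 * Cm * (n * \<rho>') \<le> \<rho>1 * a0 / 4"
  proof -
    show "n * \<rho>' \<le> \<epsilon>0" "n * \<rho>' \<le> 1" "n * \<rho>' \<le> \<tau> / 4" "n * \<rho>' \<le> \<tau>' / 2"
      using \<rho>'(4,5,7,8) n by (simp_all add: field_simps)
    have "(4 * n^4 * Cm) * \<rho>' \<le> (4 * n^4 * Cm) * (\<rho>1 * a0 / (4 * n^4 * Cm))"
      using n Cm(1) by (intro mult_left_mono \<rho>'(6)) auto
    also have "\<dots> = \<rho>1 * a0" using n Cm(1) by simp
    finally show "n^3 * Cm * (n * \<rho>') \<le> \<rho>1 * a0 / 4"
      by (simp add: power_numeral_reduce algebra_simps)
  qed
  have n\<delta>: "n * \<delta> \<le> \<rho>1 * a0 / 8"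
    using \<delta>(3) n by (simp add: field_simps)
  have tr: "norm (transpose A *v l) \<le> n^2 * norm A * norm l" for A :: "complex^'n^'n" and l
    unfolding n_def by (rule norm_transpose_vector)
  have nm: "norm v \<le> n * maxnorm v" for v :: "complex^'n" unfolding n_def by (rule norm_le_maxnorm)
  have n2\<epsilon>: "n^2 * \<epsilon> \<le> \<rho>1 * a0 / (8 * n)" "n^3 * \<epsilon> = \<rho>1 * a0 / 8"
    using n by (simp_all add: \<epsilon>_def power_numeral_reduce)
  have size: "a0 / 2 * norm l \<le> norm (\<zeta>' + transpose (M (y, z')) *v l) \<and>
      norm (\<zeta>' + transpose (M (y, z')) *v l) \<le> (n^2 * Cm + 1 * \<delta>) * norm l"
    if y: "y \<in> K1" and z': "norm z' \<le> \<delta>" and \<zeta>': "norm \<zeta>' \<le> \<delta> * norm l" for y z' \<zeta>' l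
  proof -
    have q: "(y, z') \<in> Q" "(y, 0) \<in> Q" using y z' \<delta> by (auto simp: Q_def)
    have "dist (y, z') (y, 0) < \<tau>" using z' \<delta>(4) \<tau>(1) by (simp add: dist_Pair_Pair)
    from \<tau>(2)[OF q this] have "norm (M (y, z') - M (y, 0)) < \<epsilon>" by (simp add: dist_norm)
    then have d: "norm (transpose (M (y, z') - M (y, 0)) *v l) \<le> n^2 * \<epsilon> * norm l"
      using tr[of "M (y, z') - M (y, 0)" l] n
      by (meson less_imp_le mult_left_mono mult_right_mono norm_ge_zero order_trans zero_le_power2)
    have split: "\<zeta>' + transpose (M (y, z')) *v l
        = transpose (M (y, 0)) *v l - (- \<zeta>' - transpose (M (y, z') - M (y, 0)) *v l)"
      by (simp add: transpose_def matrix_vector_mult_def vec_eq_iff algebra_simps sum_subtractf)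
    have "norm (- \<zeta>' - transpose (M (y, z') - M (y, 0)) *v l) \<le> \<delta> * norm l + n^2 * \<epsilon> * norm l"
      using norm_triangle_ineq4[of "- \<zeta>'" "transpose (M (y, z') - M (y, 0)) *v l"] \<zeta>' d by simp
    also have "\<dots> \<le> (\<rho>1 * a0 / (8 * n) + \<rho>1 * a0 / (8 * n)) * norm l"
      unfolding distrib_right using \<delta>(3) n2\<epsilon>(1) by (intro add_mono mult_right_mono) auto
    also have "\<dots> \<le> a0 / 2 * norm l"
    proof (rule mult_right_mono)
      have "\<rho>1 * a0 / n \<le> a0 * 1"
        using mult_mono[OF \<rho>1(3) order_refl, of a0] a0(1) n \<rho>1 by (simp add: divide_le_eq mult_mono)
      then show "\<rho>1 * a0 / (8 * n) + \<rho>1 * a0 / (8 * n) \<le> a0 / 2" using a0(1) by simp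
    qed simp
    finally have small: "norm (- \<zeta>' - transpose (M (y, z') - M (y, 0)) *v l) \<le> a0 / 2 * norm l" .
    have "a0 * norm l - a0 / 2 * norm l \<le> norm (\<zeta>' + transpose (M (y, z')) *v l)"
      unfolding split using norm_triangle_ineq2[of "transpose (M (y, 0)) *v l"
          "- \<zeta>' - transpose (M (y, z') - M (y, 0)) *v l"] a0(2)[OF y, of l] small by simp
    moreover have "norm (\<zeta>' + transpose (M (y, z')) *v l) \<le> \<delta> * norm l + n^2 * Cm * norm l"
    proof -
      have "norm (transpose (M (y, z')) *v l) \<le> n^2 * Cm * norm l"
        using tr[of "M (y, z')" l] Cm(2)[OF q(1)] n
        by (meson mult_left_mono mult_right_mono norm_ge_zero order_trans zero_le_power2)
      then show ?thesis using norm_triangle_ineq[of \<zeta>' "transpose (M (y, z')) *v l"] \<zeta>' by simp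
    qed
    ultimately show ?thesis by (simp add: algebra_simps)
  qed
  let ?\<Omega>w = "in_coords W w \<Omega>" and ?\<Omega>z = "in_coords W z \<Omega>"
  \<comment> \<open>writing \<open>\<zeta>'\<close> as \<open>|l| u\<close> makes the constraint on \<open>u\<close> independent of \<open>l\<close>, so that for fixed
    \<open>z'\<close>, \<open>u\<close> the inclusion passes to the closure\<close>
  define T where "T = (\<lambda>z' u p. (\<Phi> (fst p), norm (snd p) *\<^sub>R u + transpose (M (fst p, z')) *v snd p))"
  have core: "fst p \<in> K1 \<and> (\<forall>z' u. norm z' \<le> \<delta> \<longrightarrow> norm u \<le> \<delta> \<longrightarrow> T z' u p \<in> thick_union \<rho> ?\<Omega>z)"
    if pX: "p \<in> thick_union \<rho>' ?\<Omega>w" for p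
  proof -
    obtain y0 l0 y' l' where p: "(y0, l0) \<in> ?\<Omega>w" "p = (y0 + y', l0 + l')"
      "maxnorm y' \<le> \<rho>'" "maxnorm l' \<le> \<rho>' * maxnorm l0"
      using pX unfolding mem_thick_union by blast
    obtain x where x: "x \<in> W" "y0 = w x" "x \<in> fst ` \<Omega>"
      "(\<Phi> y0, transpose (J (\<Phi> y0, \<Phi> y0)) *v l0) \<in> ?\<Omega>z"
      by (rule transition_in_coords[OF t p(1)])
    define l where "l = l0 + l'"
    define \<zeta>0 where "\<zeta>0 = transpose (M (y0, 0)) *v l0"
    have y0: "y0 \<in> K0" unfolding K0_def x(2) using x(3) closure_subset by blast
    have y0K: "y0 \<in> K1" using K1I[OF y0, of 0] \<epsilon>0(1) by simp
    have y': "norm y' \<le> n * \<rho>'"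
      by (rule order_trans[OF nm mult_left_mono[OF p(3)]]) (use n in simp)
    have yK: "y0 + y' \<in> K1" by (rule K1I[OF y0]) (use y' n\<rho>'(1) in simp)
    have l'n: "norm l' \<le> (n * \<rho>') * norm l0"
    proof -
      have "norm l' \<le> n * (\<rho>' * maxnorm l0)"
        by (rule order_trans[OF nm mult_left_mono[OF p(4)]]) (use n in simp)
      also have "\<dots> \<le> n * (\<rho>' * norm l0)"
        using n \<rho>'(1) by (intro mult_left_mono maxnorm_le_norm) auto
      finally show ?thesis by (simp add: mult.assoc)
    qed
    have "norm l' \<le> 1 * norm l0" by (rule order_trans[OF l'n]) (intro mult_right_mono n\<rho>'(2) norm_ge_zero)
    then have ln: "norm l \<le> 2 * norm l0" unfolding l_def using norm_triangle_ineq[of l0 l'] by simp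
    have "T z' u p \<in> thick_union \<rho> ?\<Omega>z" if z': "norm z' \<le> \<delta>" and u: "norm u \<le> \<delta>" for z' u
    proof -
      define \<zeta> where "\<zeta> = norm l *\<^sub>R u + transpose (M (y0 + y', z')) *v l"
      have q: "(y0 + y', z') \<in> Q" "(y0, 0) \<in> Q" using yK y0K z' \<delta> by (auto simp: Q_def)
      have "dist (y0 + y', z') (y0, 0) \<le> norm y' + norm z'"
        using norm_Pair_le[of y' z'] by (simp add: dist_norm)
      also have "\<dots> < \<tau>" using y' n\<rho>'(3) z' \<delta>(4) \<tau>(1) by simp
      finally have "norm (M (y0 + y', z') - M (y0, 0)) < \<epsilon>"
        using \<tau>(2)[OF q] by (simp add: dist_norm)
      then have d: "norm (transpose (M (y0 + y', z') - M (y0, 0)) *v l) \<le> n^2 * \<epsilon> * norm l"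
        using tr[of "M (y0 + y', z') - M (y0, 0)" l] n
        by (meson less_imp_le mult_left_mono mult_right_mono norm_ge_zero order_trans zero_le_power2)
      have d2: "norm (transpose (M (y0, 0)) *v l') \<le> n^2 * Cm * norm l'"
        using tr[of "M (y0, 0)" l'] Cm(2)[OF q(2)] n
        by (meson mult_left_mono mult_right_mono norm_ge_zero order_trans zero_le_power2)
      have "\<zeta> - \<zeta>0 = norm l *\<^sub>R u + transpose (M (y0 + y', z') - M (y0, 0)) *v l + transpose (M (y0, 0)) *v l'"
        unfolding \<zeta>_def \<zeta>0_def l_def
        by (simp add: transpose_def matrix_vector_mult_def vec_eq_iff algebra_simps sum_subtractf sum.distrib)
      then have "norm (\<zeta> - \<zeta>0) \<le> norm l * norm u + norm (transpose (M (y0 + y', z') - M (y0, 0)) *v l)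
          + norm (transpose (M (y0, 0)) *v l')"
        using norm_triangle_ineq[of "norm l *\<^sub>R u + transpose (M (y0 + y', z') - M (y0, 0)) *v l" "transpose (M (y0, 0)) *v l'"]
          norm_triangle_ineq[of "norm l *\<^sub>R u" "transpose (M (y0 + y', z') - M (y0, 0)) *v l"] by simp
      also have "\<dots> \<le> norm l * \<delta> + n^2 * \<epsilon> * norm l + n^2 * Cm * norm l'"
        using u d d2 by (intro add_mono mult_left_mono) auto
      also have "\<dots> \<le> (2 * norm l0) * \<delta> + n^2 * \<epsilon> * (2 * norm l0) + n^2 * Cm * ((n * \<rho>') * norm l0)"
        using ln l'n n \<epsilon> \<delta>(1) Cm(1) by (intro add_mono mult_left_mono mult_right_mono) auto
      finally have "n * norm (\<zeta> - \<zeta>0) \<le> n * ((2 * norm l0) * \<delta> + n^2 * \<epsilon> * (2 * norm l0) + n^2 * Cm * ((n * \<rho>') * norm l0))"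
        using n by (intro mult_left_mono) auto
      also have "\<dots> = (2 * (n * \<delta>) + 2 * (n^3 * \<epsilon>) + n^3 * Cm * (n * \<rho>')) * norm l0"
        by (simp add: power_numeral_reduce algebra_simps)
      also have "\<dots> \<le> (\<rho>1 * a0) * norm l0"
      proof (rule mult_right_mono)
        show "2 * (n * \<delta>) + 2 * (n^3 * \<epsilon>) + n^3 * Cm * (n * \<rho>') \<le> \<rho>1 * a0"
          using n\<delta> n2\<epsilon>(2) n\<rho>'(5) mult_pos_pos[OF \<rho>1(1) a0(1)] by linarith
      qed simp
      also have "\<dots> \<le> \<rho>1 * norm \<zeta>0"
        using a0(2)[OF y0K, of l0] \<rho>1(1) by (simp add: \<zeta>0_def mult.assoc mult_left_mono)
      also have "\<dots> \<le> \<rho> * (n * maxnorm \<zeta>0)"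
        using \<rho>1 nm[of \<zeta>0] \<rho> by (intro mult_mono) auto
      finally have "n * norm (\<zeta> - \<zeta>0) \<le> n * (\<rho> * maxnorm \<zeta>0)" by (simp add: mult_ac)
      then have "norm (\<zeta> - \<zeta>0) \<le> \<rho> * maxnorm \<zeta>0" using n by simp
      then have 1: "maxnorm (\<zeta> - \<zeta>0) \<le> \<rho> * maxnorm \<zeta>0" using maxnorm_le_norm order_trans by blast
      have "dist (y0 + y') y0 < \<tau>'" using y' n\<rho>'(4) \<tau>'(1) by (simp add: dist_norm)
      from \<tau>'(2)[OF yK y0K this] have "norm (\<Phi> (y0 + y') - \<Phi> y0) \<le> \<rho>" by (simp add: dist_norm)
      then have 2: "maxnorm (\<Phi> (y0 + y') - \<Phi> y0) \<le> \<rho>" using maxnorm_le_norm order_trans by blast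
      have "(\<Phi> y0, \<zeta>0) \<in> ?\<Omega>z" using x(4) by (simp add: \<zeta>0_def M_def)
      moreover have "T z' u p = (\<Phi> y0 + (\<Phi> (y0 + y') - \<Phi> y0), \<zeta>0 + (\<zeta> - \<zeta>0))"
        by (simp add: T_def p(2) \<zeta>_def l_def)
      ultimately show ?thesis unfolding mem_thick_union using 1 2 by blast
    qed
    then show ?thesis using yK p(2) by simp
  qed
  have clos: "thicken \<rho>' ?\<Omega>w \<subseteq> K1 \<times> UNIV"
    unfolding thicken_eq
  proof (rule closure_minimal)
    show "thick_union \<rho>' ?\<Omega>w \<subseteq> K1 \<times> UNIV" using core by auto
    show "closed (K1 \<times> (UNIV :: (complex^'n) set))"
      using closed_Times[OF compact_imp_closed[OF K1] closed_UNIV] .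
  qed
  have main: "T z' u p \<in> thicken \<rho> ?\<Omega>z" if p: "p \<in> thicken \<rho>' ?\<Omega>w" and z': "norm z' \<le> \<delta>" and u: "norm u \<le> \<delta>" for p z' u
  proof -
    have c1: "continuous_on (K1 \<times> UNIV) (\<lambda>p :: 'n cotangent. \<Phi> (fst p))"
      by (rule continuous_on_compose2[OF \<Phi>c]) (auto intro: continuous_intros)
    have c2: "continuous_on (K1 \<times> UNIV) (\<lambda>p :: 'n cotangent. M (fst p, z'))"
      by (rule continuous_on_compose2[OF Mc]) (use z' \<delta> in \<open>auto simp: Q_def intro!: continuous_intros\<close>)
    have c3: "continuous_on (K1 \<times> UNIV) (\<lambda>p. transpose (M (fst p, z')) *v snd p)"
      unfolding matrix_vector_mult_def transpose_def vec_lambda_beta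
      by (intro continuous_on_vec_lambda continuous_intros c2)
    have "continuous_on (K1 \<times> UNIV) (T z' u)"
      unfolding T_def by (intro continuous_on_Pair continuous_on_add continuous_on_scaleR continuous_on_norm
          continuous_on_snd continuous_on_id continuous_on_const c1 c3)
    then have "continuous_on (closure (thick_union \<rho>' ?\<Omega>w)) (T z' u)"
      using clos unfolding thicken_eq by (rule continuous_on_subset)
    moreover have "T z' u ` thick_union \<rho>' ?\<Omega>w \<subseteq> thicken \<rho> ?\<Omega>z"
    proof (rule image_subsetI)
      fix p assume "p \<in> thick_union \<rho>' ?\<Omega>w"
      then have "T z' u p \<in> thick_union \<rho> ?\<Omega>z" using core z' u by blast
      then show "T z' u p \<in> thicken \<rho> ?\<Omega>z"
        unfolding thicken_eq using closure_subset by blast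
    qed
    ultimately have "T z' u ` closure (thick_union \<rho>' ?\<Omega>w) \<subseteq> thicken \<rho> ?\<Omega>z"
      by (intro image_closure_subset) (auto simp: thicken_eq)
    then show ?thesis using p unfolding thicken_eq by blast
  qed
  have "controlled W z w \<Phi> J D \<Omega> \<rho> \<rho>' \<delta> (a0 / (2 * n)) ((n^2 * Cm + \<delta>) * n)"
    unfolding controlled_def
  proof (intro conjI ballI)
    show "0 < \<rho>'" "\<rho>' < 1" "\<rho>' \<le> \<rho>" "0 < \<delta>" "0 < a0 / (2 * n)" using \<rho>' \<delta> a0(1) n by simp_all
    show "0 < (n^2 * Cm + \<delta>) * n" using n Cm(1) \<delta>(1) by (intro mult_pos_pos add_pos_pos) auto
    fix p assume p: "p \<in> thicken \<rho>' ?\<Omega>w"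
    obtain y l where yl: "p = (y, l)" by (cases p)
    have y: "y \<in> K1" using p clos yl by auto
    have "(\<Phi> y + z', \<Phi> y) \<in> D \<and>
        (\<Phi> y, \<zeta>' + transpose (J (\<Phi> y + z', \<Phi> y)) *v l) \<in> thicken \<rho> ?\<Omega>z \<and>
        a0 / (2 * n) * maxnorm l \<le> maxnorm (\<zeta>' + transpose (J (\<Phi> y + z', \<Phi> y)) *v l) \<and>
        maxnorm (\<zeta>' + transpose (J (\<Phi> y + z', \<Phi> y)) *v l) \<le> (n^2 * Cm + \<delta>) * n * maxnorm l"
      if z': "norm z' \<le> \<delta>" and \<zeta>': "norm \<zeta>' \<le> \<delta> * norm l" for z' \<zeta>'
    proof (intro conjI)
      have Mz: "M (y, z') = J (\<Phi> y + z', \<Phi> y)" by (simp add: M_def)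
      let ?v = "\<zeta>' + transpose (J (\<Phi> y + z', \<Phi> y)) *v l"
      show "(\<Phi> y + z', \<Phi> y) \<in> D" by (rule inD[OF y]) (use z' \<delta>(2) in simp)
      define u where "u = (1 / norm l) *\<^sub>R \<zeta>'"
      have u: "norm u \<le> \<delta>" "norm l *\<^sub>R u = \<zeta>'"
        using \<zeta>' \<delta>(1) by (cases "l = 0"; simp add: u_def divide_le_eq)+
      show "(\<Phi> y, ?v) \<in> thicken \<rho> ?\<Omega>z"
        using main[OF p z' u(1)] by (simp add: T_def yl u(2) Mz)
      note s = size[OF y z' \<zeta>', unfolded Mz]
      have "a0 / 2 * maxnorm l \<le> a0 / 2 * norm l"
        using a0(1) by (intro mult_left_mono maxnorm_le_norm) simp
      also have "\<dots> \<le> norm ?v" using s by blast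
      also have "\<dots> \<le> n * maxnorm ?v" by (rule nm)
      finally show "a0 / (2 * n) * maxnorm l \<le> maxnorm ?v" using n by (simp add: field_simps)
      have "maxnorm ?v \<le> norm ?v" by (rule maxnorm_le_norm)
      also have "\<dots> \<le> (n^2 * Cm + \<delta>) * norm l" using s by simp
      also have "\<dots> \<le> (n^2 * Cm + \<delta>) * (n * maxnorm l)"
        using n Cm(1) \<delta>(1) by (intro mult_left_mono nm) auto
      finally show "maxnorm ?v \<le> (n^2 * Cm + \<delta>) * n * maxnorm l" by (simp add: mult.assoc)
    qed
    then show "case p of (y, l) \<Rightarrow> y \<in> w ` W \<and>
      (\<forall>z' \<zeta>'. norm z' \<le> \<delta> \<longrightarrow> norm \<zeta>' \<le> \<delta> * norm l \<longrightarrow>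
        (\<Phi> y + z', \<Phi> y) \<in> D \<and>
        (\<Phi> y, \<zeta>' + transpose (J (\<Phi> y + z', \<Phi> y)) *v l) \<in> thicken \<rho> ?\<Omega>z \<and>
        a0 / (2 * n) * maxnorm l \<le> maxnorm (\<zeta>' + transpose (J (\<Phi> y + z', \<Phi> y)) *v l) \<and>
        maxnorm (\<zeta>' + transpose (J (\<Phi> y + z', \<Phi> y)) *v l) \<le> (n^2 * Cm + \<delta>) * n * maxnorm l)"
      using y K1W yl by auto
  qed
  then show thesis by (rule that)
qed

section \<open>The transformation of formal symbols\<close>

lemma sym_dom_mono:
  assumes "\<rho> \<le> \<rho>'" "U \<subseteq> U'" "real m' * (d' * (1 - \<rho>')) \<le> real m * (d * (1 - \<rho>))"
  shows "sym_dom \<Omega> \<rho> U d m \<subseteq> sym_dom \<Omega> \<rho>' U' d' m'"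
  using thicken_mono[OF assms(1)] assms(2,3) unfolding sym_dom_def by fastforce

lemma d_eta_eq: "d_eta P \<nu> = dird (0, 0, 1) (P \<nu>)" for P :: "'n::finite series"
proof (rule ext)
  fix p :: "(complex^'n) \<times> (complex^'n) \<times> complex"
  obtain z \<zeta> \<eta> where p: "p = (z, \<zeta>, \<eta>)" by (cases p)
  show "d_eta P \<nu> p = dird (0, 0, 1) (P \<nu>) p"
    unfolding p d_eta_def dird_def by (simp add: deriv_shift_0[of _ \<eta>] o_def)
qed

lemma pullback_fiber_coeff:
  "pullback \<Phi> J P \<nu> (y, l, \<eta>) =
    (\<Sum>j\<le>\<nu>. fiber_coeff (\<lambda>z'. J (\<Phi> y + z', \<Phi> y)) l j (\<lambda>\<zeta>. P (\<nu> - j) (\<Phi> y, \<zeta>, \<eta>)))"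
  by (simp add: pullback_def exp_t_pairing_def fiber_coeff_def)

text \<open>The point at which \<open>P\<close> is evaluated in the definition of \<open>\<Phi>\<^sup>*P\<close>, as a function of
  \<open>((w, \<lambda>, \<eta>), (z', \<zeta>'))\<close>.\<close>

definition pull_arg ::
    "(complex^'n \<Rightarrow> complex^'n) \<Rightarrow> ((complex^'n) \<times> (complex^'n) \<Rightarrow> complex^'n^'n) \<Rightarrow>
      ((complex^'n) \<times> (complex^'n) \<times> complex) \<times> 'n::finite cotangent \<Rightarrow>
      (complex^'n) \<times> (complex^'n) \<times> complex"
  where "pull_arg \<Phi> J =
    (\<lambda>((y, l, \<eta>), (z', \<zeta>')). (\<Phi> y, \<zeta>' + transpose (J (\<Phi> y + z', \<Phi> y)) *v l, \<eta>))"

text \<open>Its domain, for \<open>w\<close> in \<open>V\<close> and \<open>J\<close> on \<open>D\<close>.\<close>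

definition pull_dom ::
    "(complex^'n) set \<Rightarrow> (complex^'n \<Rightarrow> complex^'n) \<Rightarrow> ((complex^'n) \<times> (complex^'n)) set \<Rightarrow>
      (((complex^'n) \<times> (complex^'n) \<times> complex) \<times> 'n::finite cotangent) set"
  where "pull_dom V \<Phi> D = {((y, l, \<eta>), (z', \<zeta>')). y \<in> V \<and> (\<Phi> y + z', \<Phi> y) \<in> D}"

lemma pullback_par:
  "pullback \<Phi> J P \<nu> p =
    (\<Sum>j\<le>\<nu>. 1 / fact j * (d_pairing_par ^^ j) (\<lambda>x. P (\<nu> - j) (pull_arg \<Phi> J x)) (p, 0, 0))"
proof -
  obtain y l \<eta> where p: "p = (y, l, \<eta>)" by (cases p)
  have "(\<lambda>(z', \<zeta>'). P k (\<Phi> y, \<zeta>' + transpose (J (\<Phi> y + z', \<Phi> y)) *v l, \<eta>))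
      = (\<lambda>q. (\<lambda>x. P k (pull_arg \<Phi> J x)) (p, q))" for k
    by (auto simp: p pull_arg_def)
  then show ?thesis
    unfolding d_pairing_par_power[symmetric] by (simp add: p pullback_def exp_t_pairing_def)
qed

lemma pull_dom_eq: "pull_dom V \<Phi> D
    = {x \<in> (V \<times> UNIV) \<times> UNIV. (\<Phi> (fst (fst x)) + fst (snd x), \<Phi> (fst (fst x))) \<in> D}"
  by (auto simp: pull_dom_def)

context
  fixes W :: "(complex^'n::finite) set" and z w \<Phi> :: "complex^'n \<Rightarrow> complex^'n"
    and J :: "(complex^'n) \<times> (complex^'n) \<Rightarrow> complex^'n^'n" and D :: "((complex^'n) \<times> (complex^'n)) set"
  assumes t: "transition W z w \<Phi> J D"
begin

lemma pull_base_holo: "holo_on (\<lambda>x. \<Phi> (fst (fst x))) ((w ` W \<times> UNIV) \<times> UNIV)"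
  by (rule holo_on_compose[OF _ transition_holo[OF t]], intro holo_on_fst holo_on_id) auto

lemma open_pull_base: "open ((w ` W \<times> UNIV) \<times> UNIV)"
  using local_coordsD(4)[OF transitionD(2)[OF t]] by (intro open_Times open_UNIV)

lemma holo_pull_pair:
  "holo_on (\<lambda>x. (\<Phi> (fst (fst x)) + fst (snd x), \<Phi> (fst (fst x)))) ((w ` W \<times> UNIV) \<times> UNIV)"
  by (intro holo_on_Pair holo_on_add pull_base_holo holo_on_fst holo_on_snd holo_on_id)

lemma open_pull_dom: "open (pull_dom (w ` W) \<Phi> D)"
  unfolding pull_dom_eq by (rule open_preimage_holo[OF holo_pull_pair open_pull_base transitionD(4)[OF t]])

lemma holo_pull_arg: "holo_on (pull_arg \<Phi> J) (pull_dom (w ` W) \<Phi> D)"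
proof -
  have sub: "pull_dom (w ` W) \<Phi> D \<subseteq> (w ` W \<times> UNIV) \<times> UNIV" unfolding pull_dom_eq by blast
  have "holo_on (\<lambda>x. J (\<Phi> (fst (fst x)) + fst (snd x), \<Phi> (fst (fst x)))) (pull_dom (w ` W) \<Phi> D)"
    by (rule holo_on_compose[OF holo_on_subset[OF holo_pull_pair sub] transitionD(5)[OF t]])
      (simp add: pull_dom_eq)
  then have "holo_on (\<lambda>x. (\<Phi> (fst (fst x)), snd (snd x) +
      transpose (J (\<Phi> (fst (fst x)) + fst (snd x), \<Phi> (fst (fst x)))) *v fst (snd (fst x)), snd (snd (fst x))))
      (pull_dom (w ` W) \<Phi> D)"
    by (intro holo_on_Pair holo_on_add holo_on_transpose_vector holo_on_subset[OF pull_base_holo sub]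
        holo_on_fst holo_on_snd holo_on_id)
  then show ?thesis unfolding pull_arg_def split_beta .
qed

lemma holo_pulled:
  assumes "open N" "holo_on f N"
  shows "holo_on (\<lambda>x. f (pull_arg \<Phi> J x)) {x \<in> pull_dom (w ` W) \<Phi> D. pull_arg \<Phi> J x \<in> N}"
    and "open {x \<in> pull_dom (w ` W) \<Phi> D. pull_arg \<Phi> J x \<in> N}"
proof -
  show "holo_on (\<lambda>x. f (pull_arg \<Phi> J x)) {x \<in> pull_dom (w ` W) \<Phi> D. pull_arg \<Phi> J x \<in> N}"
    by (rule holo_on_compose[OF holo_on_subset[OF holo_pull_arg] assms(2)]) auto
  show "open {x \<in> pull_dom (w ` W) \<Phi> D. pull_arg \<Phi> J x \<in> N}"
    by (rule open_preimage_holo[OF holo_pull_arg open_pull_dom assms(1)])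
qed

lemma pull_dom_zero: "fst p \<in> w ` W \<Longrightarrow> (p, 0, 0) \<in> pull_dom (w ` W) \<Phi> D"
  using transitionD(3,7)[OF t] by (cases p) (auto simp: pull_dom_def)

text \<open>The points at which all terms of the coefficient of \<open>t\<^sup>\<nu>\<close> of \<open>\<Phi>\<^sup>*P\<close> are holomorphic if \<open>P\<^sub>k\<close> is
  holomorphic on \<open>N k\<close>.\<close>

definition pull_nhd :: "(nat \<Rightarrow> ((complex^'n) \<times> (complex^'n) \<times> complex) set) \<Rightarrow> nat \<Rightarrow>
      ((complex^'n) \<times> (complex^'n) \<times> complex) set"
  where "pull_nhd N \<nu> = {p. fst p \<in> w ` W \<and> (\<forall>k\<le>\<nu>. pull_arg \<Phi> J (p, 0, 0) \<in> N k)}"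

lemma pull_nhd_mem:
  assumes "p \<in> pull_nhd N \<nu>" "k \<le> \<nu>"
  shows "(p, 0, 0) \<in> {x \<in> pull_dom (w ` W) \<Phi> D. pull_arg \<Phi> J x \<in> N k}"
  using assms pull_dom_zero by (auto simp: pull_nhd_def)

lemma open_pull_nhd:
  assumes "\<And>k. open (N k)"
  shows "open (pull_nhd N \<nu>)"
proof -
  have "open ((\<lambda>p. (p, 0, 0)) -` {x \<in> pull_dom (w ` W) \<Phi> D. pull_arg \<Phi> J x \<in> N k})" for k
    by (intro open_vimage open_preimage_holo[OF holo_pull_arg open_pull_dom assms] continuous_intros)
  then have "open (\<Inter>k\<in>{..\<nu>}. (\<lambda>p. (p, 0, 0)) -` {x \<in> pull_dom (w ` W) \<Phi> D. pull_arg \<Phi> J x \<in> N k})"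
    by (intro open_INT) auto
  also have "(\<Inter>k\<in>{..\<nu>}. (\<lambda>p. (p, 0, 0)) -` {x \<in> pull_dom (w ` W) \<Phi> D. pull_arg \<Phi> J x \<in> N k}) = pull_nhd N \<nu>"
    using pull_dom_zero by (auto simp: pull_nhd_def pull_dom_eq)
  finally show ?thesis .
qed

lemma holo_pullback:
  assumes N: "\<And>k. open (N k)" "\<And>k. holo_on (P k) (N k)"
  shows "holo_on (pullback \<Phi> J P \<nu>) (pull_nhd N \<nu>)"
proof -
  have "holo_on (\<lambda>p. (d_pairing_par ^^ j) (\<lambda>x. P (\<nu> - j) (pull_arg \<Phi> J x)) (p, 0, 0)) (pull_nhd N \<nu>)" for j
    by (rule holo_on_compose[OF _ holo_on_d_pairing_par_power[OF holo_pulled[OF N]]],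
        intro holo_on_Pair holo_on_id holo_on_const) (erule pull_nhd_mem, rule diff_le_self)
  then show ?thesis
    unfolding pullback_par[abs_def] by (intro holo_on_sum holo_on_mult holo_on_const)
qed

lemma d_eta_pullback:
  assumes N: "\<And>k. open (N k)" "\<And>k. holo_on (P k) (N k)" and p: "p \<in> pull_nhd N \<nu>"
  shows "d_eta (pullback \<Phi> J P) \<nu> p = pullback \<Phi> J (d_eta P) \<nu> p"
proof -
  let ?O = "\<lambda>k. {x \<in> pull_dom (w ` W) \<Phi> D. pull_arg \<Phi> J x \<in> N k}"
  let ?G = "\<lambda>j. (d_pairing_par ^^ j) (\<lambda>x. P (\<nu> - j) (pull_arg \<Phi> J x))"
  have hG: "holo_on (\<lambda>p. ?G j (p, 0, 0)) (pull_nhd N \<nu>)" for j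
    by (rule holo_on_compose[OF _ holo_on_d_pairing_par_power[OF holo_pulled[OF N]]],
        intro holo_on_Pair holo_on_id holo_on_const) (erule pull_nhd_mem, rule diff_le_self)
  have arg: "dird ((0, 0, 1), 0) (\<lambda>x. f (pull_arg \<Phi> J x)) = (\<lambda>x. dird (0, 0, 1) f (pull_arg \<Phi> J x))" for f
    by (rule ext) (simp add: dird_def pull_arg_def split_beta)
  have step: "dird (0, 0, 1) (\<lambda>p. ?G j (p, 0, 0)) p
      = (d_pairing_par ^^ j) (\<lambda>x. dird (0, 0, 1) (P (\<nu> - j)) (pull_arg \<Phi> J x)) (p, 0, 0)" for j
  proof -
    have "dird (0, 0, 1) (\<lambda>p. ?G j (p, 0, 0)) p = dird ((0, 0, 1), 0) (?G j) (p, 0, 0)"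
      by (rule dird_first)
    also have "\<dots> = (d_pairing_par ^^ j) (dird ((0, 0, 1), 0) (\<lambda>x. P (\<nu> - j) (pull_arg \<Phi> J x))) (p, 0, 0)"
      by (rule dird_d_pairing_par_power[OF holo_pulled[OF N]]) (rule pull_nhd_mem[OF p], simp)
    finally show ?thesis unfolding arg .
  qed
  have "d_eta (pullback \<Phi> J P) \<nu> p = (\<Sum>j\<le>\<nu>. dird (0, 0, 1) (\<lambda>p. 1 / fact j * ?G j (p, 0, 0)) p)"
    unfolding d_eta_eq pullback_par[abs_def]
    by (rule dird_sum[OF _ p]) (intro holo_on_mult holo_on_const hG)
  also have "\<dots> = (\<Sum>j\<le>\<nu>. 1 / fact j *
      (d_pairing_par ^^ j) (\<lambda>x. dird (0, 0, 1) (P (\<nu> - j)) (pull_arg \<Phi> J x)) (p, 0, 0))"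
    by (simp only: dird_cmult[OF hG p] step)
  also have "\<dots> = pullback \<Phi> J (d_eta P) \<nu> p"
    by (simp only: pullback_par d_eta_eq)
  finally show ?thesis .
qed

lemma fiber_coeff_estimate:
  fixes P :: "(complex^'n) \<times> (complex^'n) \<times> complex \<Rightarrow> complex"
  assumes y: "y \<in> w ` W" and \<delta>: "\<delta> > 0" and l: "l \<noteq> 0" and N: "open N" "holo_on P N"
    and box: "\<And>z' \<zeta>'. norm z' \<le> \<delta> \<Longrightarrow> norm \<zeta>' \<le> \<delta> * norm l \<Longrightarrow> (\<Phi> y + z', \<Phi> y) \<in> D \<and>
      (\<Phi> y, \<zeta>' + transpose (J (\<Phi> y + z', \<Phi> y)) *v l, \<eta>) \<in> N \<and>
      cmod (P (\<Phi> y, \<zeta>' + transpose (J (\<Phi> y + z', \<Phi> y)) *v l, \<eta>)) \<le> B"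
  shows "cmod (fiber_coeff (\<lambda>z'. J (\<Phi> y + z', \<Phi> y)) l j (\<lambda>\<zeta>. P (\<Phi> y, \<zeta>, \<eta>)))
    \<le> (3 * real CARD('n) * real j / (\<delta> * (\<delta> * norm l))) ^ j * B"
proof -
  let ?O = "{x \<in> pull_dom (w ` W) \<Phi> D. pull_arg \<Phi> J x \<in> N}"
  let ?F = "\<lambda>q. P (pull_arg \<Phi> J ((y, l, \<eta>), q))"
  have "cmod ((d_pairing ^^ j) ?F (0, 0) / fact j)
      \<le> (3 * real CARD('n) * real j / (\<delta> * (\<delta> * norm l))) ^ j * B"
  proof (rule d_pairing_power_bound[OF holo_slice[OF holo_pulled(1)[OF N]] open_slice[OF holo_pulled(2)[OF N]] \<delta>])
    show "0 < \<delta> * norm l" using \<delta> l by simp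
    show "bibox \<delta> (\<delta> * norm l) \<subseteq> {q. ((y, l, \<eta>), q) \<in> ?O}"
      using box y by (auto simp: bibox_def pull_dom_def pull_arg_def)
    fix p :: "'n cotangent" assume "p \<in> bibox \<delta> (\<delta> * norm l)"
    then show "cmod (?F p) \<le> B" using box by (auto simp: bibox_def pull_arg_def)
  qed
  moreover have "(\<lambda>(z', \<zeta>'). P (\<Phi> y, \<zeta>' + transpose (J (\<Phi> y + z', \<Phi> y)) *v l, \<eta>)) = ?F"
    by (auto simp: pull_arg_def)
  ultimately show ?thesis by (simp add: fiber_coeff_def)
qed

lemma fiber_germ:
  assumes "y \<in> w ` W"
  shows "holo_on (\<lambda>z'. J (\<Phi> y + z', \<Phi> y)) {z'. (\<Phi> y + z', \<Phi> y) \<in> D}"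
    "open {z'. (\<Phi> y + z', \<Phi> y) \<in> D}" "0 \<in> {z'. (\<Phi> y + z', \<Phi> y) \<in> D}"
proof -
  note tD = transitionD[OF t]
  have h: "holo_on (\<lambda>z'. (\<Phi> y + z', \<Phi> y)) X" for X
    by (intro holo_on_Pair holo_on_add holo_on_const holo_on_id)
  show "holo_on (\<lambda>z'. J (\<Phi> y + z', \<Phi> y)) {z'. (\<Phi> y + z', \<Phi> y) \<in> D}"
    by (rule holo_on_compose[OF h tD(5)]) simp
  show "open {z'. (\<Phi> y + z', \<Phi> y) \<in> D}"
    using open_preimage_holo[OF h[of UNIV] open_UNIV tD(4)] by simp
  show "0 \<in> {z'. (\<Phi> y + z', \<Phi> y) \<in> D}" using assms tD(3,7) by auto
qed

lemma controlled_sym_dom: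
  assumes c: "controlled W z w \<Phi> J D \<Omega> \<rho> \<rho>' \<delta> a b" and big: "d * (1 - \<rho>) \<le> a * (d' * (1 - \<rho>'))"
    and d: "0 \<le> d * (1 - \<rho>)" and p: "(y, l, \<eta>) \<in> sym_dom (in_coords W w \<Omega>) \<rho>' U d' m" and k: "k \<le> m"
    and z': "norm z' \<le> \<delta>" "norm \<zeta>' \<le> \<delta> * norm l"
  shows "(\<Phi> y, \<zeta>' + transpose (J (\<Phi> y + z', \<Phi> y)) *v l, \<eta>) \<in> sym_dom (in_coords W z \<Omega>) \<rho> U d k"
proof -
  let ?v = "\<zeta>' + transpose (J (\<Phi> y + z', \<Phi> y)) *v l"
  have p': "(y, l) \<in> thicken \<rho>' (in_coords W w \<Omega>)" "\<eta> \<in> U" "real m * (d' * (1 - \<rho>')) \<le> maxnorm (\<eta> *s l)"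
    using p by (auto simp: sym_dom_def)
  note C = controlledD(8)[OF c p'(1) z']
  have "real k * (d * (1 - \<rho>)) \<le> real m * (a * (d' * (1 - \<rho>')))"
    by (rule mult_mono[OF _ big]) (use k d in auto)
  also have "\<dots> \<le> a * maxnorm (\<eta> *s l)"
    using mult_left_mono[OF p'(3), of a] controlledD(5)[OF c] by (simp add: mult_ac)
  also have "\<dots> \<le> maxnorm (\<eta> *s ?v)"
    unfolding maxnorm_scale using C mult_left_mono[of "a * maxnorm l" "maxnorm ?v" "cmod \<eta>"]
    by (simp add: mult_ac)
  finally show ?thesis using C p'(2) by (simp add: sym_dom_def)
qed

text \<open>On the domain with index \<open>m\<close> the covectors satisfy \<open>|l| \<ge> m d'(1 - \<rho>')\<close>, which absorbs the
  factor \<open>j\<close> of the Cauchy estimate for \<open>j \<le> m\<close>.\<close>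

lemma fiber_coeff_sym_estimate:
  assumes c: "controlled W z w \<Phi> J D \<Omega> \<rho> \<rho>' \<delta> a b" and big: "d * (1 - \<rho>) \<le> a * (d' * (1 - \<rho>'))"
    and d: "0 \<le> d * (1 - \<rho>)" "0 < d'" and p: "(y, l, \<eta>) \<in> sym_dom (in_coords W w \<Omega>) \<rho>' Z d' m"
    and \<eta>: "cmod \<eta> \<le> 1" and m: "1 \<le> m" "k \<le> m" "j \<le> m"
    and \<kappa>: "3 * real CARD('n) / (\<delta>\<^sup>2 * (d' * (1 - \<rho>'))) \<le> \<kappa>"
    and P: "open N" "holo_on P N" "sym_dom (in_coords W z \<Omega>) \<rho> Z d k \<subseteq> N"
    and B: "\<And>\<zeta>. (\<Phi> y, \<zeta>, \<eta>) \<in> sym_dom (in_coords W z \<Omega>) \<rho> Z d k \<Longrightarrow> maxnorm \<zeta> \<le> b * maxnorm l \<Longrightarrow>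
      cmod (P (\<Phi> y, \<zeta>, \<eta>)) \<le> B"
  shows "cmod (fiber_coeff (\<lambda>z'. J (\<Phi> y + z', \<Phi> y)) l j (\<lambda>\<zeta>. P (\<Phi> y, \<zeta>, \<eta>))) \<le> \<kappa> ^ j * B"
proof -
  have p': "(y, l) \<in> thicken \<rho>' (in_coords W w \<Omega>)" "real m * (d' * (1 - \<rho>')) \<le> maxnorm (\<eta> *s l)"
    using p by (auto simp: sym_dom_def)
  note c' = controlledD[OF c]
  define e where "e = d' * (1 - \<rho>')"
  have e: "e > 0" using d(2) c'(2) by (simp add: e_def)
  have "real m * e \<le> cmod \<eta> * maxnorm l" using p'(2) by (simp add: e_def maxnorm_scale)
  also have "\<dots> \<le> 1 * maxnorm l" using \<eta> by (intro mult_right_mono maxnorm_ge_0)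
  also have "\<dots> \<le> norm l" using maxnorm_le_norm[of l] by simp
  finally have ml: "real m * e \<le> norm l" .
  moreover have "0 < real m * e" using m(1) e by simp
  ultimately have l0: "0 < norm l" by linarith
  have box: "(\<Phi> y + z', \<Phi> y) \<in> D \<and>
      (\<Phi> y, \<zeta>' + transpose (J (\<Phi> y + z', \<Phi> y)) *v l, \<eta>) \<in> N \<and>
      cmod (P (\<Phi> y, \<zeta>' + transpose (J (\<Phi> y + z', \<Phi> y)) *v l, \<eta>)) \<le> B"
    if z': "norm z' \<le> \<delta>" "norm \<zeta>' \<le> \<delta> * norm l" for z' \<zeta>'
    using controlled_sym_dom[OF c big d(1) p m(2) z'] controlledD(8)[OF c p'(1) z'] P(3) B by blast
  have "cmod (P (\<Phi> y, 0 + transpose (J (\<Phi> y + 0, \<Phi> y)) *v l, \<eta>)) \<le> B"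
    using box[of 0 0] c'(4) by simp
  from order_trans[OF norm_ge_zero this] have B0: "0 \<le> B" .
  have "real j * e \<le> norm l"
    using order_trans[OF mult_right_mono[of "real j" "real m" e] ml] m(3) e by simp
  then have "real j / norm l \<le> 1 / e" using l0 e by (simp add: field_simps)
  then have "(3 * real CARD('n) / \<delta>\<^sup>2) * (real j / norm l) \<le> (3 * real CARD('n) / \<delta>\<^sup>2) * (1 / e)"
    by (intro mult_left_mono) auto
  then have q: "3 * real CARD('n) * real j / (\<delta> * (\<delta> * norm l)) \<le> \<kappa>"
    using \<kappa> by (simp add: power2_eq_square e_def mult.assoc)
  have "cmod (fiber_coeff (\<lambda>z'. J (\<Phi> y + z', \<Phi> y)) l j (\<lambda>\<zeta>. P (\<Phi> y, \<zeta>, \<eta>)))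
      \<le> (3 * real CARD('n) * real j / (\<delta> * (\<delta> * norm l))) ^ j * B"
    by (rule fiber_coeff_estimate[OF c'(7)[OF p'(1)] c'(4) _ P(1,2) box]) (use l0 in auto)
  also have "\<dots> \<le> \<kappa> ^ j * B"
    using q B0 c'(4) by (intro mult_right_mono power_mono) auto
  finally show ?thesis .
qed

lemma pull_nhd_sym_dom:
  assumes c: "controlled W z w \<Phi> J D \<Omega> \<rho> \<rho>' \<delta> a b" and big: "d * (1 - \<rho>) \<le> a * (d' * (1 - \<rho>'))"
    and d: "0 \<le> d * (1 - \<rho>)" and N: "\<And>k. sym_dom (in_coords W z \<Omega>) \<rho> S d (k + 1) \<subseteq> N k"
  shows "sym_dom (in_coords W w \<Omega>) \<rho>' S d' (\<nu> + 1) \<subseteq> pull_nhd N \<nu>"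
proof
  fix p assume p: "p \<in> sym_dom (in_coords W w \<Omega>) \<rho>' S d' (\<nu> + 1)"
  obtain y l \<eta> where yl: "p = (y, l, \<eta>)" by (cases p)
  have "(\<Phi> y, 0 + transpose (J (\<Phi> y + 0, \<Phi> y)) *v l, \<eta>) \<in> N k" if "k \<le> \<nu>" for k
    using controlled_sym_dom[OF c big d p[unfolded yl], of "k + 1" 0 0] N[of k] that controlledD(4)[OF c] by auto
  moreover have "y \<in> w ` W"
    using controlledD(7)[OF c] p by (auto simp: yl sym_dom_def)
  ultimately show "p \<in> pull_nhd N \<nu>" by (simp add: pull_nhd_def yl pull_arg_def)
qed

end

lemma N_hatI:
  assumes "0 < d" "0 < \<rho>" "\<rho> < 1" "0 < A" "A < 1"
    and "\<And>\<nu>. holo_near (P \<nu>) (sym_dom \<Omega> \<rho> S d (\<nu> + 1))"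
    and "\<And>Z h. rel_compact Z S \<Longrightarrow> 0 < h \<Longrightarrow> \<exists>C>0. \<forall>m. \<forall>(z, \<zeta>, \<eta>)\<in>sym_dom \<Omega> \<rho> Z d m.
        cmod (\<Sum>\<nu><m. P \<nu> (z, \<zeta>, \<eta>)) \<le> C * A ^ m * exp (h * maxnorm \<zeta>)"
  shows "P \<in> N_hat \<Omega> S"
  unfolding N_hat_def using assms by blast

lemma S_hatI:
  assumes "0 < d" "0 < \<rho>" "\<rho> < 1" "0 < A" "A < 1"
    and "\<And>\<nu>. holo_near (P \<nu>) (sym_dom \<Omega> \<rho> S d (\<nu> + 1))"
    and "\<And>Z h. rel_compact Z S \<Longrightarrow> 0 < h \<Longrightarrow> \<exists>C>0. \<forall>\<nu>. \<forall>(z, \<zeta>, \<eta>)\<in>sym_dom \<Omega> \<rho> Z d (\<nu> + 1).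
        cmod (P \<nu> (z, \<zeta>, \<eta>)) \<le> C * A ^ \<nu> * exp (h * maxnorm \<zeta>)"
    and "d_eta P \<in> N_hat \<Omega> S"
  shows "P \<in> S_hat \<Omega> S"
  unfolding S_hat_def using assms by blast

text \<open>Membership in \<open>N_hat\<close> depends only on the values near the domains for some, possibly larger, \<open>d\<close>
  and smaller \<open>\<rho>\<close>.\<close>

lemma N_hat_cong:
  assumes Q: "Q \<in> N_hat \<Omega> S" and d: "0 < d" "0 < \<rho>" "\<rho> < 1"
    and N: "\<And>\<nu>. open (N \<nu>)" "\<And>\<nu>. sym_dom \<Omega> \<rho> S d (\<nu> + 1) \<subseteq> N \<nu>"
    and eq: "\<And>\<nu> p. p \<in> N \<nu> \<Longrightarrow> R \<nu> p = Q \<nu> p"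
  shows "R \<in> N_hat \<Omega> S"
proof -
  obtain d1 \<rho>1 A where Q1: "0 < d1" "0 < \<rho>1" "\<rho>1 < 1" "0 < A" "A < 1"
    "\<And>\<nu>. holo_near (Q \<nu>) (sym_dom \<Omega> \<rho>1 S d1 (\<nu> + 1))"
    "\<And>Z h. rel_compact Z S \<Longrightarrow> 0 < h \<Longrightarrow> \<exists>C>0. \<forall>m. \<forall>(z, \<zeta>, \<eta>)\<in>sym_dom \<Omega> \<rho>1 Z d1 m.
        cmod (\<Sum>\<nu><m. Q \<nu> (z, \<zeta>, \<eta>)) \<le> C * A ^ m * exp (h * maxnorm \<zeta>)"
    using Q unfolding N_hat_def by blast
  define d2 where "d2 = max d d1"
  define \<rho>2 where "\<rho>2 = min \<rho> \<rho>1"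
  have p2: "0 < d2" "0 < \<rho>2" "\<rho>2 < 1" "\<rho>2 \<le> \<rho>" "\<rho>2 \<le> \<rho>1"
    using d Q1(1-3) by (auto simp: d2_def \<rho>2_def)
  have dd: "d * (1 - \<rho>) \<le> d2 * (1 - \<rho>2)" "d1 * (1 - \<rho>1) \<le> d2 * (1 - \<rho>2)"
    using d Q1(1-3) p2 by (auto simp: d2_def intro!: mult_mono)
  have sub: "sym_dom \<Omega> \<rho>2 U d2 m \<subseteq> sym_dom \<Omega> \<rho> U d m" "sym_dom \<Omega> \<rho>2 U d2 m \<subseteq> sym_dom \<Omega> \<rho>1 U d1 m" for U m
    by (rule sym_dom_mono[OF p2(4) subset_refl mult_left_mono[OF dd(1)]], simp)
      (rule sym_dom_mono[OF p2(5) subset_refl mult_left_mono[OF dd(2)]], simp)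
  show ?thesis
  proof (rule N_hatI)
    show "0 < d2" "0 < \<rho>2" "\<rho>2 < 1" "0 < A" "A < 1" using p2 Q1 by auto
    fix \<nu>
    obtain M where M: "open M" "sym_dom \<Omega> \<rho>1 S d1 (\<nu> + 1) \<subseteq> M" "holo_on (Q \<nu>) M"
      using Q1(6) unfolding holo_near_def by blast
    have "holo_on (R \<nu>) (M \<inter> N \<nu>)"
      by (rule holo_on_cong[of _ "Q \<nu>"]) (use M N eq in \<open>auto intro: holo_on_subset\<close>)
    then show "holo_near (R \<nu>) (sym_dom \<Omega> \<rho>2 S d2 (\<nu> + 1))"
      unfolding holo_near_def using M N(1)[of \<nu>] N(2)[of \<nu>] sub[of S "\<nu> + 1"]
      by (intro exI[of _ "M \<inter> N \<nu>"]) blast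
  next
    fix Z and h :: real assume Z: "rel_compact Z S" and h: "0 < h"
    have ZS: "Z \<subseteq> S" using Z closure_subset unfolding rel_compact_def by blast
    obtain C where C: "C > 0" "\<And>m z \<zeta> \<eta>. (z, \<zeta>, \<eta>) \<in> sym_dom \<Omega> \<rho>1 Z d1 m \<Longrightarrow>
        cmod (\<Sum>\<nu><m. Q \<nu> (z, \<zeta>, \<eta>)) \<le> C * A ^ m * exp (h * maxnorm \<zeta>)"
      using Q1(7)[OF Z h] by blast
    have "cmod (\<Sum>\<nu><m. R \<nu> (z, \<zeta>, \<eta>)) \<le> C * A ^ m * exp (h * maxnorm \<zeta>)"
      if p: "(z, \<zeta>, \<eta>) \<in> sym_dom \<Omega> \<rho>2 Z d2 m" for m z \<zeta> \<eta>
    proof -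
      have "R \<nu> (z, \<zeta>, \<eta>) = Q \<nu> (z, \<zeta>, \<eta>)" if "\<nu> < m" for \<nu>
      proof (rule eq)
        have "sym_dom \<Omega> \<rho> Z d m \<subseteq> sym_dom \<Omega> \<rho> S d (\<nu> + 1)"
          using that d ZS by (intro sym_dom_mono mult_right_mono) auto
        then show "(z, \<zeta>, \<eta>) \<in> N \<nu>" using p sub(1) N(2) by blast
      qed
      then have "(\<Sum>\<nu><m. R \<nu> (z, \<zeta>, \<eta>)) = (\<Sum>\<nu><m. Q \<nu> (z, \<zeta>, \<eta>))" by simp
      then show ?thesis using C(2)[OF subsetD[OF sub(2) p]] by simp
    qed
    then show "\<exists>C>0. \<forall>m. \<forall>(z, \<zeta>, \<eta>)\<in>sym_dom \<Omega> \<rho>2 Z d2 m.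
        cmod (\<Sum>\<nu><m. R \<nu> (z, \<zeta>, \<eta>)) \<le> C * A ^ m * exp (h * maxnorm \<zeta>)"
      using C(1) by blast
  qed
qed

lemma zero_in_N_hat: "(\<lambda>\<nu> p. 0) \<in> N_hat \<Omega> S"
proof -
  have "holo_near (\<lambda>p. 0 :: complex) X" for X :: "((complex^'n) \<times> (complex^'n) \<times> complex) set"
    unfolding holo_near_def by (intro exI[of _ UNIV]) (auto intro: holo_on_const)
  moreover have "\<exists>C>0. \<forall>m. \<forall>(z, \<zeta>, \<eta>)\<in>sym_dom \<Omega> (1/2) Z 1 m.
      cmod (\<Sum>\<nu><m. 0) \<le> C * (1/2) ^ m * exp (h * maxnorm \<zeta>)" for Z h
    by (intro exI[of _ 1]) auto
  ultimately show ?thesis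
    by (intro N_hatI[of 1 "1/2" "1/2"]) simp_all
qed

lemma sum_triangle_swap:
  fixes g :: "nat \<Rightarrow> nat \<Rightarrow> 'a::comm_monoid_add"
  shows "(\<Sum>\<nu><m. \<Sum>j\<le>\<nu>. g j (\<nu> - j)) = (\<Sum>j<m. \<Sum>k<m - j. g j k)"
proof -
  have "(\<Sum>\<nu><m. \<Sum>j\<le>\<nu>. g j (\<nu> - j)) = (\<Sum>(\<nu>, j)\<in>Sigma {..<m} (\<lambda>\<nu>. {..\<nu>}). g j (\<nu> - j))"
    by (simp add: sum.Sigma)
  also have "\<dots> = (\<Sum>(j, k)\<in>Sigma {..<m} (\<lambda>j. {..<m - j}). g j k)"
    by (rule sum.reindex_bij_witness[of _ "\<lambda>(j, k). (j + k, j)" "\<lambda>(\<nu>, j). (j, \<nu> - j)"]) auto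
  also have "\<dots> = (\<Sum>j<m. \<Sum>k<m - j. g j k)" by (simp add: sum.Sigma)
  finally show ?thesis .
qed

lemma geometric_half_sum: "(\<Sum>j<m. (1 / 2 :: real) ^ j) \<le> 2"
proof -
  have "(\<Sum>j<m. (1 / 2 :: real) ^ j) = 2 - 2 * (1 / 2) ^ m"
    by (induction m) (simp_all add: field_simps)
  then show ?thesis by simp
qed

lemma holo_in_fiber:
  fixes P :: "(complex^'n) \<times> (complex^'n) \<times> complex \<Rightarrow> complex"
  assumes "open N" "holo_on P N"
  shows "holo_on (\<lambda>\<zeta>. P (y, \<zeta>, \<eta>)) {\<zeta>. (y, \<zeta>, \<eta>) \<in> N}" "open {\<zeta>. (y, \<zeta>, \<eta>) \<in> N}"
proof -
  have h: "holo_on (\<lambda>\<zeta>. (y, \<zeta>, \<eta>)) X" for X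
    by (intro holo_on_Pair holo_on_const holo_on_id)
  show "holo_on (\<lambda>\<zeta>. P (y, \<zeta>, \<eta>)) {\<zeta>. (y, \<zeta>, \<eta>) \<in> N}"
    by (rule holo_on_compose[OF h assms(2)]) simp
  show "open {\<zeta>. (y, \<zeta>, \<eta>) \<in> N}"
    using open_preimage_holo[OF h[of UNIV] open_UNIV assms(1)] by simp
qed

lemma holo_near_choice:
  assumes "\<And>\<nu>::nat. holo_near (P \<nu>) (X \<nu>)"
  shows "\<exists>N. \<forall>\<nu>. open (N \<nu>) \<and> holo_on (P \<nu>) (N \<nu>) \<and> X \<nu> \<subseteq> N \<nu>"
  using assms unfolding holo_near_def by metis

context
  fixes W :: "(complex^'n::finite) set" and z w \<Phi> :: "complex^'n \<Rightarrow> complex^'n"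
    and J :: "(complex^'n) \<times> (complex^'n) \<Rightarrow> complex^'n^'n" and D :: "((complex^'n) \<times> (complex^'n)) set"
    and \<Omega> :: "'n cotangent set"
  assumes t: "transition W z w \<Phi> J D"
    and B: "compact (closure (fst ` \<Omega>))" "closure (fst ` \<Omega>) \<subseteq> W"
begin

text \<open>For given \<open>d\<close>, \<open>\<rho>\<close> and \<open>A\<close> on the side of \<open>z\<close>, the choice of \<open>d'\<close> and \<open>\<rho>'\<close> on the side of
  \<open>w\<close>: a large \<open>d'\<close> makes the constant \<open>3 n / (\<delta>\<^sup>2 d' (1 - \<rho>'))\<close> of the Cauchy estimate at most
  \<open>A / 2\<close>.\<close>

lemma choose_constants:
  assumes d: "0 < d" "0 < \<rho>" "\<rho> < 1" and A: "(0::real) < A"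
  obtains \<rho>' \<delta> a b d' where "controlled W z w \<Phi> J D \<Omega> \<rho> \<rho>' \<delta> a b" "0 < d'" "0 < \<rho>'" "\<rho>' < 1"
    "0 \<le> d * (1 - \<rho>)" "d * (1 - \<rho>) \<le> a * (d' * (1 - \<rho>'))"
    "3 * real CARD('n) / (\<delta>\<^sup>2 * (d' * (1 - \<rho>'))) \<le> A / 2"
proof -
  obtain \<rho>' \<delta> a b where c: "controlled W z w \<Phi> J D \<Omega> \<rho> \<rho>' \<delta> a b"
    using transition_controlled[OF t B d(2)] by blast
  note c' = controlledD(1-6)[OF c]
  define e where "e = max (d * (1 - \<rho>) / a) (6 * real CARD('n) / (\<delta>\<^sup>2 * A))"
  have e1: "d * (1 - \<rho>) \<le> a * e"
  proof -
    have "d * (1 - \<rho>) / a \<le> e" by (simp add: e_def)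
    then show ?thesis using c'(5) by (simp add: pos_divide_le_eq mult.commute)
  qed
  have "0 < 6 * real CARD('n) / (\<delta>\<^sup>2 * A)" using c'(4) A by simp
  also have "\<dots> \<le> e" by (simp add: e_def)
  finally have e0: "0 < e" .
  have "6 * real CARD('n) / (\<delta>\<^sup>2 * A) \<le> e" by (simp add: e_def)
  then have e2: "3 * real CARD('n) / (\<delta>\<^sup>2 * e) \<le> A / 2"
    using e0 c'(4) A by (simp add: field_simps)
  define d' where "d' = e / (1 - \<rho>')"
  have d': "d' * (1 - \<rho>') = e" "0 < d'" using c' e0 by (auto simp: d'_def)
  show thesis
    by (rule that[OF c d'(2) c'(1,2)]) (use d e1 e2 d'(1) in auto)
qed

lemma pullback_holo_near:
  assumes P: "\<And>\<nu>. holo_near (P \<nu>) (sym_dom (in_coords W z \<Omega>) \<rho> S d (\<nu> + 1))"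
    and c: "controlled W z w \<Phi> J D \<Omega> \<rho> \<rho>' \<delta> a b" "0 \<le> d * (1 - \<rho>)" "d * (1 - \<rho>) \<le> a * (d' * (1 - \<rho>'))"
  shows "\<exists>N. \<forall>\<nu>. open (N \<nu>) \<and> sym_dom (in_coords W w \<Omega>) \<rho>' S d' (\<nu> + 1) \<subseteq> N \<nu> \<and>
    holo_on (pullback \<Phi> J P \<nu>) (N \<nu>) \<and>
    (\<forall>p\<in>N \<nu>. d_eta (pullback \<Phi> J P) \<nu> p = pullback \<Phi> J (d_eta P) \<nu> p)"
proof -
  obtain N where N: "\<And>\<nu>. open (N \<nu>)" "\<And>\<nu>. holo_on (P \<nu>) (N \<nu>)"
    "\<And>\<nu>. sym_dom (in_coords W z \<Omega>) \<rho> S d (\<nu> + 1) \<subseteq> N \<nu>"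
    using holo_near_choice[of P "\<lambda>\<nu>. sym_dom (in_coords W z \<Omega>) \<rho> S d (\<nu> + 1)", OF P] by blast
  show ?thesis
  proof (intro exI allI conjI ballI)
    show "open (pull_nhd W w \<Phi> J N \<nu>)" for \<nu> by (rule open_pull_nhd[OF t N(1)])
    show "sym_dom (in_coords W w \<Omega>) \<rho>' S d' (\<nu> + 1) \<subseteq> pull_nhd W w \<Phi> J N \<nu>" for \<nu>
      by (rule pull_nhd_sym_dom[OF t c(1,3,2) N(3)])
    show "holo_on (pullback \<Phi> J P \<nu>) (pull_nhd W w \<Phi> J N \<nu>)" for \<nu>
      by (rule holo_pullback[OF t N(1,2)])
    show "d_eta (pullback \<Phi> J P) \<nu> p = pullback \<Phi> J (d_eta P) \<nu> p" if "p \<in> pull_nhd W w \<Phi> J N \<nu>" for \<nu> p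
      by (rule d_eta_pullback[OF t N(1,2) that])
  qed
qed

lemma pullback_N_hat:
  assumes P: "P \<in> N_hat (in_coords W z \<Omega>) S" and S: "\<And>\<eta>. \<eta> \<in> S \<Longrightarrow> cmod \<eta> \<le> 1"
  shows "pullback \<Phi> J P \<in> N_hat (in_coords W w \<Omega>) S"
proof -
  let ?\<Omega>z = "in_coords W z \<Omega>" and ?\<Omega>w = "in_coords W w \<Omega>"
  obtain d \<rho> A where P1: "0 < d" "0 < \<rho>" "\<rho> < 1" "0 < A" "A < 1"
    "\<And>\<nu>. holo_near (P \<nu>) (sym_dom ?\<Omega>z \<rho> S d (\<nu> + 1))"
    "\<And>Z h. rel_compact Z S \<Longrightarrow> 0 < h \<Longrightarrow> \<exists>C>0. \<forall>m. \<forall>(z, \<zeta>, \<eta>)\<in>sym_dom ?\<Omega>z \<rho> Z d m.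
        cmod (\<Sum>\<nu><m. P \<nu> (z, \<zeta>, \<eta>)) \<le> C * A ^ m * exp (h * maxnorm \<zeta>)"
    using P unfolding N_hat_def by blast
  obtain \<rho>' \<delta> a b d' where c: "controlled W z w \<Phi> J D \<Omega> \<rho> \<rho>' \<delta> a b" and d': "0 < d'" "0 < \<rho>'" "\<rho>' < 1"
    and d0: "0 \<le> d * (1 - \<rho>)" and big: "d * (1 - \<rho>) \<le> a * (d' * (1 - \<rho>'))"
    and \<kappa>: "3 * real CARD('n) / (\<delta>\<^sup>2 * (d' * (1 - \<rho>'))) \<le> A / 2"
    using choose_constants[OF P1(1-4)] by blast
  have b0: "0 < b" by (rule controlledD(6)[OF c])
  obtain N where N: "\<And>\<nu>. open (N \<nu>)" "\<And>\<nu>. holo_on (P \<nu>) (N \<nu>)"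
    "\<And>\<nu>. sym_dom ?\<Omega>z \<rho> S d (\<nu> + 1) \<subseteq> N \<nu>"
    using holo_near_choice[of P "\<lambda>\<nu>. sym_dom ?\<Omega>z \<rho> S d (\<nu> + 1)", OF P1(6)] by blast
  show ?thesis
  proof (rule N_hatI)
    show "0 < d'" "0 < \<rho>'" "\<rho>' < 1" "0 < A" "A < 1" using d' P1 by auto
    show "holo_near (pullback \<Phi> J P \<nu>) (sym_dom ?\<Omega>w \<rho>' S d' (\<nu> + 1))" for \<nu>
      using pullback_holo_near[OF P1(6) c d0 big] unfolding holo_near_def by blast
  next
    fix Z and h :: real assume Z: "rel_compact Z S" and h: "0 < h"
    have ZS: "Z \<subseteq> S" using Z closure_subset unfolding rel_compact_def by blast
    have hb: "0 < h / b" using h b0 by simp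
    obtain C where C: "C > 0" "\<And>m z \<zeta> \<eta>. (z, \<zeta>, \<eta>) \<in> sym_dom ?\<Omega>z \<rho> Z d m \<Longrightarrow>
        cmod (\<Sum>\<nu><m. P \<nu> (z, \<zeta>, \<eta>)) \<le> C * A ^ m * exp (h / b * maxnorm \<zeta>)"
      using P1(7)[OF Z hb] by blast
    have "cmod (\<Sum>\<nu><m. pullback \<Phi> J P \<nu> (y, l, \<eta>)) \<le> 2 * C * A ^ m * exp (h * maxnorm l)"
      if p: "(y, l, \<eta>) \<in> sym_dom ?\<Omega>w \<rho>' Z d' m" for m y l \<eta>
    proof (cases "m = 0")
      case True
      then show ?thesis using C(1) by simp
    next
      case False
      have p': "(y, l) \<in> thicken \<rho>' ?\<Omega>w" "\<eta> \<in> Z" using p by (auto simp: sym_dom_def)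
      have y: "y \<in> w ` W" by (rule controlledD(7)[OF c p'(1)])
      let ?fc = "\<lambda>j Q. fiber_coeff (\<lambda>z'. J (\<Phi> y + z', \<Phi> y)) l j (\<lambda>\<zeta>. Q (\<Phi> y, \<zeta>, \<eta>))"
      let ?E = "exp (h * maxnorm l)"
      have sum_P: "?fc j (\<lambda>x. \<Sum>k<i. P k x) = (\<Sum>k<i. ?fc j (P k))" if i: "i \<le> m" for i j
      proof (rule fiber_coeff_sum[OF fiber_germ[OF t y]])
        show "open (\<Inter>k\<in>{..<i}. {\<zeta>. (\<Phi> y, \<zeta>, \<eta>) \<in> N k})"
          by (intro open_INT ballI holo_in_fiber(2)[OF N(1,2)]) simp
        show "holo_on (\<lambda>\<zeta>. P k (\<Phi> y, \<zeta>, \<eta>)) (\<Inter>k\<in>{..<i}. {\<zeta>. (\<Phi> y, \<zeta>, \<eta>) \<in> N k})" if "k \<in> {..<i}" for k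
          by (rule holo_on_subset[OF holo_in_fiber(1)[OF N(1,2)]]) (use that in auto)
        have "(\<Phi> y, transpose (J (\<Phi> y + 0, \<Phi> y)) *v l, \<eta>) \<in> N k" if "k < i" for k
        proof -
          have "(\<Phi> y, 0 + transpose (J (\<Phi> y + 0, \<Phi> y)) *v l, \<eta>) \<in> sym_dom ?\<Omega>z \<rho> Z d (k + 1)"
            by (rule controlled_sym_dom[OF t c big d0 p]) (use that i controlledD(4)[OF c] in auto)
          moreover have "sym_dom ?\<Omega>z \<rho> Z d (k + 1) \<subseteq> sym_dom ?\<Omega>z \<rho> S d (k + 1)"
            using ZS by (intro sym_dom_mono) auto
          ultimately show ?thesis using N(3)[of k] by auto
        qed
        then show "transpose (J (\<Phi> y + 0, \<Phi> y)) *v l \<in> (\<Inter>k\<in>{..<i}. {\<zeta>. (\<Phi> y, \<zeta>, \<eta>) \<in> N k})" by simp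
      qed
      have "(\<Sum>\<nu><m. pullback \<Phi> J P \<nu> (y, l, \<eta>)) = (\<Sum>\<nu><m. \<Sum>j\<le>\<nu>. ?fc j (P (\<nu> - j)))"
        by (simp add: pullback_fiber_coeff)
      \<comment> \<open>collecting the terms with the same \<open>j\<close> yields partial sums of \<open>P\<close>, to which the hypothesis
        applies on the larger domain with index \<open>m - j\<close>\<close>
      also have "\<dots> = (\<Sum>j<m. \<Sum>k<m - j. ?fc j (P k))"
        by (rule sum_triangle_swap[of "\<lambda>j k. ?fc j (P k)"])
      also have "\<dots> = (\<Sum>j<m. ?fc j (\<lambda>x. \<Sum>k<m - j. P k x))"
        by (simp add: sum_P)
      also have "cmod \<dots> \<le> (\<Sum>j<m. C * A ^ m * ?E * (1 / 2) ^ j)"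
      proof (rule sum_norm_le)
        fix j assume j: "j \<in> {..<m}"
        have "cmod (?fc j (\<lambda>x. \<Sum>k<m - j. P k x)) \<le> (A / 2) ^ j * (C * A ^ (m - j) * ?E)"
        proof (rule fiber_coeff_sym_estimate[OF t c big d0 d'(1) p _ _ _ _ \<kappa>, of "m - j"])
          show "cmod \<eta> \<le> 1" using S ZS p'(2) by auto
          show "1 \<le> m" "m - j \<le> m" "j \<le> m" using False j by auto
          show "open (\<Inter>k\<in>{..<m - j}. N k)" by (intro open_INT ballI N(1)) simp
          show "holo_on (\<lambda>x. \<Sum>k<m - j. P k x) (\<Inter>k\<in>{..<m - j}. N k)"
            by (intro holo_on_sum holo_on_subset[OF N(2)]) auto
          have "sym_dom ?\<Omega>z \<rho> Z d (m - j) \<subseteq> N k" if "k < m - j" for k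
          proof -
            have "sym_dom ?\<Omega>z \<rho> Z d (m - j) \<subseteq> sym_dom ?\<Omega>z \<rho> S d (k + 1)"
              using that ZS d0 by (intro sym_dom_mono mult_right_mono) auto
            then show ?thesis using N(3)[of k] by auto
          qed
          then show "sym_dom ?\<Omega>z \<rho> Z d (m - j) \<subseteq> (\<Inter>k\<in>{..<m - j}. N k)" by blast
          fix \<zeta> assume q: "(\<Phi> y, \<zeta>, \<eta>) \<in> sym_dom ?\<Omega>z \<rho> Z d (m - j)" "maxnorm \<zeta> \<le> b * maxnorm l"
          have "h / b * maxnorm \<zeta> \<le> h * maxnorm l"
            using mult_left_mono[OF q(2), of "h / b"] hb b0 by simp
          then have "C * A ^ (m - j) * exp (h / b * maxnorm \<zeta>) \<le> C * A ^ (m - j) * ?E"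
            using C(1) P1(4) by (intro mult_left_mono) auto
          then show "cmod (\<Sum>k<m - j. P k (\<Phi> y, \<zeta>, \<eta>)) \<le> C * A ^ (m - j) * ?E"
            using C(2)[OF q(1)] by simp
        qed
        also have "\<dots> = C * (A ^ j * A ^ (m - j)) * ?E * (1 / 2) ^ j"
          by (simp add: power_divide mult_ac)
        also have "A ^ j * A ^ (m - j) = A ^ m" using j by (simp flip: power_add)
        finally show "cmod (?fc j (\<lambda>x. \<Sum>k<m - j. P k x)) \<le> C * A ^ m * ?E * (1 / 2) ^ j" .
      qed
      also have "\<dots> = C * A ^ m * ?E * (\<Sum>j<m. (1 / 2) ^ j)" by (simp add: sum_distrib_left)
      also have "\<dots> \<le> C * A ^ m * ?E * 2"
        using C(1) P1(4) by (intro mult_left_mono geometric_half_sum) auto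
      finally show ?thesis by (simp add: mult_ac)
    qed
    then show "\<exists>C>0. \<forall>m. \<forall>(z, \<zeta>, \<eta>)\<in>sym_dom ?\<Omega>w \<rho>' Z d' m.
        cmod (\<Sum>\<nu><m. pullback \<Phi> J P \<nu> (z, \<zeta>, \<eta>)) \<le> C * A ^ m * exp (h * maxnorm \<zeta>)"
      using C(1) by (intro exI[of _ "2 * C"]) auto
  qed
qed

lemma pullback_S_hat:
  assumes P: "P \<in> S_hat (in_coords W z \<Omega>) S" and S: "\<And>\<eta>. \<eta> \<in> S \<Longrightarrow> cmod \<eta> \<le> 1"
  shows "pullback \<Phi> J P \<in> S_hat (in_coords W w \<Omega>) S"
proof -
  let ?\<Omega>z = "in_coords W z \<Omega>" and ?\<Omega>w = "in_coords W w \<Omega>"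
  obtain d \<rho> A where P1: "0 < d" "0 < \<rho>" "\<rho> < 1" "0 < A" "A < 1"
    "\<And>\<nu>. holo_near (P \<nu>) (sym_dom ?\<Omega>z \<rho> S d (\<nu> + 1))"
    "\<And>Z h. rel_compact Z S \<Longrightarrow> 0 < h \<Longrightarrow> \<exists>C>0. \<forall>\<nu>. \<forall>(z, \<zeta>, \<eta>)\<in>sym_dom ?\<Omega>z \<rho> Z d (\<nu> + 1).
        cmod (P \<nu> (z, \<zeta>, \<eta>)) \<le> C * A ^ \<nu> * exp (h * maxnorm \<zeta>)"
    and P2: "d_eta P \<in> N_hat ?\<Omega>z S"
    using P unfolding S_hat_def by blast
  obtain \<rho>' \<delta> a b d' where c: "controlled W z w \<Phi> J D \<Omega> \<rho> \<rho>' \<delta> a b" and d': "0 < d'" "0 < \<rho>'" "\<rho>' < 1"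
    and d0: "0 \<le> d * (1 - \<rho>)" and big: "d * (1 - \<rho>) \<le> a * (d' * (1 - \<rho>'))"
    and \<kappa>: "3 * real CARD('n) / (\<delta>\<^sup>2 * (d' * (1 - \<rho>'))) \<le> A / 2"
    using choose_constants[OF P1(1-4)] by blast
  have b0: "0 < b" by (rule controlledD(6)[OF c])
  obtain N where N: "\<And>\<nu>. open (N \<nu>)" "\<And>\<nu>. holo_on (P \<nu>) (N \<nu>)"
    "\<And>\<nu>. sym_dom ?\<Omega>z \<rho> S d (\<nu> + 1) \<subseteq> N \<nu>"
    using holo_near_choice[of P "\<lambda>\<nu>. sym_dom ?\<Omega>z \<rho> S d (\<nu> + 1)", OF P1(6)] by blast
  obtain N' where N': "\<And>\<nu>. open (N' \<nu>)" "\<And>\<nu>. sym_dom ?\<Omega>w \<rho>' S d' (\<nu> + 1) \<subseteq> N' \<nu>"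
    "\<And>\<nu>. holo_on (pullback \<Phi> J P \<nu>) (N' \<nu>)"
    "\<And>\<nu> p. p \<in> N' \<nu> \<Longrightarrow> d_eta (pullback \<Phi> J P) \<nu> p = pullback \<Phi> J (d_eta P) \<nu> p"
    using pullback_holo_near[OF P1(6) c d0 big] by blast
  have deta: "d_eta (pullback \<Phi> J P) \<in> N_hat ?\<Omega>w S"
    by (rule N_hat_cong[OF pullback_N_hat[OF P2 S] d' N'(1,2,4)])
  have est: "\<exists>C>0. \<forall>\<nu>. \<forall>(z, \<zeta>, \<eta>)\<in>sym_dom ?\<Omega>w \<rho>' Z d' (\<nu> + 1).
        cmod (pullback \<Phi> J P \<nu> (z, \<zeta>, \<eta>)) \<le> C * A ^ \<nu> * exp (h * maxnorm \<zeta>)"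
    if Z: "rel_compact Z S" and h: "0 < h" for Z h
  proof -
    have ZS: "Z \<subseteq> S" using Z closure_subset unfolding rel_compact_def by blast
    have hb: "0 < h / b" using h b0 by simp
    obtain C where C: "C > 0" "\<And>\<nu> z \<zeta> \<eta>. (z, \<zeta>, \<eta>) \<in> sym_dom ?\<Omega>z \<rho> Z d (\<nu> + 1) \<Longrightarrow>
        cmod (P \<nu> (z, \<zeta>, \<eta>)) \<le> C * A ^ \<nu> * exp (h / b * maxnorm \<zeta>)"
      using P1(7)[OF Z hb] by blast
    have "cmod (pullback \<Phi> J P \<nu> (y, l, \<eta>)) \<le> 2 * C * A ^ \<nu> * exp (h * maxnorm l)"
      if p: "(y, l, \<eta>) \<in> sym_dom ?\<Omega>w \<rho>' Z d' (\<nu> + 1)" for \<nu> y l \<eta>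
    proof -
      have p': "(y, l) \<in> thicken \<rho>' ?\<Omega>w" "\<eta> \<in> Z" using p by (auto simp: sym_dom_def)
      let ?fc = "\<lambda>j Q. fiber_coeff (\<lambda>z'. J (\<Phi> y + z', \<Phi> y)) l j (\<lambda>\<zeta>. Q (\<Phi> y, \<zeta>, \<eta>))"
      let ?E = "exp (h * maxnorm l)"
      have "cmod (pullback \<Phi> J P \<nu> (y, l, \<eta>)) \<le> (\<Sum>j\<le>\<nu>. C * A ^ \<nu> * ?E * (1 / 2) ^ j)"
        unfolding pullback_fiber_coeff
      proof (rule sum_norm_le)
        fix j assume j: "j \<in> {..\<nu>}"
        have "cmod (?fc j (P (\<nu> - j))) \<le> (A / 2) ^ j * (C * A ^ (\<nu> - j) * ?E)"
        proof (rule fiber_coeff_sym_estimate[OF t c big d0 d'(1) p _ _ _ _ \<kappa>, of "\<nu> - j + 1"])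
          show "cmod \<eta> \<le> 1" using S ZS p'(2) by auto
          show "1 \<le> \<nu> + 1" "\<nu> - j + 1 \<le> \<nu> + 1" "j \<le> \<nu> + 1" using j by auto
          show "open (N (\<nu> - j))" "holo_on (P (\<nu> - j)) (N (\<nu> - j))" by (rule N)+
          have "sym_dom ?\<Omega>z \<rho> Z d (\<nu> - j + 1) \<subseteq> sym_dom ?\<Omega>z \<rho> S d (\<nu> - j + 1)"
            using ZS by (intro sym_dom_mono) auto
          then show "sym_dom ?\<Omega>z \<rho> Z d (\<nu> - j + 1) \<subseteq> N (\<nu> - j)" using N(3) by blast
          fix \<zeta> assume q: "(\<Phi> y, \<zeta>, \<eta>) \<in> sym_dom ?\<Omega>z \<rho> Z d (\<nu> - j + 1)" "maxnorm \<zeta> \<le> b * maxnorm l"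
          have "h / b * maxnorm \<zeta> \<le> h * maxnorm l"
            using mult_left_mono[OF q(2), of "h / b"] hb b0 by simp
          then have "C * A ^ (\<nu> - j) * exp (h / b * maxnorm \<zeta>) \<le> C * A ^ (\<nu> - j) * ?E"
            using C(1) P1(4) by (intro mult_left_mono) auto
          then show "cmod (P (\<nu> - j) (\<Phi> y, \<zeta>, \<eta>)) \<le> C * A ^ (\<nu> - j) * ?E"
            using C(2)[OF q(1)] by simp
        qed
        also have "\<dots> = C * (A ^ j * A ^ (\<nu> - j)) * ?E * (1 / 2) ^ j"
          by (simp add: power_divide mult_ac)
        also have "A ^ j * A ^ (\<nu> - j) = A ^ \<nu>" using j by (simp flip: power_add)
        finally show "cmod (?fc j (P (\<nu> - j))) \<le> C * A ^ \<nu> * ?E * (1 / 2) ^ j" .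
      qed
      also have "\<dots> = C * A ^ \<nu> * ?E * (\<Sum>j<Suc \<nu>. (1 / 2) ^ j)"
        by (simp only: sum_distrib_left lessThan_Suc_atMost)
      also have "\<dots> \<le> C * A ^ \<nu> * ?E * 2"
        using C(1) P1(4) by (intro mult_left_mono geometric_half_sum) auto
      finally show ?thesis by (simp add: mult_ac)
    qed
    then show ?thesis using C(1) by (intro exI[of _ "2 * C"]) auto
  qed
  have near: "holo_near (pullback \<Phi> J P \<nu>) (sym_dom ?\<Omega>w \<rho>' S d' (\<nu> + 1))" for \<nu>
    using N' unfolding holo_near_def by blast
  show ?thesis
    by (rule S_hatI[OF d' P1(4,5) near est deta])
qed

end

section \<open>Identity and composition\<close>

lemma pullback_identity:
  assumes t: "transition W z z (\<lambda>x. x) J D" and x: "x \<in> W"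
    and N: "\<And>k. open (N k)" "\<And>k. holo_on (P k) (N k)" and mem: "\<And>k. k \<le> \<nu> \<Longrightarrow> (z x, l, \<eta>) \<in> N k"
  shows "pullback (\<lambda>x. x) J P \<nu> (z x, l, \<eta>) = P \<nu> (z x, l, \<eta>)"
proof -
  note tD = transitionD[OF t]
  have zx: "z x \<in> z ` W" using x by simp
  have id: "J (z x + z', z x) *v z' = z'" if zD: "z' \<in> {z'. (z x + z', z x) \<in> D}" for z'
  proof -
    obtain x' where "x' \<in> W" "z x + z' = z x'" using zD tD(6) by auto
    moreover from this have "z' = z x' - z x" by (simp add: algebra_simps)
    ultimately show ?thesis using tD(8)[OF x, of x'] zD by simp
  qed
  have "fiber_coeff (\<lambda>z'. J (z x + z', z x)) l j (\<lambda>\<zeta>. P (\<nu> - j) (z x, \<zeta>, \<eta>))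
      = (if j = 0 then P (\<nu> - j) (z x, l, \<eta>) else 0)" for j
    by (rule fiber_coeff_identity[OF fiber_germ[OF t zx] id holo_in_fiber[OF N]])
      (simp_all add: mem)
  then show ?thesis by (simp add: pullback_fiber_coeff)
qed

lemma sum_triangle_rotate:
  fixes g :: "nat \<Rightarrow> nat \<Rightarrow> nat \<Rightarrow> 'a::comm_monoid_add"
  shows "(\<Sum>j\<le>\<nu>. \<Sum>i\<le>\<nu> - j. g j i (\<nu> - j - i)) = (\<Sum>k\<le>\<nu>. \<Sum>j\<le>\<nu> - k. g j (\<nu> - k - j) k)"
proof -
  have "(\<Sum>j\<le>\<nu>. \<Sum>i\<le>\<nu> - j. g j i (\<nu> - j - i))
      = (\<Sum>(j, i)\<in>Sigma {..\<nu>} (\<lambda>j. {..\<nu> - j}). g j i (\<nu> - j - i))"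
    by (simp add: sum.Sigma)
  also have "\<dots> = (\<Sum>(k, j)\<in>Sigma {..\<nu>} (\<lambda>k. {..\<nu> - k}). g j (\<nu> - k - j) k)"
    by (rule sum.reindex_bij_witness[of _ "\<lambda>(k, j). (j, \<nu> - k - j)" "\<lambda>(j, i). (\<nu> - j - i, j)"]) auto
  also have "\<dots> = (\<Sum>k\<le>\<nu>. \<Sum>j\<le>\<nu> - k. g j (\<nu> - k - j) k)" by (simp add: sum.Sigma)
  finally show ?thesis .
qed

text \<open>At the level of formal series the two transformations agree exactly, at every point where the
  coefficients of \<open>P\<close> involved are holomorphic.\<close>

lemma pullback_compose:
  assumes tzw: "transition W z w \<Phi> J D" and twv: "transition W w v \<Psi> J' D'"
    and tzv: "transition W z v (\<Phi> \<circ> \<Psi>) J'' D''" and x: "x \<in> W"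
    and N: "\<And>k. open (N k)" "\<And>k. holo_on (P k) (N k)"
    and mem: "\<And>k. k \<le> \<nu> \<Longrightarrow> (z x, transpose (J'' (z x, z x)) *v \<xi>, \<eta>) \<in> N k"
  shows "pullback \<Psi> J' (pullback \<Phi> J P) \<nu> (v x, \<xi>, \<eta>) = pullback (\<Phi> \<circ> \<Psi>) J'' P \<nu> (v x, \<xi>, \<eta>)"
proof -
  note a = transitionD[OF tzw] and b = transitionD[OF twv] and c = transitionD[OF tzv]
  have base: "\<Psi> (v x) = w x" "\<Phi> (w x) = z x" using a(3) b(3) x by auto
  define G where "G = (\<lambda>z'. J (z x + z', z x))"
  define H where "H = (\<lambda>y'. J' (w x + y', w x))"
  define M where "M = (\<lambda>z'. J'' (z x + z', z x))"
  define NG where "NG = {z'. (z x + z', z x) \<in> D}"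
  define NH where "NH = {y'. (w x + y', w x) \<in> D'}"
  define NM where "NM = {z'. (z x + z', z x) \<in> D''}"
  have G: "holo_on G NG" "open NG" "0 \<in> NG"
    using fiber_germ[OF tzw, of "w x"] x base by (simp_all add: G_def NG_def)
  have H: "holo_on H NH" "open NH" "0 \<in> NH"
    using fiber_germ[OF twv, of "v x"] x base by (simp_all add: H_def NH_def)
  have M: "holo_on M NM" "open NM" "0 \<in> NM"
    using fiber_germ[OF tzv, of "v x"] x base by (simp_all add: M_def NM_def)
  define NN where "NN = {z' \<in> NG \<inter> NM. G z' *v z' \<in> NH}"
  have sub: "NN \<subseteq> NG" "NN \<subseteq> NM" by (auto simp: NN_def)
  have hGz: "holo_on (\<lambda>z'. G z' *v z') (NG \<inter> NM)"
    by (intro holo_on_matrix_vector holo_on_subset[OF G(1)] holo_on_id) auto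
  have NN: "open NN" unfolding NN_def
    by (rule open_preimage_holo[OF hGz _ H(2)]) (intro open_Int G M)
  have NN0: "0 \<in> NN" using G(3) M(3) H(3) by (simp add: NN_def)
  have G': "holo_on G NN" and M': "holo_on M NN"
    using G(1) M(1) sub by (auto intro: holo_on_subset)
  have comp1: "G z' *v z' \<in> NH" if "z' \<in> NN" for z' using that by (simp add: NN_def)
  have comp2: "H (G z' *v z') *v (G z' *v z') = M z' *v z'" if z': "z' \<in> NN" for z'
  proof -
    have inD: "(z x + z', z x) \<in> D" "(z x + z', z x) \<in> D''" using z' by (auto simp: NN_def NG_def NM_def)
    then obtain x' where x': "x' \<in> W" "z x + z' = z x'" using a(6) by auto
    then have z'_eq: "z' = z x' - z x" by (simp add: algebra_simps)
    have Gz: "G z' *v z' = w x' - w x"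
      using a(8)[OF x x'(1)] inD(1) x'(2) by (simp add: G_def z'_eq)
    have "(w x', w x) \<in> D'" using comp1[OF z'] by (simp add: Gz NH_def)
    then have "H (G z' *v z') *v (G z' *v z') = v x' - v x"
      using b(8)[OF x x'(1)] by (simp add: Gz H_def)
    also have "\<dots> = M z' *v z'"
      using c(8)[OF x x'(1)] inD(2) x'(2) by (simp add: M_def z'_eq)
    finally show ?thesis .
  qed
  let ?f = "\<lambda>k \<zeta>. P k (z x, \<zeta>, \<eta>)"
  let ?U = "\<lambda>k. {\<zeta>. (z x, \<zeta>, \<eta>) \<in> N k}"
  have U: "open (?U k)" "holo_on (?f k) (?U k)" for k
    using holo_in_fiber[OF N] by auto
  have MU: "transpose (M 0) *v \<xi> \<in> ?U k" if "k \<le> \<nu>" for k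
    using mem[OF that] by (simp add: M_def)
  let ?\<mu>0 = "transpose (H 0) *v \<xi>"
  have GU: "transpose (G 0) *v ?\<mu>0 = transpose (M 0) *v \<xi>"
    by (rule compose_at_zero[OF G' NN NN0 H M' comp1 comp2])
  define V where "V = (\<Inter>k\<in>{..\<nu>}. {\<mu>. transpose (G 0) *v \<mu> \<in> ?U k})"
  have V: "open V" unfolding V_def by (intro open_INT ballI open_fiber_preimage U) simp
  have V0: "?\<mu>0 \<in> V" using MU by (simp add: V_def GU)
  have outer: "fiber_coeff H \<xi> j (\<lambda>\<mu>. pullback \<Phi> J P (\<nu> - j) (w x, \<mu>, \<eta>))
      = (\<Sum>i\<le>\<nu> - j. fiber_coeff H \<xi> j (\<lambda>\<mu>. fiber_coeff G \<mu> i (?f (\<nu> - j - i))))" for j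
  proof -
    have "(\<lambda>\<mu>. pullback \<Phi> J P (\<nu> - j) (w x, \<mu>, \<eta>))
        = (\<lambda>\<mu>. \<Sum>i\<le>\<nu> - j. fiber_coeff G \<mu> i (?f (\<nu> - j - i)))"
      by (simp add: pullback_fiber_coeff base G_def)
    moreover have "fiber_coeff H \<xi> j (\<lambda>\<mu>. \<Sum>i\<le>\<nu> - j. fiber_coeff G \<mu> i (?f (\<nu> - j - i)))
        = (\<Sum>i\<le>\<nu> - j. fiber_coeff H \<xi> j (\<lambda>\<mu>. fiber_coeff G \<mu> i (?f (\<nu> - j - i))))"
    proof (rule fiber_coeff_sum[OF H V V0])
      fix i
      show "holo_on (\<lambda>\<mu>. fiber_coeff G \<mu> i (?f (\<nu> - j - i))) V"
        by (rule holo_on_subset[OF holo_fiber_coeff[OF G U(2,1)]]) (auto simp: V_def)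
    qed
    ultimately show ?thesis by simp
  qed
  have "pullback \<Psi> J' (pullback \<Phi> J P) \<nu> (v x, \<xi>, \<eta>)
      = (\<Sum>j\<le>\<nu>. fiber_coeff H \<xi> j (\<lambda>\<mu>. pullback \<Phi> J P (\<nu> - j) (w x, \<mu>, \<eta>)))"
    by (simp add: pullback_fiber_coeff[of \<Psi>] base H_def)
  also have "\<dots> = (\<Sum>j\<le>\<nu>. \<Sum>i\<le>\<nu> - j. fiber_coeff H \<xi> j (\<lambda>\<mu>. fiber_coeff G \<mu> i (?f (\<nu> - j - i))))"
    by (simp only: outer)
  also have "\<dots> = (\<Sum>k\<le>\<nu>. \<Sum>j\<le>\<nu> - k. fiber_coeff H \<xi> j (\<lambda>\<mu>. fiber_coeff G \<mu> (\<nu> - k - j) (?f k)))"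
    by (rule sum_triangle_rotate[of "\<lambda>j i k. fiber_coeff H \<xi> j (\<lambda>\<mu>. fiber_coeff G \<mu> i (?f k))"])
  also have "\<dots> = (\<Sum>k\<le>\<nu>. fiber_coeff M \<xi> (\<nu> - k) (?f k))"
    by (intro sum.cong refl fiber_coeff_compose[OF G' NN NN0 H M' comp1 comp2 U(2,1) MU]) simp_all
  also have "\<dots> = (\<Sum>j\<le>\<nu>. fiber_coeff M \<xi> j (?f (\<nu> - j)))"
    by (rule sum.reindex_bij_witness[of _ "\<lambda>j. \<nu> - j" "\<lambda>j. \<nu> - j"]) auto
  also have "\<dots> = pullback (\<Phi> \<circ> \<Psi>) J'' P \<nu> (v x, \<xi>, \<eta>)"
    by (simp add: pullback_fiber_coeff base M_def)
  finally show ?thesis .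
qed

lemma open_in_coords:
  assumes z: "local_coords W z" and \<Omega>: "open \<Omega>"
  shows "open (in_coords W z \<Omega>)"
proof -
  note l = local_coordsD[OF z]
  let ?x = "\<lambda>p. inv_into W z (fst p)"
  let ?X = "z ` W \<times> (UNIV :: (complex^'a) set)"
  have hx: "holo_on ?x ?X"
    by (rule holo_on_compose[OF _ l(5)], intro holo_on_fst holo_on_id) auto
  have xW: "?x p \<in> W" if "p \<in> ?X" for p using that by (auto simp: inv_into_into)
  let ?g = "\<lambda>p. (?x p, transpose (matrix (frechet_derivative z (at (?x p)))) *v snd p)"
  have "holo_on (\<lambda>p. (\<chi> i. \<Sum>j\<in>UNIV. dird (axis i 1) (\<lambda>x. z x $ j) (?x p) * snd p $ j)) ?X"
  proof (rule holo_on_vec)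
    fix i
    have "holo_on (\<lambda>p. dird (axis i 1) (\<lambda>x. z x $ j) (?x p)) ?X" for j
      by (rule holo_on_compose[OF hx holo_on_dird[OF holo_on_nth[OF l(3)] l(1)] xW])
    then show "holo_on (\<lambda>p. (\<chi> i. \<Sum>j\<in>UNIV. dird (axis i 1) (\<lambda>x. z x $ j) (?x p) * snd p $ j) $ i) ?X"
      unfolding vec_lambda_beta by (intro holo_on_sum holo_on_mult holo_on_nth holo_on_snd holo_on_id)
  qed
  from holo_on_Pair[OF hx this] have hg: "holo_on ?g ?X"
  proof (rule holo_on_cong[rotated 2])
    show "open ?X" using l(4) by (intro open_Times open_UNIV)
    show "(?x p, (\<chi> i. \<Sum>j\<in>UNIV. dird (axis i 1) (\<lambda>x. z x $ j) (?x p) * snd p $ j)) = ?g p" if "p \<in> ?X" for p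
      by (simp add: vec_eq_iff matrix_vector_mult_def transpose_def matrix_def frechet_holo(3)[OF l(3) xW[OF that]])
  qed
  have "in_coords W z \<Omega> = {p \<in> ?X. ?g p \<in> \<Omega>}"
    using l(2) by (auto simp: in_coords_def)
  then show ?thesis
    using open_preimage_holo[OF hg _ \<Omega>] l(4) by (simp add: open_Times)
qed

lemma fiber_conic_in_coords:
  assumes "fiber_conic \<Omega>" shows "fiber_conic (in_coords W z \<Omega>)"
  using assms unfolding fiber_conic_def in_coords_def by (fastforce simp: matrix_vector_scaleR)

lemma conically_rel_compact_base:
  assumes "conically_rel_compact \<Omega> UNIV"
  shows "compact (closure (fst ` \<Omega>))"
proof -
  obtain K where K: "compact K" "\<Omega> \<subseteq> {(x, c *\<^sub>R \<xi>) | x \<xi> c. (x, \<xi>) \<in> K \<and> 0 < (c::real)}"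
    using assms unfolding conically_rel_compact_def by blast
  have "compact (fst ` K)" by (intro compact_continuous_image continuous_intros K)
  moreover have "fst ` \<Omega> \<subseteq> fst ` K" using K(2) by force
  ultimately have "bounded (fst ` \<Omega>)" by (rule bounded_subset[OF compact_imp_bounded])
  then show ?thesis by simp
qed

theorem theorem7p13:
  fixes \<Omega> :: "((complex^'n) \<times> (complex^'n)) set"
    and W :: "(complex^'n) set"
    and z w \<Phi> :: "complex^'n \<Rightarrow> complex^'n"
    and J :: "(complex^'n) \<times> (complex^'n) \<Rightarrow> complex^'n^'n"
    and r \<theta> :: real
  assumes "0 < r" "r < 1/2" "0 < \<theta>" "\<theta> < 1/2"
    and "open \<Omega>" "fiber_conic \<Omega>" "conically_rel_compact \<Omega> UNIV"
    and "closure (fst ` \<Omega>) \<subseteq> W" "local_coords W z" "local_coords W w"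
    and "\<forall>x\<in>W. z x = \<Phi> (w x)"
    and "is_Jstar (w ` W) \<Phi> J"
  shows "(\<forall>P\<in>S_hat (in_coords W z \<Omega>) (sector r \<theta>).
            pullback \<Phi> J P \<in> S_hat (in_coords W w \<Omega>) (sector r \<theta>))
      \<and> (\<forall>P\<in>N_hat (in_coords W z \<Omega>) (sector r \<theta>).
            pullback \<Phi> J P \<in> N_hat (in_coords W w \<Omega>) (sector r \<theta>))
      \<and> (\<forall>J\<^sub>1. is_Jstar (z ` W) (\<lambda>x. x) J\<^sub>1 \<longrightarrow>
          (\<forall>P\<in>S_hat (in_coords W z \<Omega>) (sector r \<theta>).
            same_series (in_coords W z \<Omega>) (sector r \<theta>) (pullback (\<lambda>x. x) J\<^sub>1 P) P))
      \<and> (\<forall>v \<Psi> J\<^sub>\<Psi> J\<^sub>\<Phi>\<^sub>\<Psi>. local_coords W v \<longrightarrow> (\<forall>x\<in>W. w x = \<Psi> (v x)) \<longrightarrow>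
          is_Jstar (v ` W) \<Psi> J\<^sub>\<Psi> \<longrightarrow> is_Jstar (v ` W) (\<Phi> \<circ> \<Psi>) J\<^sub>\<Phi>\<^sub>\<Psi> \<longrightarrow>
          (\<forall>P\<in>S_hat (in_coords W z \<Omega>) (sector r \<theta>). \<forall>p\<in>in_coords W v \<Omega>.
            (\<lambda>\<nu> q. pullback \<Psi> J\<^sub>\<Psi> (pullback \<Phi> J P) \<nu> q - pullback (\<Phi> \<circ> \<Psi>) J\<^sub>\<Phi>\<^sub>\<Psi> P \<nu> q)
              \<in> N_hat_germ p))"
proof -
  let ?S = "sector r \<theta>"
  obtain D where t: "transition W z w \<Phi> J D"
    by (rule is_Jstar_imp_transition[OF assms(9-12)])
  have B: "compact (closure (fst ` \<Omega>))" by (rule conically_rel_compact_base[OF assms(7)])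
  have S1: "cmod \<eta> \<le> 1" if "\<eta> \<in> ?S" for \<eta> using that assms(2) by (simp add: sector_def)
  have near: "\<exists>d \<rho>. 0 < d \<and> 0 < \<rho> \<and> \<rho> < 1 \<and> (\<forall>\<nu>. holo_near (P \<nu>) (sym_dom (in_coords W z \<Omega>) \<rho> ?S d (\<nu> + 1)))"
    if "P \<in> S_hat (in_coords W z \<Omega>) ?S" for P
    using that unfolding S_hat_def by blast
  have identity: "same_series (in_coords W z \<Omega>) ?S (pullback (\<lambda>x. x) J1 P) P"
    if J1: "is_Jstar (z ` W) (\<lambda>x. x) J1" and P: "P \<in> S_hat (in_coords W z \<Omega>) ?S" for J1 P
  proof -
    obtain D1 where t1: "transition W z z (\<lambda>x. x) J1 D1"
      by (rule is_Jstar_imp_transition[OF assms(9,9) _ J1]) auto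
    obtain d \<rho> where d: "0 < d" "0 < \<rho>" "\<rho> < 1"
      and hn: "\<And>\<nu>. holo_near (P \<nu>) (sym_dom (in_coords W z \<Omega>) \<rho> ?S d (\<nu> + 1))"
      using near[OF P] by blast
    obtain N where N: "\<And>\<nu>. open (N \<nu>)" "\<And>\<nu>. holo_on (P \<nu>) (N \<nu>)"
      "\<And>\<nu>. sym_dom (in_coords W z \<Omega>) \<rho> ?S d (\<nu> + 1) \<subseteq> N \<nu>"
      using holo_near_choice[of P "\<lambda>\<nu>. sym_dom (in_coords W z \<Omega>) \<rho> ?S d (\<nu> + 1)", OF hn] by blast
    obtain \<rho>' \<delta> a b where c: "controlled W z z (\<lambda>x. x) J1 D1 \<Omega> \<rho> \<rho>' \<delta> a b"
      by (rule transition_controlled[OF t1 B assms(8) d(2)])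
    note c' = controlledD[OF c]
    define M where "M = (\<lambda>\<nu>. (z ` W \<times> UNIV) \<inter> (\<Inter>k\<in>{..\<nu>}. N k))"
    have M: "open (M \<nu>)" for \<nu>
      unfolding M_def using local_coordsD(4)[OF assms(9)]
      by (intro open_Int open_Times open_UNIV open_INT ballI N(1)) simp_all
    have PM: "holo_on (P \<nu>) (M \<nu>)" for \<nu>
      by (rule holo_on_subset[OF N(2)]) (auto simp: M_def)
    have eq: "pullback (\<lambda>x. x) J1 P \<nu> p = P \<nu> p" if pM: "p \<in> M \<nu>" for \<nu> p
    proof -
      obtain x l \<eta> where p: "p = (z x, l, \<eta>)" "x \<in> W" using pM by (cases p) (auto simp: M_def)
      show ?thesis unfolding p(1)
        by (rule pullback_identity[OF t1 p(2) N(1,2)]) (use pM p(1) in \<open>auto simp: M_def\<close>)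
    qed
    have sub: "sym_dom (in_coords W z \<Omega>) \<rho>' ?S d (\<nu> + 1) \<subseteq> M \<nu>" for \<nu>
    proof
      fix p assume p: "p \<in> sym_dom (in_coords W z \<Omega>) \<rho>' ?S d (\<nu> + 1)"
      have "p \<in> N k" if "k \<le> \<nu>" for k
      proof -
        have "real (k + 1) * (d * (1 - \<rho>)) \<le> real (\<nu> + 1) * (d * (1 - \<rho>'))"
          using that d c'(3) by (intro mult_mono) auto
        then have "sym_dom (in_coords W z \<Omega>) \<rho>' ?S d (\<nu> + 1) \<subseteq> sym_dom (in_coords W z \<Omega>) \<rho> ?S d (k + 1)"
          by (rule sym_dom_mono[OF c'(3) subset_refl])
        then show ?thesis using p N(3)[of k] by blast
      qed
      moreover have "fst p \<in> z ` W" using p c'(7) by (auto simp: sym_dom_def)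
      ultimately show "p \<in> M \<nu>" by (cases p) (auto simp: M_def)
    qed
    have PM': "holo_on (pullback (\<lambda>x. x) J1 P \<nu>) (M \<nu>)" for \<nu>
      by (rule holo_on_cong[OF M _ PM]) (simp add: eq)
    have "holo_near (pullback (\<lambda>x. x) J1 P \<nu>) (sym_dom (in_coords W z \<Omega>) \<rho>' ?S d (\<nu> + 1)) \<and>
        holo_near (P \<nu>) (sym_dom (in_coords W z \<Omega>) \<rho>' ?S d (\<nu> + 1)) \<and>
        (\<forall>p\<in>sym_dom (in_coords W z \<Omega>) \<rho>' ?S d (\<nu> + 1). pullback (\<lambda>x. x) J1 P \<nu> p = P \<nu> p)" for \<nu>
      unfolding holo_near_def using M[of \<nu>] PM[of \<nu>] PM'[of \<nu>] sub[of \<nu>] eq[of _ \<nu>] by blast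
    then show ?thesis unfolding same_series_def using d(1) c'(1,2) by blast
  qed
  have composition: "(\<lambda>\<nu> q. pullback \<Psi> J\<Psi> (pullback \<Phi> J P) \<nu> q - pullback (\<Phi> \<circ> \<Psi>) J\<Phi>\<Psi> P \<nu> q) \<in> N_hat_germ p"
    if v: "local_coords W v" and wv: "\<forall>x\<in>W. w x = \<Psi> (v x)" and J\<Psi>: "is_Jstar (v ` W) \<Psi> J\<Psi>"
      and J\<Phi>\<Psi>: "is_Jstar (v ` W) (\<Phi> \<circ> \<Psi>) J\<Phi>\<Psi>" and P: "P \<in> S_hat (in_coords W z \<Omega>) ?S"
      and p: "p \<in> in_coords W v \<Omega>" for v \<Psi> J\<Psi> J\<Phi>\<Psi> P p
  proof -
    obtain D' where t': "transition W w v \<Psi> J\<Psi> D'"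
      by (rule is_Jstar_imp_transition[OF assms(10) v wv J\<Psi>])
    have zv: "\<forall>x\<in>W. z x = (\<Phi> \<circ> \<Psi>) (v x)" using assms(11) wv by simp
    obtain D'' where t'': "transition W z v (\<Phi> \<circ> \<Psi>) J\<Phi>\<Psi> D''"
      by (rule is_Jstar_imp_transition[OF assms(9) v zv J\<Phi>\<Psi>])
    obtain d \<rho> where d: "0 < d" "0 < \<rho>" "\<rho> < 1"
      and hn: "\<And>\<nu>. holo_near (P \<nu>) (sym_dom (in_coords W z \<Omega>) \<rho> ?S d (\<nu> + 1))"
      using near[OF P] by blast
    obtain N where N: "\<And>\<nu>. open (N \<nu>)" "\<And>\<nu>. holo_on (P \<nu>) (N \<nu>)"
      "\<And>\<nu>. sym_dom (in_coords W z \<Omega>) \<rho> ?S d (\<nu> + 1) \<subseteq> N \<nu>"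
      using holo_near_choice[of P "\<lambda>\<nu>. sym_dom (in_coords W z \<Omega>) \<rho> ?S d (\<nu> + 1)", OF hn] by blast
    obtain \<rho>' \<delta> a b d' where c: "controlled W z v (\<Phi> \<circ> \<Psi>) J\<Phi>\<Psi> D'' \<Omega> \<rho> \<rho>' \<delta> a b"
      and d': "0 < d'" "0 < \<rho>'" "\<rho>' < 1"
      and d0: "0 \<le> d * (1 - \<rho>)" and big: "d * (1 - \<rho>) \<le> a * (d' * (1 - \<rho>'))"
      by (rule choose_constants[OF t'' B assms(8) d zero_less_one]) (rule that)
    have eq: "pullback \<Psi> J\<Psi> (pullback \<Phi> J P) \<nu> q - pullback (\<Phi> \<circ> \<Psi>) J\<Phi>\<Psi> P \<nu> q = 0"
      if qM: "q \<in> pull_nhd W v (\<Phi> \<circ> \<Psi>) J\<Phi>\<Psi> N \<nu>" for \<nu> q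
    proof -
      obtain x \<xi> \<eta> where q: "q = (v x, \<xi>, \<eta>)" "x \<in> W"
        using qM by (cases q) (auto simp: pull_nhd_def[OF t''])
      have "pullback \<Psi> J\<Psi> (pullback \<Phi> J P) \<nu> q = pullback (\<Phi> \<circ> \<Psi>) J\<Phi>\<Psi> P \<nu> q"
        unfolding q(1)
      proof (rule pullback_compose[OF t t' t'' q(2) N(1,2)])
        fix k assume "k \<le> \<nu>"
        then show "(z x, transpose (J\<Phi>\<Psi> (z x, z x)) *v \<xi>, \<eta>) \<in> N k"
          using qM q transitionD(3)[OF t'' q(2)] by (auto simp: pull_nhd_def[OF t''] pull_arg_def)
      qed
      then show ?thesis by simp
    qed
    have "(\<lambda>\<nu> q. pullback \<Psi> J\<Psi> (pullback \<Phi> J P) \<nu> q - pullback (\<Phi> \<circ> \<Psi>) J\<Phi>\<Psi> P \<nu> q)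
        \<in> N_hat (in_coords W v \<Omega>) ?S"
      by (rule N_hat_cong[OF zero_in_N_hat d' open_pull_nhd[OF t'' N(1)]
            pull_nhd_sym_dom[OF t'' c big d0 N(3)] eq])
    then show ?thesis
      unfolding N_hat_germ_def
      using open_in_coords[OF v assms(5)] fiber_conic_in_coords[OF assms(6)] p assms(1-4) by blast
  qed
  show ?thesis
    by (intro conjI ballI allI impI)
      (assumption | rule pullback_S_hat[OF t B assms(8) _ S1] pullback_N_hat[OF t B assms(8) _ S1]
        identity composition)+
qed

end
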